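(* Let $\phi_s,\phi_{ns}:\mathbb{R}^N\to\mathbb{R}^N$ and $\zeta:\mathbb{R}^N\to\mathbb{R}$ be of class $C^2$, let $F(U)=\phi_s(U)+\zeta(U)\phi_{ns}(U)$, and assume $F(\vec 0)=\vec 0$, $\zeta(\vec 0)=0$. Let $\mathcal S=\{U:\zeta(U)=0\}$ and let $\delta>0$ be the (sufficiently small) cut-off constant. Assume: (i) only initial data with $\zeta(U(0))>0$ are considered for $dU/d\tau=F(U)$; (ii) $F(U)=\vec 0$ whenever $|U|\ge 2\delta$; (iii) all eigenvalues of the Jacobian $DF(\vec 0)$ have non positive real part; (iv) $\nabla\zeta(\vec 0)\neq\vec 0$; (v) for every center manifold $\mathcal M^c$ of $dU/d\tau=F(U)$ around $\vec 0$, if $|U|\le\delta$ and $U\in\mathcal M^c\cap\mathcal S$, then $F(U)=\vec 0$; (vi) there is a manifold $\mathcal M^{eq}$ of equilibria of $dU/d\tau=F(U)$ which contains $\vec 0$ and is transversal to $\mathcal S$ (that is, $\mathcal S\cap\mathcal M^{eq}$ is a manifold of dimension $\dim\mathcal M^{eq}-1$); (vii) $\nabla\zeta(U)\cdot F(U)=0$ for every $U\in\mathcal S$; (viii) if $U\in\mathcal S$ and $F(U)=\vec 0$, then $G(U)=0$, where $G$ is the extension by continuity to $\mathcal S$ of $\nabla\zeta(U)\cdot F(U)/\zeta(U)$. In the coordinates $(\zeta,u_0,u_-)$ described in the context, consider the singular system $$(\ast\ast)\quad\begin{cases}\dfrac{d\zeta}{dt}=\zeta\,G_{10}(\zeta,u_0)u_0+G_{1-}(\zeta,u_0,u_-)u_-\\[4pt]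 \dfrac{du_0}{dt}=\big\{G_{01}(\zeta,u_0)+[G_{0-}(\zeta,u_0,u_-)-G_{0-}(\zeta,u_0,\vec 0)]\big\}u_0\\[4pt] \dfrac{du_-}{dt}=\dfrac1\zeta\,G_s(\zeta,u_0,u_-)u_-.\end{cases}$$ Then there exists an invariant center manifold $\mathcal M^{00}$ for system $(\ast\ast)$ around the equilibrium point $(0,\vec 0,\vec 0)$ which is contained in the manifold of slow dynamics $\{u_-=\vec 0\}$. In particular, system $(\ast\ast)$ restricted to $\mathcal M^{00}$ is non singular and every solution on it satisfies the following property: if $\zeta(0)>0$, then $\zeta(t)>0$ for every $t$.
   Context: Cut-off convention: the vector field is multiplied by a smooth scalar cut-off function equal to $1$ for $|U|\le\delta$ and to $0$ for $|U|\ge2\delta$; the resulting field is still denoted $F$. Coordinates: let $n_-$ be the number of eigenvalues of $DF(\vec 0)$ with strictly negative real part and $n_0+1$ the number with zero real part (counted with multiplicity), $N=n_-+n_0+1$. Under the hypotheses listed, for $\delta$ small there is a continuously differentiable local diffeomorphism $U\mapsto(\zeta,u_0,u_-)\in\mathbb R\times\mathbb R^{n_0}\times\mathbb R^{n_-}$ (with $\zeta$ the value of the function $\zeta$ at the point), defined in the ball of radius $\delta$ centered at the origin, which transforms $dU/d\tau=F(U)$ into $$\begin{cases} d\zeta/d\tau=G_{10}(\zeta,u_0)u_0\,\zeta^2+G_{1-}(\zeta,u_0,u_-)u_-\,\zeta\\ du_0/d\tau=\big\{G_{01}(\zeta,u_0)+[G_{0-}(\zeta,u_0,u_-)-G_{0-}(\zeta,u_0,\vec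 0)]\big\}\zeta u_0\\ du_-/d\tau=G_s(\zeta,u_0,u_-)u_-\end{cases}$$ with $G_{10}$ a row vector in $\mathbb R^{n_0}$, $G_{1-}$ a row vector in $\mathbb R^{n_-}$, $G_{01},G_{0-}$ being $n_0\times n_0$ matrices, $G_s$ an $n_-\times n_-$ matrix, and all eigenvalues of $G_s(0,\vec 0,\vec 0)$ having strictly negative real part. A center manifold of this $\tau$-system is $\{u_-=\vec 0\}$; it is called the manifold of slow dynamics. System $(\ast\ast)$ is the singular equation $dU/dt=F(U)/\zeta(U)$ in these coordinates. Center manifold of the singular system: by definition, a center manifold of $(\ast\ast)$ around $(0,\vec 0,\vec 0)$ is a center manifold, around the equilibrium $(0,\vec 0,\vec 0)$, of the non singular system obtained by reduction to the manifold of slow dynamics, $$d\zeta/dt=\zeta\,G_{10}(\zeta,u_0)u_0,\qquad du_0/dt=G_{01}(\zeta,u_0)u_0,\qquad u_-\equiv\vec 0 .$$ *)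

theory Defs
  imports "HOL-Analysis.Analysis" "HOL-Computational_Algebra.Polynomial"
begin

section \<open>Regularity, diffeomorphisms, submanifolds\<close>

text \<open>
  For an open set (or a relatively open subset of a linear subspace) this is ordinary
  continuous differentiability. On a subset of a proper subspace the derivative is not unique,
  hence the existential quantifier.
\<close>

definition C1_on :: "'a::real_normed_vector set \<Rightarrow> ('a \<Rightarrow> 'b::real_normed_vector) \<Rightarrow> bool" where
  "C1_on S f \<longleftrightarrow>
     (\<exists>f' :: 'a \<Rightarrow> 'a \<Rightarrow>\<^sub>L 'b.
        (\<forall>x\<in>S. (f has_derivative blinfun_apply (f' x)) (at x within S)) \<and> continuous_on S f')"

definition C2_on :: "'a::real_normed_vector set \<Rightarrow> ('a \<Rightarrow> 'b::real_normed_vector) \<Rightarrow> bool" where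
  "C2_on S f \<longleftrightarrow>
     (\<exists>f' :: 'a \<Rightarrow> 'a \<Rightarrow>\<^sub>L 'b.
        (\<forall>x\<in>S. (f has_derivative blinfun_apply (f' x)) (at x within S)) \<and> C1_on S f')"

definition grad :: "(real^'n \<Rightarrow> real) \<Rightarrow> real^'n \<Rightarrow> real^'n" where
  "grad f x = (\<chi> i. frechet_derivative f (at x) (axis i 1))"

definition C1_diffeo :: "'a::euclidean_space set \<Rightarrow> 'a set \<Rightarrow> ('a \<Rightarrow> 'a) \<Rightarrow> bool" where
  "C1_diffeo U V \<phi> \<longleftrightarrow>
     open U \<and> open V \<and> bij_betw \<phi> U V \<and> C1_on U \<phi> \<and> C1_on V (inv_into U \<phi>)"

definition submanifold :: "nat \<Rightarrow> 'a::euclidean_space set \<Rightarrow> bool" where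
  "submanifold d M \<longleftrightarrow>
     (\<forall>p\<in>M. \<exists>U V \<phi> L. p \<in> U \<and> C1_diffeo U V \<phi> \<and> subspace L \<and> dim L = d
        \<and> \<phi> ` (U \<inter> M) = V \<inter> L)"

section \<open>Index blocks\<close>

text \<open>
  For a set J of indices, the space of vectors with card J components is identified with the
  coordinate subspace of vectors whose support lies in J. The splitting of the N-dimensional
  space into the coordinates (zeta, u0, u-) is then a partition of the N indices into a single
  index k, a block I of size n0 and a block J of size n-; both n0 = 0 and n- = 0 are possible.
\<close>

definition coord_space :: "'n set \<Rightarrow> ('a::zero^'n) set" where
  "coord_space J = {v. \<forall>i. i \<notin> J \<longrightarrow> v $ i = 0}"

definition blk :: "'n set \<Rightarrow> real^'n \<Rightarrow> real^'n" where
  "blk J x = (\<chi> i. if i \<in> J then x $ i else 0)"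

section \<open>Spectral notions for real matrices\<close>

definition complex_block :: "'n set \<Rightarrow> real^'n^'n \<Rightarrow> complex^'n^'n" where
  "complex_block J A = (\<chi> i j. if i \<in> J \<and> j \<in> J then complex_of_real (A $ i $ j) else 0)"

text \<open>Complex eigenvalues of the J-by-J submatrix of A.\<close>

definition eigenvalues_on :: "'n::finite set \<Rightarrow> real^'n^'n \<Rightarrow> complex set" where
  "eigenvalues_on J A =
     {\<mu>. \<exists>v\<in>coord_space J. v \<noteq> 0 \<and> complex_block J A *v v = \<mu> *s v}"

definition charpoly :: "real^'n::finite^'n \<Rightarrow> complex poly" where
  "charpoly A =
     det (\<chi> i j. if i = j then [:- complex_of_real (A $ i $ j), 1:]
                  else [:- complex_of_real (A $ i $ j):])"

text \<open>The number of eigenvalues with property P, counted with algebraic multiplicity.\<close>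

definition num_eigenvalues :: "(complex \<Rightarrow> bool) \<Rightarrow> real^'n::finite^'n \<Rightarrow> nat" where
  "num_eigenvalues P A = size (filter_mset P (proots (charpoly A)))"

text \<open>
  The real invariant subspace belonging to the eigenvalues of the J-by-J submatrix that satisfy P
  (P is always invariant under conjugation below): the span of the real parts of all generalized
  eigenvectors. Imaginary parts are included, since v can be multiplied by the imaginary unit.
\<close>

definition spectral_space :: "'n::finite set \<Rightarrow> (complex \<Rightarrow> bool) \<Rightarrow> real^'n^'n \<Rightarrow> (real^'n) set" where
  "spectral_space J P A =
     span {x. \<exists>v\<in>coord_space J. \<exists>\<mu> m. P \<mu>
              \<and> ((\<lambda>w. complex_block J A *v w - \<mu> *s w) ^^ m) v = 0
              \<and> x = (\<chi> i. Re (v $ i))}"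

abbreviation center_space :: "'n::finite set \<Rightarrow> real^'n^'n \<Rightarrow> (real^'n) set" where
  "center_space J \<equiv> spectral_space J (\<lambda>\<mu>. Re \<mu> = 0)"

abbreviation hyperbolic_space :: "'n::finite set \<Rightarrow> real^'n^'n \<Rightarrow> (real^'n) set" where
  "hyperbolic_space J \<equiv> spectral_space J (\<lambda>\<mu>. Re \<mu> \<noteq> 0)"

section \<open>Solutions, local invariance, center manifolds\<close>

text \<open>
  x is a solution of x' = f x on the open time interval T, which contains the initial time 0,
  with values in D.
\<close>

definition solution :: "'a::real_normed_vector set \<Rightarrow> ('a \<Rightarrow> 'a) \<Rightarrow> real set \<Rightarrow> (real \<Rightarrow> 'a) \<Rightarrow> bool" where
  "solution D f T x \<longleftrightarrow>
     open T \<and> is_interval T \<and> 0 \<in> T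
     \<and> (\<forall>t\<in>T. x t \<in> D \<and> (x has_vector_derivative f (x t)) (at t))"

definition locally_invariant :: "'a::real_normed_vector set \<Rightarrow> ('a \<Rightarrow> 'a) \<Rightarrow> 'a set \<Rightarrow> bool" where
  "locally_invariant D f M \<longleftrightarrow>
     (\<forall>T x. solution D f T x \<and> x 0 \<in> M \<longrightarrow> (\<exists>\<epsilon>>0. \<forall>t\<in>T. \<bar>t\<bar> < \<epsilon> \<longrightarrow> x t \<in> M))"

text \<open>
  Center manifold around the equilibrium 0 of the system x' = f x on D, a relatively open subset
  of the coordinate space of J: a locally invariant continuously differentiable graph over a ball
  of the center space, tangent to the center space at 0. Only the J-by-J block of the matrix A
  matters, and it is uniquely determined by f. Requiring a graph rather than an arbitrary
  submanifold tangent to the center space keeps a center manifold from having further components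
  that have nothing to do with the equilibrium.
\<close>

definition center_manifold ::
  "'n::finite set \<Rightarrow> (real^'n) set \<Rightarrow> (real^'n \<Rightarrow> real^'n) \<Rightarrow> (real^'n) set \<Rightarrow> bool" where
  "center_manifold J D f M \<longleftrightarrow>
     openin (top_of_set (coord_space J)) D \<and> 0 \<in> D \<and> f 0 = 0 \<and>
     (\<exists>A r h. (f has_derivative (\<lambda>x. A *v x)) (at 0 within D) \<and> r > 0 \<and>
        (let B = center_space J A \<inter> ball 0 r in
           (\<forall>v\<in>B. h v \<in> hyperbolic_space J A) \<and> C1_on B h \<and>
           h 0 = 0 \<and> (h has_derivative (\<lambda>_. 0)) (at 0 within B) \<and>
           M = (\<lambda>v. v + h v) ` B)) \<and>
     M \<subseteq> D \<and> locally_invariant D f M"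

section \<open>The three systems in the coordinates (zeta, u0, u-)\<close>

text \<open>
  In what follows x $ k is zeta, blk I x is u0 and blk J x is u-. The row vectors G10, G1m and
  the matrices G01, G0m, Gs only enter through the appropriate blocks of entries.
\<close>

definition tau_field ::
  "'n::finite \<Rightarrow> 'n set \<Rightarrow> 'n set
   \<Rightarrow> (real \<Rightarrow> real^'n \<Rightarrow> real^'n) \<Rightarrow> (real \<Rightarrow> real^'n \<Rightarrow> real^'n \<Rightarrow> real^'n)
   \<Rightarrow> (real \<Rightarrow> real^'n \<Rightarrow> real^'n^'n) \<Rightarrow> (real \<Rightarrow> real^'n \<Rightarrow> real^'n \<Rightarrow> real^'n^'n)
   \<Rightarrow> (real \<Rightarrow> real^'n \<Rightarrow> real^'n \<Rightarrow> real^'n^'n) \<Rightarrow> real^'n \<Rightarrow> real^'n" where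
  "tau_field k I J G10 G1m G01 G0m Gs x =
     (let z = x $ k; u0 = blk I x; um = blk J x in
      \<chi> i. if i = k then (G10 z u0 \<bullet> u0) * z\<^sup>2 + (G1m z u0 um \<bullet> um) * z
           else if i \<in> I then ((G01 z u0 + (G0m z u0 um - G0m z u0 0)) *v (z *\<^sub>R u0)) $ i
           else if i \<in> J then (Gs z u0 um *v um) $ i
           else 0)"

text \<open>
  The right-hand side of the singular system. At zeta = 0, division by zero makes the last block 0;
  this is the intended value only when u- = 0, cf. the domain of the system defined below.
\<close>

definition sing_field ::
  "'n::finite \<Rightarrow> 'n set \<Rightarrow> 'n set
   \<Rightarrow> (real \<Rightarrow> real^'n \<Rightarrow> real^'n) \<Rightarrow> (real \<Rightarrow> real^'n \<Rightarrow> real^'n \<Rightarrow> real^'n)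
   \<Rightarrow> (real \<Rightarrow> real^'n \<Rightarrow> real^'n^'n) \<Rightarrow> (real \<Rightarrow> real^'n \<Rightarrow> real^'n \<Rightarrow> real^'n^'n)
   \<Rightarrow> (real \<Rightarrow> real^'n \<Rightarrow> real^'n \<Rightarrow> real^'n^'n) \<Rightarrow> real^'n \<Rightarrow> real^'n" where
  "sing_field k I J G10 G1m G01 G0m Gs x =
     (let z = x $ k; u0 = blk I x; um = blk J x in
      \<chi> i. if i = k then z * (G10 z u0 \<bullet> u0) + G1m z u0 um \<bullet> um
           else if i \<in> I then ((G01 z u0 + (G0m z u0 um - G0m z u0 0)) *v u0) $ i
           else if i \<in> J then (1 / z) * (Gs z u0 um *v um) $ i
           else 0)"

text \<open>The points at which the singular system makes sense.\<close>

definition sing_domain :: "'n::finite \<Rightarrow> 'n set \<Rightarrow> (real^'n) set \<Rightarrow> (real^'n) set" where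
  "sing_domain k J \<Omega> = {x\<in>\<Omega>. x $ k \<noteq> 0 \<or> blk J x = 0}"

definition slow_manifold :: "'n::finite set \<Rightarrow> (real^'n) set \<Rightarrow> (real^'n) set" where
  "slow_manifold J \<Omega> = {x\<in>\<Omega>. blk J x = 0}"

text \<open>The non singular system obtained by reduction to the manifold of slow dynamics.\<close>

definition reduced_field ::
  "'n::finite \<Rightarrow> 'n set
   \<Rightarrow> (real \<Rightarrow> real^'n \<Rightarrow> real^'n) \<Rightarrow> (real \<Rightarrow> real^'n \<Rightarrow> real^'n^'n) \<Rightarrow> real^'n \<Rightarrow> real^'n" where
  "reduced_field k I G10 G01 x =
     (let z = x $ k; u0 = blk I x in
      \<chi> i. if i = k then z * (G10 z u0 \<bullet> u0)
           else if i \<in> I then (G01 z u0 *v u0) $ i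
           else 0)"

text \<open>
  By definition, a center manifold of the singular system is a center manifold of its reduction to
  the manifold of slow dynamics, a system on the coordinate space of (zeta, u0).
\<close>

definition sing_center_manifold ::
  "'n::finite \<Rightarrow> 'n set \<Rightarrow> 'n set \<Rightarrow> (real^'n) set
   \<Rightarrow> (real \<Rightarrow> real^'n \<Rightarrow> real^'n) \<Rightarrow> (real \<Rightarrow> real^'n \<Rightarrow> real^'n^'n) \<Rightarrow> (real^'n) set \<Rightarrow> bool" where
  "sing_center_manifold k I J \<Omega> G10 G01 M \<longleftrightarrow>
     center_manifold (insert k I) (slow_manifold J \<Omega>) (reduced_field k I G10 G01) M"

text \<open>
  The coordinates: a diffeomorphism \<open>\<Phi>\<close> from the ball of radius \<open>\<delta>\<close> onto \<open>\<Omega>\<close> whose k-th component is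
  \<open>\<zeta>\<close> and which maps the field F to the field of the tau-system. The last two conditions are the regularity
  of the coefficients: the reduced field is continuously differentiable, as is needed for it to have
  center manifolds, and Gs is continuous.
\<close>

definition slow_fast_coordinates ::
  "(real^'n::finite \<Rightarrow> real^'n) \<Rightarrow> (real^'n \<Rightarrow> real) \<Rightarrow> real
   \<Rightarrow> (real^'n \<Rightarrow> real^'n) \<Rightarrow> (real^'n) set \<Rightarrow> 'n \<Rightarrow> 'n set \<Rightarrow> 'n set
   \<Rightarrow> (real \<Rightarrow> real^'n \<Rightarrow> real^'n) \<Rightarrow> (real \<Rightarrow> real^'n \<Rightarrow> real^'n \<Rightarrow> real^'n)
   \<Rightarrow> (real \<Rightarrow> real^'n \<Rightarrow> real^'n^'n) \<Rightarrow> (real \<Rightarrow> real^'n \<Rightarrow> real^'n \<Rightarrow> real^'n^'n)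
   \<Rightarrow> (real \<Rightarrow> real^'n \<Rightarrow> real^'n \<Rightarrow> real^'n^'n) \<Rightarrow> bool" where
  "slow_fast_coordinates F \<zeta> \<delta> \<Phi> \<Omega> k I J G10 G1m G01 G0m Gs \<longleftrightarrow>
     k \<notin> I \<and> k \<notin> J \<and> I \<inter> J = {} \<and> insert k (I \<union> J) = UNIV \<and>
     card J = num_eigenvalues (\<lambda>\<mu>. Re \<mu> < 0) (jacobian F (at 0)) \<and>
     card I + 1 = num_eigenvalues (\<lambda>\<mu>. Re \<mu> = 0) (jacobian F (at 0)) \<and>
     C1_diffeo (ball 0 \<delta>) \<Omega> \<Phi> \<and> \<Phi> 0 = 0 \<and>
     (\<forall>U\<in>ball 0 \<delta>. \<Phi> U $ k = \<zeta> U) \<and>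
     (\<forall>U\<in>ball 0 \<delta>. frechet_derivative \<Phi> (at U) (F U)
                     = tau_field k I J G10 G1m G01 G0m Gs (\<Phi> U)) \<and>
     (\<forall>\<mu>\<in>eigenvalues_on J (Gs 0 0 0). Re \<mu> < 0) \<and>
     C1_on (slow_manifold J \<Omega>) (reduced_field k I G10 G01) \<and>
     continuous_on \<Omega> (\<lambda>x. Gs (x $ k) (blk I x) (blk J x))"

end

theory Submission
  imports Defs "HOL-Computational_Algebra.Fundamental_Theorem_Algebra"
begin

text \<open>
  On the manifold of slow dynamics the singular system is the reduced system, a \<open>C\<^sup>1\<close> field on an open
  subset of the coordinate space of \<open>(\<zeta>, u\<^sub>0)\<close>, so the point is the center manifold theorem for
  \<open>C\<^sup>1\<close> fields. It is proved by the method of Lyapunov and Perron: after a cut-off, the field is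
  \<open>A x + g x\<close> with \<open>g\<close> of small Lipschitz constant, and the center manifold consists of the initial
  values of the solutions that grow at most like \<open>exp (\<eta> * \<bar>t\<bar>)\<close> in both time directions.
  For each center component \<open>v\<close> of the initial value there is exactly one such solution, by
  contraction in a weighted space; its dependence on \<open>v\<close> is \<open>C\<^sup>1\<close> because the variational equation is
  solvable for two rates \<open>\<eta> < \<eta>'\<close>. No matrix exponentials are needed: the linear inhomogeneous
  equation is solved on generalized eigenvectors \<open>b\<close> by induction on \<open>m\<close> with \<open>(A - \<mu>)\<^sup>m b = 0\<close>,
  each step being a scalar equation.
  A solution of the singular system that starts on the slow manifold with \<open>\<zeta> > 0\<close> stays there by
  Gronwall's inequality, and \<open>\<zeta>\<close> cannot reach \<open>0\<close> since its derivative is locally bounded by a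
  multiple of \<open>\<zeta>\<close>.
\<close>

section \<open>Scalar equations with exponentially weighted bounds\<close>

text \<open>The growth class makes the problem rigid. If \<open>\<eta>\<close> lies below
  \<open>\<bar>Re \<mu>\<bar>\<close> for every hyperbolic eigenvalue \<open>\<mu>\<close>, a slow
  solution of the linear equation is determined by its center component alone, because hyperbolic
  modes grow too fast in one of the two time directions. Uniqueness in this class is the source of
  most properties: time shifts of slow solutions are again slow, which gives invariance of the
  graph; linear combinations of variational solutions are again variational solutions, which gives
  linearity of the derivative; at \<open>v = 0\<close> the variational equation is the linear one,
  which gives tangency. The nonlinear estimates all come from one absorption argument with
  \<open>C * L \<le> 1 / 2\<close>. A second difficulty is that the field lives on a relatively open
  part of a coordinate subspace, where derivatives are not unique. Composing with the block
  projection extends it to the whole space and picks out a matrix supported in the block. For the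
  singular system local invariance rests on a bound for 1/\<zeta> near the starting point, which is
  available when \<zeta> is positive there.\<close>

lemma vector_derivative_zero_of_norm_bound:
  fixes z :: "real \<Rightarrow> 'a::real_inner"
  assumes T: "is_interval T" and r: "r \<in> T" and z0: "z r = 0"
    and d: "\<And>t. t \<in> T \<Longrightarrow> (z has_vector_derivative z' t) (at t)"
    and b: "\<And>t. t \<in> T \<Longrightarrow> norm (z' t) \<le> K * norm (z t)"
    and t: "t \<in> T"
  shows "z t = 0"
proof -
  have di: "((\<lambda>s. exp (c * s) * (z s \<bullet> z s)) has_real_derivative
      exp (c * s) * (c * (z s \<bullet> z s) + 2 * (z s \<bullet> z' s))) (at s)" if "s \<in> T" for s c
  proof -
    have "((\<lambda>s. z s \<bullet> z s) has_derivative (\<lambda>h. z s \<bullet> (h *\<^sub>R z' s) + (h *\<^sub>R z' s) \<bullet> z s)) (at s)"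
      using d[OF that] unfolding has_vector_derivative_def by (intro has_derivative_inner)
    then have "((\<lambda>s. z s \<bullet> z s) has_real_derivative 2 * (z s \<bullet> z' s)) (at s)"
      unfolding has_field_derivative_def
      by (rule has_derivative_eq_rhs) (auto simp: inner_commute fun_eq_iff)
    then show ?thesis
      by (auto intro!: derivative_eq_intros simp: algebra_simps)
  qed
  have bd: "\<bar>z s \<bullet> z' s\<bar> \<le> K * (z s \<bullet> z s)" if "s \<in> T" for s
  proof -
    have "\<bar>z s \<bullet> z' s\<bar> \<le> norm (z s) * norm (z' s)"
      by (rule Cauchy_Schwarz_ineq2)
    also have "\<dots> \<le> norm (z s) * (K * norm (z s))"
      by (rule mult_left_mono[OF b[OF that]]) simp
    also have "\<dots> = K * (z s \<bullet> z s)"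
      by (simp add: power2_norm_eq_inner[symmetric] power2_eq_square)
    finally show ?thesis .
  qed
  have sub: "s \<in> T" if "s \<in> {min r t..max r t}" for s
    by (rule mem_is_interval_1_I[OF T, of "min r t" "max r t"]) (use that r t in \<open>auto simp: min_def max_def\<close>)
  have "z t \<bullet> z t \<le> 0"
  proof (cases "r \<le> t")
    case True
    \<comment> \<open>Gronwall in differential form: by \<open>bd\<close> the weight
      \<open>exp (- 2 * K * s)\<close> makes the squared norm nonincreasing to the right of
      \<open>r\<close>, and \<open>exp (2 * K * s)\<close> makes it nondecreasing to the left. In
      both cases it is bounded above by its value 0 at \<open>r\<close>.\<close>
    have "exp (- 2 * K * t) * (z t \<bullet> z t) \<le> exp (- 2 * K * r) * (z r \<bullet> z r)"
    proof (rule DERIV_nonpos_imp_nonincreasing[OF True])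
      fix s assume "r \<le> s" "s \<le> t"
      then have s: "s \<in> T" using sub True by auto
      have "exp (- 2 * K * s) * ((- 2 * K) * (z s \<bullet> z s) + 2 * (z s \<bullet> z' s)) \<le> 0"
        using bd[OF s] by (intro mult_nonneg_nonpos) auto
      with di[OF s, of "- 2 * K"]
      show "\<exists>y. ((\<lambda>s. exp (- 2 * K * s) * (z s \<bullet> z s)) has_real_derivative y) (at s) \<and> y \<le> 0"
        by auto
    qed
    then show ?thesis using z0 by (simp add: mult_le_0_iff)
  next
    case False
    then have le: "t \<le> r" by simp
    have "exp (2 * K * t) * (z t \<bullet> z t) \<le> exp (2 * K * r) * (z r \<bullet> z r)"
    proof (rule DERIV_nonneg_imp_nondecreasing[OF le])
      fix s assume "t \<le> s" "s \<le> r"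
      then have s: "s \<in> T" using sub le by auto
      have "exp (2 * K * s) * ((2 * K) * (z s \<bullet> z s) + 2 * (z s \<bullet> z' s)) \<ge> 0"
        using bd[OF s] by (intro mult_nonneg_nonneg) auto
      with di[OF s, of "2 * K"]
      show "\<exists>y. ((\<lambda>s. exp (2 * K * s) * (z s \<bullet> z s)) has_real_derivative y) (at s) \<and> 0 \<le> y"
        by auto
    qed
    then show ?thesis using z0 by (simp add: mult_le_0_iff)
  qed
  then show ?thesis by (metis inner_ge_zero inner_eq_zero_iff order_antisym)
qed

lemma antiderivative_on_line:
  fixes q :: "real \<Rightarrow> 'a::banach"
  assumes q: "continuous_on UNIV q"
  obtains Q where "Q 0 = 0" "\<And>t. (Q has_vector_derivative q t) (at t)"
proof -
  \<comment> \<open>At most one of the two intervals is nondegenerate, so this is the signed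
    integral from 0 to \<open>t\<close>. Near any point it differs by a constant from an integral
    with the fixed lower limit \<open>-r\<close>.\<close>
  define Q where "Q t = integral {0..t} q - integral {t..0} q" for t
  have "Q 0 = 0" by (simp add: Q_def)
  moreover have "(Q has_vector_derivative q t) (at t)" for t
  proof -
    define r where "r = \<bar>t\<bar> + 1"
    have int: "q integrable_on {a..b}" for a b
      by (rule integrable_continuous_interval) (rule continuous_on_subset[OF q], simp)
    have eq: "Q s = integral {-r..s} q - integral {-r..0} q" if "s \<in> {-r<..<r}" for s
    proof (cases "s \<ge> 0")
      case True
      then have "integral {-r..0} q + integral {0..s} q = integral {-r..s} q"
        using that by (intro Henstock_Kurzweil_Integration.integral_combine int) (auto simp: r_def)
      moreover have "integral {s..0} q = 0" using True by (cases "s = 0") auto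
      ultimately show ?thesis by (simp add: Q_def algebra_simps)
    next
      case False
      then have "integral {-r..s} q + integral {s..0} q = integral {-r..0} q"
        using that by (intro Henstock_Kurzweil_Integration.integral_combine int) (auto simp: r_def)
      moreover have "integral {0..s} q = 0" using False by auto
      ultimately show ?thesis by (simp add: Q_def algebra_simps)
    qed
    have "((\<lambda>s. integral {-r..s} q) has_vector_derivative q t) (at t within {-r..r})"
      by (rule integral_has_vector_derivative) (auto intro: continuous_on_subset[OF q] simp: r_def)
    then have "((\<lambda>s. integral {-r..s} q) has_vector_derivative q t) (at t)"
      by (subst (asm) at_within_interior) (auto simp: r_def)
    then have "((\<lambda>s. integral {-r..s} q - integral {-r..0} q) has_vector_derivative q t) (at t)"
      by (auto intro!: derivative_eq_intros)
    then show ?thesis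
      by (rule has_vector_derivative_transform_within_open[where S = "{-r<..<r}"])
        (auto simp: eq, auto simp: r_def)
  qed
  ultimately show ?thesis using that by blast
qed

lemma weighted_exp_le:
  fixes \<eta> t s :: real
  assumes "\<eta> \<ge> 0"
  shows "exp (\<eta> * \<bar>s\<bar>) \<le> exp (\<eta> * \<bar>t\<bar>) * exp (\<eta> * \<bar>s - t\<bar>)"
proof -
  have "\<bar>s\<bar> \<le> \<bar>t\<bar> + \<bar>s - t\<bar>" by linarith
  then have "\<eta> * \<bar>s\<bar> \<le> \<eta> * (\<bar>t\<bar> + \<bar>s - t\<bar>)" by (rule mult_left_mono) fact
  then show ?thesis by (simp add: exp_add[symmetric] distrib_left)
qed

lemma norm_exp_mult_of_real: "norm (exp (\<mu> * of_real t)) = exp (Re \<mu> * t)" for \<mu> :: complex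
  by (simp add: norm_exp_eq_Re)

text \<open>Variation of constants for a scalar equation. With \<open>p = 0\<close> and constant
  \<open>Q\<close> it also gives the derivative of the exponential itself.\<close>

lemma exp_times_vector_derivative:
  fixes \<mu> :: complex
  assumes "(Q has_vector_derivative exp (- \<mu> * of_real t) * p) (at t)"
  shows "((\<lambda>t. exp (\<mu> * of_real t) * Q t) has_vector_derivative
     \<mu> * (exp (\<mu> * of_real t) * Q t) + p) (at t)"
proof -
  have "((\<lambda>t. exp (\<mu> * of_real t)) has_vector_derivative exp (\<mu> * of_real t) * \<mu>) (at t)"
    by (rule has_vector_derivative_real_field[where f = "\<lambda>z. exp (\<mu> * z)"])
      (auto intro!: derivative_eq_intros)
  from has_vector_derivative_mult[OF this assms]
  have "((\<lambda>t. exp (\<mu> * of_real t) * Q t) has_vector_derivative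
     exp (\<mu> * of_real t) * (exp (- \<mu> * of_real t) * p) + exp (\<mu> * of_real t) * \<mu> * Q t) (at t)" .
  moreover have "exp (\<mu> * of_real t) * (exp (- \<mu> * of_real t) * p) = p"
    using exp_minus_inverse[of "\<mu> * of_real t"] by (simp add: mult.assoc[symmetric])
  moreover have "exp (\<mu> * of_real t) * \<mu> * Q t = \<mu> * (exp (\<mu> * of_real t) * Q t)"
    by (simp only: mult_ac)
  ultimately show ?thesis by (simp only: add.commute)
qed

text \<open>Variation of constants from time 0. The factor \<open>exp (\<mu> * t)\<close> has
  modulus 1, so integrating the bound on \<open>p\<close> costs only \<open>1 / \<eta>\<close>; this
  blows up as \<eta> tends to 0, which is why slow exponential growth has to be allowed. Starting at
  0 leaves the center component of the full solution free to be prescribed.\<close>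

lemma scalar_solution_center:
  fixes \<mu> :: complex and p :: "real \<Rightarrow> complex"
  assumes \<mu>: "Re \<mu> = 0" and \<eta>: "\<eta> > 0" and p: "continuous_on UNIV p"
    and P: "\<And>t. norm (p t) \<le> P * exp (\<eta> * \<bar>t\<bar>)"
  obtains s where "s 0 = 0" "\<And>t. (s has_vector_derivative \<mu> * s t + p t) (at t)"
    "\<And>t. norm (s t) \<le> P / \<eta> * exp (\<eta> * \<bar>t\<bar>)"
proof -
  have "continuous_on UNIV (\<lambda>t. exp (- \<mu> * of_real t) * p t)"
    by (intro continuous_intros p)
  then obtain Q where Q0: "Q 0 = 0"
    and Q: "\<And>t. (Q has_vector_derivative exp (- \<mu> * of_real t) * p t) (at t)"
    by (rule antiderivative_on_line) blast
  have P0: "P \<ge> 0" using order_trans[OF norm_ge_zero P[of 0]] by simp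
  have nb: "norm (exp (- \<mu> * of_real t) * p t) \<le> P * exp (\<eta> * \<bar>t\<bar>)" for t
    using P[of t] \<mu> by (simp add: norm_mult norm_exp_mult_of_real[of "-\<mu>", simplified])
  have cont: "continuous_on S Q" for S
    using Q by (meson continuous_at_imp_continuous_on has_vector_derivative_continuous)
  have bd: "norm (Q t) \<le> P / \<eta> * exp (\<eta> * \<bar>t\<bar>)" for t
  proof (cases "0 < t")
    case True
    have "norm (Q t - Q 0) \<le> P / \<eta> * exp (\<eta> * t) - P / \<eta> * exp (\<eta> * 0)"
    proof (rule differentiable_bound_general[OF True cont, where f' = "\<lambda>t. exp (- \<mu> * of_real t) * p t"
          and \<phi>' = "\<lambda>t. P * exp (\<eta> * t)"])
      show "continuous_on {0..t} (\<lambda>a. P / \<eta> * exp (\<eta> * a))" by (intro continuous_intros)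
      show "((\<lambda>a. P / \<eta> * exp (\<eta> * a)) has_vector_derivative P * exp (\<eta> * x)) (at x)" for x
        unfolding has_real_derivative_iff_has_vector_derivative[symmetric]
        using \<eta> by (auto intro!: derivative_eq_intros)
      show "norm (exp (- \<mu> * complex_of_real x) * p x) \<le> P * exp (\<eta> * x)" if "0 < x" for x
        using nb[of x] that by simp
    qed (use Q in auto)
    moreover have "P / \<eta> \<ge> 0" using P0 \<eta> by simp
    ultimately show ?thesis using True Q0 by simp
  next
    case False
    show ?thesis
    proof (cases "t = 0")
      case True
      then show ?thesis using Q0 P0 \<eta> by simp
    next
      case nz: False
      with False have t: "t < 0" by simp
      have "norm (Q 0 - Q t) \<le> - P / \<eta> * exp (- \<eta> * 0) - (- P / \<eta> * exp (- \<eta> * t))"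
      proof (rule differentiable_bound_general[OF t cont, where f' = "\<lambda>t. exp (- \<mu> * of_real t) * p t"
            and \<phi>' = "\<lambda>t. P * exp (- \<eta> * t)"])
        show "continuous_on {t..0} (\<lambda>a. - P / \<eta> * exp (- \<eta> * a))" by (intro continuous_intros)
        show "((\<lambda>a. - P / \<eta> * exp (- \<eta> * a)) has_vector_derivative P * exp (- \<eta> * x)) (at x)" for x
          unfolding has_real_derivative_iff_has_vector_derivative[symmetric]
          using \<eta> by (auto intro!: derivative_eq_intros)
        show "norm (exp (- \<mu> * complex_of_real x) * p x) \<le> P * exp (- \<eta> * x)" if "x < 0" for x
          using nb[of x] that by simp
      qed (use Q in auto)
      moreover have "P / \<eta> \<ge> 0" using P0 \<eta> by simp
      ultimately show ?thesis using t Q0 by simp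
    qed
  qed
  show ?thesis
  proof (rule that[of "\<lambda>t. exp (\<mu> * of_real t) * Q t"])
    show "norm (exp (\<mu> * of_real t) * Q t) \<le> P / \<eta> * exp (\<eta> * \<bar>t\<bar>)" for t
      using bd[of t] \<mu> by (simp add: norm_mult norm_exp_mult_of_real)
  qed (use Q0 exp_times_vector_derivative[OF Q] in auto)
qed

text \<open>Variation of constants from time infinity: the integral over the future converges
  because \<open>Re \<mu>\<close> exceeds \<eta>, and no other integration constant avoids growth
  like \<open>exp (Re \<mu> * t)\<close>. The initial value is therefore dictated by
  \<open>p\<close>.\<close>

lemma scalar_solution_unstable:
  fixes \<mu> :: complex and p :: "real \<Rightarrow> complex"
  assumes \<mu>: "Re \<mu> > \<eta>" and \<eta>: "\<eta> > 0" and p: "continuous_on UNIV p"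
    and P: "\<And>t. norm (p t) \<le> P * exp (\<eta> * \<bar>t\<bar>)"
  obtains s where "\<And>t. (s has_vector_derivative \<mu> * s t + p t) (at t)"
    "\<And>t. norm (s t) \<le> P / (Re \<mu> - \<eta>) * exp (\<eta> * \<bar>t\<bar>)"
proof -
  define a where "a = Re \<mu> - \<eta>"
  have a: "a > 0" using \<mu> by (simp add: a_def)
  have "continuous_on UNIV (\<lambda>t. exp (- \<mu> * of_real t) * p t)"
    by (intro continuous_intros p)
  then obtain Q where Q: "\<And>t. (Q has_vector_derivative exp (- \<mu> * of_real t) * p t) (at t)"
    by (rule antiderivative_on_line) blast
  have P0: "P \<ge> 0" using order_trans[OF norm_ge_zero P[of 0]] by simp
  have cont: "continuous_on S Q" for S
    using Q by (meson continuous_at_imp_continuous_on has_vector_derivative_continuous)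
  \<comment> \<open>Because \<bar>x\<bar> is at most \<bar>t\<bar> + (x - t) for x beyond t, the
    integrand decays at rate \<open>a\<close> and the remaining factor depends on \<open>t\<close>
    only.\<close>
  have nb: "norm (exp (- \<mu> * of_real x) * p x) \<le> P * exp (\<eta> * \<bar>t\<bar> - \<eta> * t) * exp (- a * x)"
    if "t \<le> x" for t x
  proof -
    have "norm (exp (- \<mu> * of_real x) * p x) = exp (- Re \<mu> * x) * norm (p x)"
      by (simp add: norm_mult norm_exp_mult_of_real[of "-\<mu>", simplified])
    also have "\<dots> \<le> exp (- Re \<mu> * x) * (P * (exp (\<eta> * \<bar>t\<bar>) * exp (\<eta> * \<bar>x - t\<bar>)))"
      using P0 weighted_exp_le[of \<eta> x t] \<eta>
      by (intro mult_left_mono order_trans[OF P]) auto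
    also have "\<dots> = P * exp (\<eta> * \<bar>t\<bar> - \<eta> * t) * exp (- a * x)"
      using that by (simp add: exp_add[symmetric] a_def algebra_simps)
    finally show ?thesis .
  qed
  have inc: "norm (Q T - Q t) \<le> P / a * exp (\<eta> * \<bar>t\<bar>) * exp (- Re \<mu> * t)" if tT: "t < T" for t T
  proof -
    define c where "c = P * exp (\<eta> * \<bar>t\<bar> - \<eta> * t)"
    have c0: "c \<ge> 0" using P0 by (simp add: c_def)
    have "norm (Q T - Q t) \<le> - c / a * exp (- a * T) - (- c / a * exp (- a * t))"
    proof (rule differentiable_bound_general[OF tT cont, where f' = "\<lambda>t. exp (- \<mu> * of_real t) * p t"
          and \<phi>' = "\<lambda>x. c * exp (- a * x)"])
      show "continuous_on {t..T} (\<lambda>x. - c / a * exp (- a * x))" by (intro continuous_intros)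
      show "((\<lambda>x. - c / a * exp (- a * x)) has_vector_derivative c * exp (- a * x)) (at x)" for x
        unfolding has_real_derivative_iff_has_vector_derivative[symmetric]
        using a by (auto intro!: derivative_eq_intros)
      show "norm (exp (- \<mu> * complex_of_real x) * p x) \<le> c * exp (- a * x)" if "t < x" for x
        using nb[of t x] that by (simp add: c_def)
    qed (use Q in auto)
    also have "\<dots> \<le> c / a * exp (- a * t)" using c0 a by simp
    also have "\<dots> = P / a * exp (\<eta> * \<bar>t\<bar>) * exp (- Re \<mu> * t)"
      by (simp add: c_def a_def exp_add[symmetric] algebra_simps)
    finally show ?thesis .
  qed
  \<comment> \<open>The improper integral is realized as the limit of \<open>Q\<close> along the
    natural numbers, with \<open>inc\<close> bounding the tails; \<open>qb\<close> then carries the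
    tail bound over to the limit.\<close>
  have "Cauchy (\<lambda>n. Q (real n))"
  proof (rule metric_CauchyI)
    fix e :: real assume e: "e > 0"
    have "((\<lambda>n. P / a * exp (- a * real n)) \<longlongrightarrow> P / a * 0) sequentially"
    proof (intro tendsto_mult tendsto_const filterlim_compose[OF exp_at_bot])
      show "LIM n sequentially. - a * real n :> at_bot"
        by (rule filterlim_tendsto_neg_mult_at_bot[OF tendsto_const])
          (use a in \<open>auto intro: filterlim_real_sequentially\<close>)
    qed
    then have "\<forall>\<^sub>F n in sequentially. P / a * exp (- a * real n) < e / 2"
      using e by (intro order_tendstoD) auto
    then obtain N where N: "P / a * exp (- a * real N) < e / 2"
      unfolding eventually_sequentially by blast
    have *: "dist (Q (real n)) (Q (real N)) < e / 2" if "n \<ge> N" for n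
    proof (cases "n = N")
      case False
      then have "norm (Q (real n) - Q (real N)) \<le> P / a * exp (\<eta> * real N) * exp (- Re \<mu> * real N)"
        using inc[of "real N" "real n"] that by simp
      also have "\<dots> = P / a * exp (- a * real N)"
        by (simp add: a_def exp_add[symmetric] algebra_simps)
      also note N
      finally show ?thesis by (simp add: dist_norm)
    qed (use e in auto)
    show "\<exists>M. \<forall>m\<ge>M. \<forall>n\<ge>M. dist (Q (real m)) (Q (real n)) < e"
      using * dist_triangle_half_l by blast
  qed
  then obtain q where q: "(\<lambda>n. Q (real n)) \<longlonglongrightarrow> q"
    using Cauchy_convergent convergent_def by blast
  have qb: "norm (q - Q t) \<le> P / a * exp (\<eta> * \<bar>t\<bar>) * exp (- Re \<mu> * t)" for t
  proof (rule tendsto_upperbound)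
    show "(\<lambda>n. norm (Q (real n) - Q t)) \<longlonglongrightarrow> norm (q - Q t)"
      by (intro tendsto_intros q)
    show "\<forall>\<^sub>F n in sequentially. norm (Q (real n) - Q t) \<le> P / a * exp (\<eta> * \<bar>t\<bar>) * exp (- Re \<mu> * t)"
      using eventually_gt_at_top[of "nat \<lceil>\<bar>t\<bar>\<rceil>"]
      by eventually_elim (rule inc, linarith)
  qed simp
  show ?thesis
  proof (rule that[of "\<lambda>t. exp (\<mu> * of_real t) * (Q t - q)"])
    fix t
    have "((\<lambda>t. Q t - q) has_vector_derivative exp (- \<mu> * of_real t) * p t) (at t)"
      using Q[of t] by (auto intro!: derivative_eq_intros)
    then show "((\<lambda>t. exp (\<mu> * of_real t) * (Q t - q)) has_vector_derivative
        \<mu> * (exp (\<mu> * of_real t) * (Q t - q)) + p t) (at t)"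
      by (rule exp_times_vector_derivative)
    have "norm (exp (\<mu> * of_real t) * (Q t - q)) = exp (Re \<mu> * t) * norm (q - Q t)"
      by (simp add: norm_mult norm_exp_mult_of_real norm_minus_commute)
    also have "\<dots> \<le> exp (Re \<mu> * t) * (P / a * exp (\<eta> * \<bar>t\<bar>) * exp (- Re \<mu> * t))"
      by (intro mult_left_mono qb) simp
    also have "\<dots> = P / a * exp (\<eta> * \<bar>t\<bar>)" by (simp add: exp_minus field_simps)
    finally show "norm (exp (\<mu> * of_real t) * (Q t - q)) \<le> P / (Re \<mu> - \<eta>) * exp (\<eta> * \<bar>t\<bar>)"
      by (simp add: a_def)
  qed
qed

text \<open>For negative real part, time reversal turns the equation into the unstable one with
  exponent \<open>- \<mu>\<close> and forcing \<open>- p (- t)\<close>.\<close>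

lemma scalar_solution_hyperbolic:
  fixes \<mu> :: complex and p :: "real \<Rightarrow> complex"
  assumes \<mu>: "\<bar>Re \<mu>\<bar> > \<eta>" and \<eta>: "\<eta> > 0" and p: "continuous_on UNIV p"
    and P: "\<And>t. norm (p t) \<le> P * exp (\<eta> * \<bar>t\<bar>)"
  obtains s where "\<And>t. (s has_vector_derivative \<mu> * s t + p t) (at t)"
    "\<And>t. norm (s t) \<le> P / (\<bar>Re \<mu>\<bar> - \<eta>) * exp (\<eta> * \<bar>t\<bar>)"
proof (cases "Re \<mu> > 0")
  case True
  then show ?thesis
    using scalar_solution_unstable[of \<eta> \<mu> p P] assms that by auto
next
  case False
  have "continuous_on UNIV (\<lambda>t. - p (- t))"
    by (intro continuous_on_minus continuous_on_compose2[OF p]) (auto intro: continuous_intros)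
  moreover have "Re (- \<mu>) > \<eta>" using \<mu> False by auto
  moreover have "norm (- p (- t)) \<le> P * exp (\<eta> * \<bar>t\<bar>)" for t using P[of "- t"] by simp
  ultimately obtain s where
    s: "\<And>t. (s has_vector_derivative - \<mu> * s t + - p (- t)) (at t)"
    and sb: "\<And>t. norm (s t) \<le> P / (Re (- \<mu>) - \<eta>) * exp (\<eta> * \<bar>t\<bar>)"
    using \<eta> by (rule_tac scalar_solution_unstable[of \<eta> "- \<mu>" "\<lambda>t. - p (- t)" P]) auto
  show ?thesis
  proof (rule that[of "\<lambda>t. s (- t)"])
    fix t
    have "((s \<circ> uminus) has_vector_derivative (-1) *\<^sub>R (- \<mu> * s (- t) + - p (- (- t)))) (at t)"
      by (rule vector_diff_chain_at[OF _ s]) (auto intro!: derivative_eq_intros)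
    then show "((\<lambda>t. s (- t)) has_vector_derivative \<mu> * s (- t) + p t) (at t)"
      by (simp add: o_def add.commute)
    show "norm (s (- t)) \<le> P / (\<bar>Re \<mu>\<bar> - \<eta>) * exp (\<eta> * \<bar>t\<bar>)"
      using sb[of "- t"] False by simp
  qed
qed

section \<open>The linear equation and the spectral decomposition\<close>

lemma norm_vector_smult: "norm (c *s v) = norm c * norm v" for v :: "complex^'n"
  unfolding norm_vec_def
  by (simp add: L2_set_right_distrib norm_mult)

lemma bounded_linear_smult_left: "bounded_linear (\<lambda>c. c *s v)" for v :: "complex^'n"
  by (rule bounded_linear_intro[where K = "norm v"])
    (auto simp: vec_eq_iff algebra_simps norm_vector_smult)

lemma scaleR_eq_smult: "r *\<^sub>R v = of_real r *s v" for v :: "complex^'n"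
  by (simp only: vec_eq_iff vector_smult_component vector_scaleR_component) (simp add: scaleR_conv_of_real)

text \<open>\<open>V\<close> plays the part of a complex subspace invariant under \<open>T\<close>.
  Since \<open>subspace\<close>, \<open>span\<close> and \<open>linear\<close> refer to real
  scalars, compatibility with complex scalars is required separately through
  \<open>*s\<close>.\<close>

locale complex_operator =
  fixes T :: "complex^'n::finite \<Rightarrow> complex^'n" and V :: "(complex^'n) set"
  assumes T_add: "T (x + y) = T x + T y"
    and T_smult: "T (c *s x) = c *s T x"
    and V_0: "0 \<in> V"
    and V_add: "x \<in> V \<Longrightarrow> y \<in> V \<Longrightarrow> x + y \<in> V"
    and V_smult: "x \<in> V \<Longrightarrow> c *s x \<in> V"
    and V_T: "x \<in> V \<Longrightarrow> T x \<in> V"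
begin

lemma bounded_linear_T: "bounded_linear T"
  unfolding linear_conv_bounded_linear[symmetric]
  by (rule linearI) (auto simp: T_add T_smult scaleR_eq_smult)

lemma T_0 [simp]: "T 0 = 0"
  using T_smult[of 0 0] by simp

lemma V_scaleR: "x \<in> V \<Longrightarrow> r *\<^sub>R x \<in> V"
  by (simp add: scaleR_eq_smult V_smult)

lemma subspace_V: "subspace V"
  by (simp add: subspace_def V_0 V_add V_scaleR)

lemma V_diff: "x \<in> V \<Longrightarrow> y \<in> V \<Longrightarrow> x - y \<in> V"
  using subspace_V by (rule subspace_diff)

section \<open>Generalized eigenvectors and the decomposition of \<open>V\<close>\<close>

definition sh :: "complex \<Rightarrow> complex^'n \<Rightarrow> complex^'n" where
  "sh \<mu> = (\<lambda>w. T w - \<mu> *s w)"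

lemma sh_add: "sh \<mu> (x + y) = sh \<mu> x + sh \<mu> y"
  by (simp add: sh_def T_add vector_add_ldistrib)

lemma sh_smult: "sh \<mu> (c *s x) = c *s sh \<mu> x"
  by (simp add: sh_def T_smult vec_eq_iff algebra_simps)

lemma sh_0 [simp]: "sh \<mu> 0 = 0"
  by (simp add: sh_def)

lemma sh_V: "x \<in> V \<Longrightarrow> sh \<mu> x \<in> V"
  by (simp add: sh_def V_diff V_T V_smult)

lemma sh_pow_add: "(sh \<mu> ^^ m) (x + y) = (sh \<mu> ^^ m) x + (sh \<mu> ^^ m) y"
  by (induction m) (auto simp: sh_add)

lemma sh_pow_smult: "(sh \<mu> ^^ m) (c *s x) = c *s (sh \<mu> ^^ m) x"
  by (induction m) (auto simp: sh_smult)

lemma sh_pow_0 [simp]: "(sh \<mu> ^^ m) 0 = 0"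
  using sh_pow_smult[where c = 0 and x = 0] by simp

lemma sh_pow_mono: "(sh \<mu> ^^ m) x = 0 \<Longrightarrow> (sh \<mu> ^^ (m + k)) x = 0"
  by (simp add: add.commute[of m] funpow_add)

text \<open>A union over eigenvalues and not a sum, hence in general not closed under addition
  unless \<open>P\<close> singles out one eigenvalue; sums are formed by \<open>span\<close>
  afterwards.\<close>

definition gen :: "(complex \<Rightarrow> bool) \<Rightarrow> (complex^'n) set" where
  "gen P = {v\<in>V. \<exists>\<mu> m. P \<mu> \<and> (sh \<mu> ^^ m) v = 0}"

lemma subspace_gen: "subspace (gen (\<lambda>\<nu>. \<nu> = \<mu>))"
proof -
  have "x + y \<in> gen (\<lambda>\<nu>. \<nu> = \<mu>)" if "x \<in> gen (\<lambda>\<nu>. \<nu> = \<mu>)" "y \<in> gen (\<lambda>\<nu>. \<nu> = \<mu>)" for x y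
  proof -
    obtain m k where "(sh \<mu> ^^ m) x = 0" "(sh \<mu> ^^ k) y = 0"
      using \<open>x \<in> _\<close> \<open>y \<in> _\<close> by (auto simp: gen_def)
    then have "(sh \<mu> ^^ (m + k)) (x + y) = 0"
      using sh_pow_mono[where m = m and x = x and k = k] sh_pow_mono[where m = k and x = y and k = m] by (simp add: sh_pow_add add.commute)
    then show ?thesis using that by (auto simp: gen_def V_add)
  qed
  moreover have "r *\<^sub>R x \<in> gen (\<lambda>\<nu>. \<nu> = \<mu>)" if "x \<in> gen (\<lambda>\<nu>. \<nu> = \<mu>)" for r x
    using that by (auto simp: gen_def scaleR_eq_smult sh_pow_smult V_smult)
  moreover have "0 \<in> gen (\<lambda>\<nu>. \<nu> = \<mu>)" by (auto simp: gen_def V_0)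
  ultimately show ?thesis by (simp add: subspace_def)
qed

text \<open>On the generalized eigenspace of \<open>\<nu>\<close> the shift \<open>sh a\<close> is
  the nonzero scalar \<open>\<nu> - a\<close> plus a nilpotent map. The recursion solves
  \<open>sh a u' = sh \<nu> w\<close> one nilpotency step lower and divides \<open>w - u'\<close> by
  that scalar.\<close>

lemma shift_surj_on_gen:
  assumes "\<nu> \<noteq> a" "w \<in> V" "(sh \<nu> ^^ m) w = 0"
  shows "\<exists>u\<in>V. (sh \<nu> ^^ m) u = 0 \<and> sh a u = w"
  using assms(2,3)
proof (induction m arbitrary: w)
  case 0
  then show ?case by (auto intro!: bexI[of _ 0] simp: V_0)
next
  case (Suc m)
  have "(sh \<nu> ^^ m) (sh \<nu> w) = 0" using Suc.prems(2) by (simp add: funpow_swap1)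
  then obtain u' where u': "u' \<in> V" "(sh \<nu> ^^ m) u' = 0" "sh a u' = sh \<nu> w"
    using Suc.IH sh_V[OF Suc.prems(1)] by blast
  define u where "u = (1 / (\<nu> - a)) *s (w + (- 1) *s u')"
  have "u \<in> V" unfolding u_def by (intro V_smult V_add Suc.prems u')
  moreover have "(sh \<nu> ^^ Suc m) u' = 0" using u'(2) by simp
  then have "(sh \<nu> ^^ Suc m) u = 0"
    unfolding u_def sh_pow_smult sh_pow_add using Suc.prems(2) by simp
  moreover have "sh a u = w"
  proof -
    have "sh a w = sh \<nu> w + (\<nu> - a) *s w"
      by (simp add: sh_def vec_eq_iff algebra_simps)
    then have "sh a u = (1 / (\<nu> - a)) *s ((\<nu> - a) *s w)"
      unfolding u_def sh_smult sh_add u'(3) \<open>sh a w = _\<close> by (simp add: vec_eq_iff)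
    moreover have "(1 / (\<nu> - a)) * (\<nu> - a) = 1" using assms(1) by simp
    ultimately show ?thesis by (simp only: vector_smult_assoc vector_smult_lid)
  qed
  ultimately show ?case by blast
qed

text \<open>A polynomial in \<open>T\<close> given by its roots, with repetitions recording
  multiplicity. The factors commute, so the order of the list is immaterial.\<close>

primrec kill :: "complex list \<Rightarrow> complex^'n \<Rightarrow> complex^'n" where
  "kill [] v = v"
| "kill (a # L) v = kill L (sh a v)"

lemma kill_add: "kill L (x + y) = kill L x + kill L y"
  by (induction L arbitrary: x y) (auto simp: sh_add)

lemma kill_smult: "kill L (c *s x) = c *s kill L x"
  by (induction L arbitrary: x) (auto simp: sh_smult)

lemma kill_0 [simp]: "kill L 0 = 0"
  by (induction L) auto

lemma kill_append: "kill (L @ L') v = kill L' (kill L v)"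
  by (induction L arbitrary: v) auto

lemma T_sh: "T (sh a v) = sh a (T v)"
  by (simp add: sh_def T_smult diff_conv_add_uminus T_add del: add_uminus_conv_diff)
    (metis T_add T_smult vector_sneg_minus1)

lemma sh_sh: "sh a (sh b v) = sh b (sh a v)"
  using T_sh[of b v] T_sh[of a v] by (simp add: sh_def vec_eq_iff algebra_simps)

lemma kill_sh: "kill L (sh a v) = sh a (kill L v)"
  by (induction L arbitrary: v) (auto simp: sh_sh[of _ a])

lemma kill_kill: "kill L (kill L' v) = kill L' (kill L v)"
  by (induction L arbitrary: v) (auto simp: kill_sh)

lemma kill_replicate: "kill (replicate m \<mu>) v = (sh \<mu> ^^ m) v"
  by (induction m arbitrary: v) (auto simp: funpow_swap1)

text \<open>Primary decomposition, one root \<open>a\<close> at a time. Components of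
  \<open>sh a v\<close> belonging to other eigenvalues have preimages under \<open>sh a\<close>;
  after subtraction of such a preimage \<open>u\<close>, what is left of \<open>sh a v\<close> is a
  generalized eigenvector for \<open>a\<close>, and then so is \<open>v - u\<close>.\<close>

lemma span_gen_of_kill:
  assumes "kill L v = 0" "v \<in> V"
  shows "v \<in> span (gen (\<lambda>_. True))"
  using assms
proof (induction L arbitrary: v)
  case Nil
  then show ?case by (simp add: span_0)
next
  case (Cons a L)
  let ?G = "gen (\<lambda>_. True)" and ?Ga = "gen (\<lambda>\<nu>. \<nu> = a)"
  have "sh a v \<in> span ?G"
    using Cons by (auto simp: sh_V)
  then have "\<exists>u\<in>span ?G. u \<in> V \<and> sh a v - sh a u \<in> ?Ga"
  proof (induction rule: span_induct_alt)
    case base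
    then show ?case
      using span_0 V_0 subspace_0[OF subspace_gen] by force
  next
    case (step c x y)
    then obtain u where u: "u \<in> span ?G" "u \<in> V" "y - sh a u \<in> ?Ga" by auto
    obtain \<nu> m where x: "x \<in> V" "(sh \<nu> ^^ m) x = 0" using step by (auto simp: gen_def)
    show ?case
    proof (cases "\<nu> = a")
      case True
      then have "x \<in> ?Ga" using x by (auto simp: gen_def)
      then have "c *\<^sub>R x + (y - sh a u) \<in> ?Ga"
        by (intro subspace_add[OF subspace_gen] subspace_mul[OF subspace_gen] u)
      then show ?thesis using u by (intro bexI[of _ u]) (auto simp: algebra_simps)
    next
      case False
      from shift_surj_on_gen[OF this x] obtain u' where
        u': "u' \<in> V" "(sh \<nu> ^^ m) u' = 0" "sh a u' = x" by blast
      then have "u' \<in> ?G" by (auto simp: gen_def)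
      then have "c *\<^sub>R u' + u \<in> span ?G"
        by (intro span_add span_mul span_base u)
      moreover have "sh a (c *\<^sub>R u' + u) = c *\<^sub>R x + sh a u"
        by (simp add: sh_add scaleR_eq_smult sh_smult u')
      ultimately show ?thesis
        using u u' by (intro bexI[of _ "c *\<^sub>R u' + u"]) (auto simp: V_add V_scaleR)
    qed
  qed
  then obtain u where u: "u \<in> span ?G" "u \<in> V" "sh a v - sh a u \<in> ?Ga" by blast
  have "sh a v - sh a u = sh a (v - u)"
    using sh_add[of a "v - u" u] by simp
  then obtain m where "(sh a ^^ m) (sh a (v - u)) = 0" using u by (auto simp: gen_def)
  then have "(sh a ^^ Suc m) (v - u) = 0" by (simp add: funpow_swap1)
  then have "v - u \<in> ?G" using V_diff[OF Cons.prems(2) u(2)] unfolding gen_def by blast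
  then have "u + (v - u) \<in> span ?G" by (intro span_add u span_base)
  then show ?case by simp
qed

section \<open>Polynomials in \<open>T\<close> by Horner's scheme, and a product of shifts that
  annihilates \<open>V\<close>\<close>

definition papply :: "complex poly \<Rightarrow> complex^'n \<Rightarrow> complex^'n" where
  "papply p = fold_coeffs (\<lambda>a f v. a *s v + f (T v)) p (\<lambda>_. 0)"

lemma papply_0 [simp]: "papply 0 v = 0"
  by (simp add: papply_def)

lemma papply_pCons [simp]: "papply (pCons a p) v = a *s v + papply p (T v)"
proof (cases "p = 0")
  case True
  then show ?thesis by (cases "a = 0") (simp_all add: papply_def)
next
  case False
  then show ?thesis by (simp add: papply_def)
qed

lemma papply_add: "papply (p + q) v = papply p v + papply q v"
  by (induction p q arbitrary: v rule: poly_induct2) (auto simp: vec_eq_iff algebra_simps)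

lemma papply_smult: "papply (smult c p) v = c *s papply p v"
  by (induction p arbitrary: v) (auto simp: vec_eq_iff algebra_simps)

lemma papply_arg_add: "papply p (v + w) = papply p v + papply p w"
  by (induction p arbitrary: v w) (auto simp: T_add vec_eq_iff algebra_simps)

lemma papply_arg_smult: "papply p (c *s v) = c *s papply p v"
  by (induction p arbitrary: v) (auto simp: T_smult vec_eq_iff algebra_simps)

lemma papply_linear_factor: "papply ([:- a, 1:] * q) v = papply q (sh a v)"
proof -
  have "papply ([:- a, 1:] * q) v = (- a) *s papply q v + papply q (T v)"
  proof -
    have "[:- a, 1:] * q = smult (- a) q + pCons 0 q" by simp
    then show ?thesis by (simp only: papply_add papply_smult papply_pCons) simp
  qed
  also have "\<dots> = papply q ((- a) *s v + T v)"
    by (simp only: papply_arg_add papply_arg_smult)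
  also have "(- a) *s v + T v = sh a v" by (simp add: sh_def vec_eq_iff)
  finally show ?thesis .
qed

lemma papply_monom: "papply (monom c j) v = c *s (T ^^ j) v"
  by (induction j arbitrary: v) (auto simp: monom_0 monom_Suc funpow_swap1)

lemma papply_sum: "finite I \<Longrightarrow> papply (\<Sum>i\<in>I. p i) v = (\<Sum>i\<in>I. papply (p i) v)"
  by (induction I rule: finite_induct) (auto simp: papply_add)

text \<open>The powers of \<open>T\<close> applied to \<open>v\<close> are linearly dependent in
  finite dimension. As \<open>dependent\<close> speaks about sets, a coincidence of two powers is a
  case of its own, settled by the difference of two monomials.\<close>

lemma ex_annihilating_poly: "\<exists>p. p \<noteq> 0 \<and> papply p v = 0"
proof -
  let ?N = "DIM(complex^'n)"
  let ?f = "\<lambda>j. (T ^^ j) v"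
  show ?thesis
  proof (cases "inj_on ?f {..?N}")
    case True
    then have "card (?f ` {..?N}) > ?N" by (simp add: card_image)
    then have "dependent (?f ` {..?N})"
      by (intro dependent_biggerset) simp_all
    then obtain u i where u: "(\<Sum>w\<in>?f ` {..?N}. u w *\<^sub>R w) = 0" and i: "i \<le> ?N" "u (?f i) \<noteq> 0"
      by (auto simp: dependent_finite)
    define p where "p = (\<Sum>j\<le>?N. monom (complex_of_real (u (?f j))) j)"
    have "coeff p i = (\<Sum>j\<le>?N. if j = i then of_real (u (?f j)) else 0)"
      unfolding p_def coeff_sum by (intro sum.cong) auto
    also have "\<dots> = of_real (u (?f i))" using i by simp
    finally have "p \<noteq> 0" using i by auto
    moreover have "papply p v = (\<Sum>j\<le>?N. u (?f j) *\<^sub>R ?f j)"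
      by (simp add: p_def papply_sum papply_monom scaleR_eq_smult)
    then have "papply p v = 0" using u using sum.reindex[OF True, of "\<lambda>w. u w *\<^sub>R w"] by (simp add: o_def)
    ultimately show ?thesis by blast
  next
    case False
    then obtain i j where ij: "?f i = ?f j" "i \<noteq> j" by (auto simp: inj_on_def)
    define p where "p = monom 1 i + smult (- 1) (monom 1 j :: complex poly)"
    have "papply p v = 0"
      unfolding p_def papply_add papply_smult papply_monom using ij by (simp add: vec_eq_iff)
    moreover have "coeff p i = 1" using ij by (simp add: p_def)
    then have "p \<noteq> 0" by auto
    ultimately show ?thesis by blast
  qed
qed

text \<open>The polynomial splits over the complex numbers; each root found is peeled off as a
  factor \<open>sh a\<close>, until a nonzero constant forces the vector to vanish.\<close>

lemma kill_of_annihilating_poly: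
  assumes "p \<noteq> 0" "papply p v = 0"
  shows "\<exists>L. kill L v = 0"
  using assms
proof (induction "degree p" arbitrary: p v)
  case 0
  then obtain c where "p = [:c:]" by (metis degree_0_id)
  then have "v = 0" using 0 by simp
  then show ?case by (intro exI[of _ "[]"]) simp
next
  case (Suc n)
  have "\<not> constant (poly p)" using Suc.hyps(2) by (simp add: constant_degree)
  then obtain a where "poly p a = 0" using fundamental_theorem_of_algebra by blast
  then obtain q where q: "p = [:- a, 1:] * q" by (auto simp: poly_eq_0_iff_dvd)
  then have "q \<noteq> 0" using Suc.prems by auto
  then have "n = degree q" using Suc.hyps(2) unfolding q by (subst (asm) degree_mult_eq) auto
  moreover have "papply q (sh a v) = 0" using Suc.prems(2) unfolding q papply_linear_factor .
  ultimately obtain L where "kill L (sh a v) = 0" using Suc.hyps(1) \<open>q \<noteq> 0\<close> by blast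
  then show ?case by (intro exI[of _ "a # L"]) simp
qed

text \<open>Lists of finitely many basis vectors can be concatenated: since the factors commute,
  each list annihilates its own vector in whatever position it stands.\<close>

lemma ex_kill_list: "\<exists>L. \<forall>v\<in>V. kill L v = 0"
proof -
  obtain B where B: "B \<subseteq> V" "independent B" "V \<subseteq> span B"
    using basis_exists[of V] by metis
  then have "finite B" by (simp add: independent_imp_finite)
  then have "\<exists>L. \<forall>b\<in>B. kill L b = 0"
  proof (induction B rule: finite_induct)
    case (insert b B)
    then obtain L where L: "\<forall>b\<in>B. kill L b = 0" by blast
    obtain p where "p \<noteq> 0" "papply p b = 0" using ex_annihilating_poly[of b] by blast
    then obtain L' where "kill L' b = 0" using kill_of_annihilating_poly[of p b] by blast
    then have "\<forall>x\<in>insert b B. kill (L @ L') x = 0"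
      using L \<open>kill L' b = 0\<close> kill_kill[of L' L b] by (auto simp: kill_append)
    then show ?case by blast
  qed auto
  then obtain L where L: "\<forall>b\<in>B. kill L b = 0" by blast
  have "kill L v = 0" if "v \<in> span B" for v
    using that
  proof (induction rule: span_induct_alt)
    case (step c x y)
    then show ?case using L by (simp add: kill_add scaleR_eq_smult kill_smult)
  qed simp
  then show ?thesis using B(3) by blast
qed

lemma V_eq_span_gen: "V \<subseteq> span (gen (\<lambda>_. True))"
  using ex_kill_list span_gen_of_kill by blast

text \<open>On an eigenvector, \<open>kill L\<close> is multiplication by the product of the
  \<open>\<mu> - a\<close> with \<open>a\<close> in \<open>L\<close>. A generalized eigenvector
  leads to this case through its last nonzero image under powers of \<open>sh \<mu>\<close>.\<close>

lemma eigenvalue_in_kill_list: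
  "T e = \<mu> *s e \<Longrightarrow> e \<noteq> 0 \<Longrightarrow> kill L e = 0 \<Longrightarrow> \<mu> \<in> set L"
proof (induction L arbitrary: e)
  case (Cons a L)
  show ?case
  proof (cases "\<mu> = a")
    case False
    have e: "sh a e = (\<mu> - a) *s e" using Cons.prems(1) by (simp add: sh_def vec_eq_iff algebra_simps)
    moreover have "(\<mu> - a) *s e \<noteq> 0"
      using False Cons.prems(2) by (simp add: vec_eq_iff)
    moreover have "T ((\<mu> - a) *s e) = \<mu> *s ((\<mu> - a) *s e)"
      by (simp only: T_smult Cons.prems(1) vector_smult_assoc mult.commute)
    ultimately show ?thesis using Cons.IH[of "(\<mu> - a) *s e"] Cons.prems(3) by simp
  qed simp
qed simp

lemma gen_eigenvalue_in_kill_list: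
  "\<lbrakk>v \<in> V; v \<noteq> 0; (sh \<mu> ^^ m) v = 0; \<forall>v\<in>V. kill L v = 0\<rbrakk> \<Longrightarrow> \<mu> \<in> set L"
proof (induction m arbitrary: v)
  case (Suc m)
  show ?case
  proof (cases "sh \<mu> v = 0")
    case True
    then show ?thesis using eigenvalue_in_kill_list[of v \<mu> L] Suc.prems by (simp add: sh_def)
  next
    case False
    then show ?thesis using Suc.IH[of "sh \<mu> v"] Suc.prems by (simp add: sh_V funpow_swap1)
  qed
qed simp

section \<open>The spectral gap and the linear equation with slowly growing forcing\<close>

definition gap :: "real \<Rightarrow> bool" where
  "gap \<eta> \<longleftrightarrow> (\<forall>v\<in>V. \<forall>\<mu> m. v \<noteq> 0 \<longrightarrow> (sh \<mu> ^^ m) v = 0 \<longrightarrow> Re \<mu> \<noteq> 0 \<longrightarrow> \<eta> < \<bar>Re \<mu>\<bar>)"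

text \<open>Only nonzero vectors count in \<open>gap\<close>, so its condition concerns actual
  eigenvalues, and these all occur in one finite annihilating list.\<close>

lemma ex_gap: "\<exists>\<beta>>0. \<forall>\<eta><\<beta>. gap \<eta>"
proof -
  obtain L where L: "\<forall>v\<in>V. kill L v = 0" using ex_kill_list by blast
  \<comment> \<open>The element 1 keeps the set nonempty when every root in \<open>L\<close> is
    purely imaginary.\<close>
  define R where "R = insert 1 ((\<lambda>\<mu>. \<bar>Re \<mu>\<bar>) ` {\<mu>\<in>set L. Re \<mu> \<noteq> 0})"
  have "finite R" "R \<noteq> {}" by (auto simp: R_def)
  then have "Min R > 0" by (subst Min_gr_iff) (auto simp: R_def)
  moreover have "Min R \<le> \<bar>Re \<mu>\<bar>" if "v \<in> V" "v \<noteq> 0" "(sh \<mu> ^^ m) v = 0" "Re \<mu> \<noteq> 0" for v \<mu> m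
    using gen_eigenvalue_in_kill_list[OF that(1,2,3) L] that(4) \<open>finite R\<close>
    by (intro Min_le) (auto simp: R_def)
  then have "gap \<eta>" if "\<eta> < Min R" for \<eta>
    using that unfolding gap_def by (meson less_le_trans)
  ultimately show ?thesis by blast
qed

text \<open>\<open>C\<close> is chosen before the forcing: it bounds a solution operator on the
  weighted space, which the contraction will need. The forcing is a scalar function in the fixed
  direction \<open>b\<close>, and \<open>Z\<close> records where the initial value may lie.\<close>

definition solvable :: "(complex^'n \<Rightarrow> bool) \<Rightarrow> real \<Rightarrow> complex^'n \<Rightarrow> bool" where
  "solvable Z \<eta> b \<longleftrightarrow> (\<exists>C\<ge>0. \<forall>p P. continuous_on UNIV p \<longrightarrow>
     (\<forall>t. norm (p t :: complex) \<le> P * exp (\<eta> * \<bar>t\<bar>)) \<longrightarrow>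
     (\<exists>x. Z (x 0) \<and> (\<forall>t. x t \<in> V \<and> (x has_vector_derivative T (x t) + p t *s b) (at t)
        \<and> norm (x t) \<le> C * P * exp (\<eta> * \<bar>t\<bar>))))"

text \<open>The ansatz \<open>s t *s b + y t\<close>, with the scalar \<open>s\<close> driven by
  \<open>p\<close>, leaves for \<open>y\<close> the same equation with forcing \<open>s\<close> in
  the direction \<open>sh \<mu> b\<close>, which needs one power less. The Boolean \<open>Z\<close>
  treats together scalar solutions that start at 0 and those whose initial value is
  dictated.\<close>

lemma solvable_gen:
  assumes \<kappa>: "\<kappa> \<ge> 0"
    and sc: "\<And>p P. continuous_on UNIV p \<Longrightarrow> (\<And>t. norm (p t) \<le> P * exp (\<eta> * \<bar>t\<bar>)) \<Longrightarrow>
       \<exists>s. (Z \<longrightarrow> s 0 = 0) \<and> (\<forall>t. (s has_vector_derivative \<mu> * s t + p t) (at t)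
          \<and> norm (s t) \<le> \<kappa> * P * exp (\<eta> * \<bar>t\<bar>))"
    and b: "b \<in> V" "(sh \<mu> ^^ m) b = 0"
  shows "solvable (\<lambda>v. v \<in> V \<and> (sh \<mu> ^^ m) v = 0 \<and> (Z \<longrightarrow> v = 0)) \<eta> b"
  using b
proof (induction m arbitrary: b)
  case 0
  then show ?case unfolding solvable_def
    by (intro exI[of _ 0] conjI allI impI exI[of _ "\<lambda>_. 0"]) (auto simp: V_0)
next
  case (Suc m)
  have "(sh \<mu> ^^ m) (sh \<mu> b) = 0" using Suc.prems(2) by (simp add: funpow_swap1)
  from Suc.IH[OF sh_V[OF Suc.prems(1)] this] obtain C where C: "C \<ge> 0" and
    sol: "\<And>p P. continuous_on UNIV p \<Longrightarrow> (\<forall>t. norm (p t :: complex) \<le> P * exp (\<eta> * \<bar>t\<bar>)) \<Longrightarrow>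
     \<exists>x. (x 0 \<in> V \<and> (sh \<mu> ^^ m) (x 0) = 0 \<and> (Z \<longrightarrow> x 0 = 0)) \<and>
        (\<forall>t. x t \<in> V \<and> (x has_vector_derivative T (x t) + p t *s sh \<mu> b) (at t)
        \<and> norm (x t) \<le> C * P * exp (\<eta> * \<bar>t\<bar>))"
    unfolding solvable_def by blast
  show ?case unfolding solvable_def
  proof (intro exI[of _ "\<kappa> * norm b + C * \<kappa>"] conjI allI impI)
    show "0 \<le> \<kappa> * norm b + C * \<kappa>" using C \<kappa> by simp
    fix p :: "real \<Rightarrow> complex" and P
    assume p: "continuous_on UNIV p" "\<forall>t. norm (p t) \<le> P * exp (\<eta> * \<bar>t\<bar>)"
    obtain s where s0: "Z \<longrightarrow> s 0 = 0"
      and s: "\<And>t. (s has_vector_derivative \<mu> * s t + p t) (at t)"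
      and sb: "\<And>t. norm (s t) \<le> \<kappa> * P * exp (\<eta> * \<bar>t\<bar>)"
      using sc[of p P] p by blast
    have "continuous_on UNIV s"
      using s by (meson continuous_at_imp_continuous_on has_vector_derivative_continuous)
    from sol[OF this, of "\<kappa> * P"] sb obtain y where
      y0: "y 0 \<in> V" "(sh \<mu> ^^ m) (y 0) = 0" "Z \<longrightarrow> y 0 = 0"
      and yV: "\<And>t. y t \<in> V"
      and y: "\<And>t. (y has_vector_derivative T (y t) + s t *s sh \<mu> b) (at t)"
      and yb: "\<And>t. norm (y t) \<le> C * (\<kappa> * P) * exp (\<eta> * \<bar>t\<bar>)" by metis
    let ?x = "\<lambda>t. s t *s b + y t"
    have x0: "?x 0 \<in> V" using y0 Suc.prems by (simp add: V_add V_smult)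
    have x0': "(sh \<mu> ^^ Suc m) (?x 0) = 0"
      using y0(2) Suc.prems(2) unfolding sh_pow_add sh_pow_smult by simp
    have xZ: "Z \<longrightarrow> ?x 0 = 0" using s0 y0 by simp
    have xV: "?x t \<in> V" for t using yV Suc.prems by (simp add: V_add V_smult)
    have xd: "(?x has_vector_derivative T (?x t) + p t *s b) (at t)" for t
    proof -
      have "(?x has_vector_derivative (\<mu> * s t + p t) *s b + (T (y t) + s t *s sh \<mu> b)) (at t)"
        by (intro has_vector_derivative_add y
            bounded_linear.has_vector_derivative[OF bounded_linear_smult_left s])
      moreover have "(\<mu> * s t + p t) *s b + (T (y t) + s t *s sh \<mu> b) = T (?x t) + p t *s b"
        by (simp add: sh_def T_add T_smult vec_eq_iff algebra_simps)
      ultimately show ?thesis by (rule has_vector_derivative_eq_rhs)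
    qed
    have xb: "norm (?x t) \<le> (\<kappa> * norm b + C * \<kappa>) * P * exp (\<eta> * \<bar>t\<bar>)" for t
    proof -
      have "norm (?x t) \<le> norm (s t) * norm b + norm (y t)"
        using norm_triangle_ineq[of "s t *s b" "y t"] by (simp add: norm_vector_smult)
      also have "\<dots> \<le> \<kappa> * P * exp (\<eta> * \<bar>t\<bar>) * norm b + C * (\<kappa> * P) * exp (\<eta> * \<bar>t\<bar>)"
        by (intro add_mono mult_right_mono sb yb) simp
      finally show ?thesis by (simp add: algebra_simps)
    qed
    show "\<exists>x. (x 0 \<in> V \<and> (sh \<mu> ^^ Suc m) (x 0) = 0 \<and> (Z \<longrightarrow> x 0 = 0)) \<and>
        (\<forall>t. x t \<in> V \<and> (x has_vector_derivative T (x t) + p t *s b) (at t)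
        \<and> norm (x t) \<le> (\<kappa> * norm b + C * \<kappa>) * P * exp (\<eta> * \<bar>t\<bar>))"
      by (intro exI[of _ ?x] conjI allI x0 x0' xZ xV xd xb)
  qed
qed

lemma solvable_mono: "solvable Z \<eta> b \<Longrightarrow> (\<And>v. Z v \<Longrightarrow> Z' v) \<Longrightarrow> solvable Z' \<eta> b"
  unfolding solvable_def by meson

lemma solvable_center:
  assumes "Re \<mu> = 0" "\<eta> > 0" "b \<in> V" "(sh \<mu> ^^ m) b = 0"
  shows "solvable (\<lambda>v. v = 0) \<eta> b"
proof (rule solvable_mono)
  show "solvable (\<lambda>v. v \<in> V \<and> (sh \<mu> ^^ m) v = 0 \<and> (True \<longrightarrow> v = 0)) \<eta> b"
  proof (rule solvable_gen[where \<kappa> = "1 / \<eta>"])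
    fix p :: "real \<Rightarrow> complex" and P
    assume p: "continuous_on UNIV p" "\<And>t. norm (p t) \<le> P * exp (\<eta> * \<bar>t\<bar>)"
    show "\<exists>s. (True \<longrightarrow> s 0 = 0) \<and> (\<forall>t. (s has_vector_derivative \<mu> * s t + p t) (at t)
          \<and> norm (s t) \<le> 1 / \<eta> * P * exp (\<eta> * \<bar>t\<bar>))"
      by (rule scalar_solution_center[OF assms(1,2) p]) auto
  qed (use assms in auto)
qed auto

lemma solvable_hyperbolic:
  assumes "\<bar>Re \<mu>\<bar> > \<eta>" "\<eta> > 0" "b \<in> V" "(sh \<mu> ^^ m) b = 0"
  shows "solvable (\<lambda>v. v \<in> span (gen (\<lambda>\<mu>. Re \<mu> \<noteq> 0))) \<eta> b"
proof (rule solvable_mono)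
  show "solvable (\<lambda>v. v \<in> V \<and> (sh \<mu> ^^ m) v = 0 \<and> (False \<longrightarrow> v = 0)) \<eta> b"
  proof (rule solvable_gen[where \<kappa> = "1 / (\<bar>Re \<mu>\<bar> - \<eta>)"])
    fix p :: "real \<Rightarrow> complex" and P
    assume p: "continuous_on UNIV p" "\<And>t. norm (p t) \<le> P * exp (\<eta> * \<bar>t\<bar>)"
    show "\<exists>s. (False \<longrightarrow> s 0 = 0) \<and> (\<forall>t. (s has_vector_derivative \<mu> * s t + p t) (at t)
          \<and> norm (s t) \<le> 1 / (\<bar>Re \<mu>\<bar> - \<eta>) * P * exp (\<eta> * \<bar>t\<bar>))"
      by (rule scalar_solution_hyperbolic[OF assms(1,2) p]) auto
  qed (use assms in auto)
  have "Re \<mu> \<noteq> 0" using assms by auto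
  then show "v \<in> span (gen (\<lambda>\<mu>. Re \<mu> \<noteq> 0))"
    if "v \<in> V \<and> (sh \<mu> ^^ m) v = 0 \<and> (False \<longrightarrow> v = 0)" for v
    using that by (intro span_base) (auto simp: gen_def)
qed

lemma solvable_0: "solvable (\<lambda>v. v \<in> span S) \<eta> 0"
  unfolding solvable_def
  by (intro exI[of _ 0] conjI allI impI exI[of _ "\<lambda>_. 0"]) (auto simp: V_0 span_0)

lemma solvable_lincomb:
  assumes "solvable (\<lambda>v. v \<in> span S) \<eta> b" "solvable (\<lambda>v. v \<in> span S) \<eta> d"
  shows "solvable (\<lambda>v. v \<in> span S) \<eta> (r *\<^sub>R b + d)"
proof -
  obtain C where C: "C \<ge> 0" and
    sol: "\<And>p P. continuous_on UNIV p \<Longrightarrow> (\<forall>t. norm (p t :: complex) \<le> P * exp (\<eta> * \<bar>t\<bar>)) \<Longrightarrow>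
     \<exists>x. x 0 \<in> span S \<and> (\<forall>t. x t \<in> V \<and> (x has_vector_derivative T (x t) + p t *s b) (at t)
        \<and> norm (x t) \<le> C * P * exp (\<eta> * \<bar>t\<bar>))"
    using assms(1) unfolding solvable_def by blast
  obtain C' where C': "C' \<ge> 0" and
    sol': "\<And>p P. continuous_on UNIV p \<Longrightarrow> (\<forall>t. norm (p t :: complex) \<le> P * exp (\<eta> * \<bar>t\<bar>)) \<Longrightarrow>
     \<exists>x. x 0 \<in> span S \<and> (\<forall>t. x t \<in> V \<and> (x has_vector_derivative T (x t) + p t *s d) (at t)
        \<and> norm (x t) \<le> C' * P * exp (\<eta> * \<bar>t\<bar>))"
    using assms(2) unfolding solvable_def by blast
  show ?thesis unfolding solvable_def
  proof (intro exI[of _ "\<bar>r\<bar> * C + C'"] conjI allI impI)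
    show "0 \<le> \<bar>r\<bar> * C + C'" using C C' by simp
    fix p :: "real \<Rightarrow> complex" and P
    assume p: "continuous_on UNIV p" "\<forall>t. norm (p t) \<le> P * exp (\<eta> * \<bar>t\<bar>)"
    obtain x where x: "x 0 \<in> span S" "\<And>t. x t \<in> V"
      "\<And>t. (x has_vector_derivative T (x t) + p t *s b) (at t)"
      "\<And>t. norm (x t) \<le> C * P * exp (\<eta> * \<bar>t\<bar>)" using sol[OF p] by blast
    obtain y where y: "y 0 \<in> span S" "\<And>t. y t \<in> V"
      "\<And>t. (y has_vector_derivative T (y t) + p t *s d) (at t)"
      "\<And>t. norm (y t) \<le> C' * P * exp (\<eta> * \<bar>t\<bar>)" using sol'[OF p] by blast
    let ?z = "\<lambda>t. r *\<^sub>R x t + y t"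
    have "(?z has_vector_derivative T (?z t) + p t *s (r *\<^sub>R b + d)) (at t)" for t
    proof -
      have "(?z has_vector_derivative r *\<^sub>R (T (x t) + p t *s b) + (T (y t) + p t *s d)) (at t)"
        by (intro has_vector_derivative_add y
            bounded_linear.has_vector_derivative[OF bounded_linear_scaleR_right x(3)])
      moreover have "r *\<^sub>R (T (x t) + p t *s b) + (T (y t) + p t *s d)
          = T (?z t) + p t *s (r *\<^sub>R b + d)"
        by (simp add: T_add T_smult scaleR_eq_smult vec_eq_iff algebra_simps)
      ultimately show ?thesis by (rule has_vector_derivative_eq_rhs)
    qed
    moreover have "norm (?z t) \<le> (\<bar>r\<bar> * C + C') * P * exp (\<eta> * \<bar>t\<bar>)" for t
    proof -
      have "norm (?z t) \<le> \<bar>r\<bar> * norm (x t) + norm (y t)"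
        using norm_triangle_ineq[of "r *\<^sub>R x t" "y t"] by simp
      also have "\<dots> \<le> \<bar>r\<bar> * (C * P * exp (\<eta> * \<bar>t\<bar>)) + C' * P * exp (\<eta> * \<bar>t\<bar>)"
        by (intro add_mono mult_left_mono x y) simp
      finally show ?thesis by (simp add: algebra_simps)
    qed
    moreover have "?z 0 \<in> span S" by (intro span_add span_mul x y)
    moreover have "?z t \<in> V" for t by (intro V_add V_scaleR x y)
    ultimately show "\<exists>x. x 0 \<in> span S \<and> (\<forall>t. x t \<in> V \<and>
        (x has_vector_derivative T (x t) + p t *s (r *\<^sub>R b + d)) (at t)
        \<and> norm (x t) \<le> (\<bar>r\<bar> * C + C') * P * exp (\<eta> * \<bar>t\<bar>))"
      by (intro exI[of _ ?z] conjI allI)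
  qed
qed

text \<open>Central pieces of \<open>b\<close> are solved with initial value 0 and hyperbolic pieces
  with a hyperbolic one, so that the sum adds nothing to the center component of the initial
  value.\<close>

lemma solvable_all:
  assumes \<eta>: "\<eta> > 0"
    and gap: "gap \<eta>"
    and b: "b \<in> V"
  shows "solvable (\<lambda>v. v \<in> span (gen (\<lambda>\<mu>. Re \<mu> \<noteq> 0))) \<eta> b"
proof -
  have "b \<in> span (gen (\<lambda>_. True))" using b V_eq_span_gen by blast
  then show ?thesis
  proof (induction rule: span_induct_alt)
    case base
    show ?case by (rule solvable_0)
  next
    case (step c x y)
    obtain \<mu> m where x: "x \<in> V" "(sh \<mu> ^^ m) x = 0" using step(1) by (auto simp: gen_def)
    have "solvable (\<lambda>v. v \<in> span (gen (\<lambda>\<mu>. Re \<mu> \<noteq> 0))) \<eta> x"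
    proof (cases "Re \<mu> = 0")
      case True
      from solvable_center[OF this \<eta> x] show ?thesis
        by (rule solvable_mono) (simp add: span_0)
    next
      case False
      then show ?thesis
        using solvable_hyperbolic[OF _ \<eta> x] gap[unfolded gap_def] x solvable_0 by (cases "x = 0") auto
    qed
    then show ?case using step(2) by (rule solvable_lincomb)
  qed
qed

text \<open>\<open>exp (\<mu> * t) *s b\<close> solves the equation up to an error in the direction
  \<open>sh \<mu> b\<close>, which the forced equation with zero initial value corrects. The actual
  growth is polynomial and is absorbed by the exponential weight.\<close>

lemma ex_center_solution:
  assumes "Re \<mu> = 0" "\<eta> > 0" "b \<in> V" "(sh \<mu> ^^ m) b = 0"
  shows "\<exists>x C. x 0 = b \<and> (\<forall>t. x t \<in> V \<and> (x has_vector_derivative T (x t)) (at t)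
     \<and> norm (x t) \<le> C * exp (\<eta> * \<bar>t\<bar>))"
proof (cases m)
  case 0
  then show ?thesis using assms by (intro exI[of _ "\<lambda>_. 0"] exI[of _ 0]) (auto simp: V_0)
next
  case (Suc n)
  define e where "e = (\<lambda>t. exp (\<mu> * complex_of_real t))"
  have e: "(e has_vector_derivative \<mu> * e t) (at t)" for t
    using exp_times_vector_derivative[of "\<lambda>_. 1" \<mu> t 0] unfolding e_def by simp
  have "continuous_on UNIV e" unfolding e_def by (intro continuous_intros)
  moreover have ne: "norm (e t) = 1" for t using assms(1) by (simp add: e_def norm_exp_mult_of_real)
  then have neb: "\<forall>t. norm (e t) \<le> 1 * exp (\<eta> * \<bar>t\<bar>)" using assms(2) by simp
  moreover have "solvable (\<lambda>v. v = 0) \<eta> (sh \<mu> b)"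
    using assms Suc by (intro solvable_center[of \<mu> _ _ n]) (auto simp: sh_V funpow_swap1)
  ultimately obtain C y where y0: "y 0 = 0" and yV: "\<And>t. y t \<in> V"
    and y: "\<And>t. (y has_vector_derivative T (y t) + e t *s sh \<mu> b) (at t)"
    and yb: "\<And>t. norm (y t) \<le> C * 1 * exp (\<eta> * \<bar>t\<bar>)"
    unfolding solvable_def by metis
  let ?x = "\<lambda>t. e t *s b + y t"
  have "?x 0 = b" by (simp add: y0 e_def)
  moreover have "?x t \<in> V" for t using yV assms(3) by (simp add: V_add V_smult)
  moreover have "(?x has_vector_derivative T (?x t)) (at t)" for t
  proof -
    have "(?x has_vector_derivative (\<mu> * e t) *s b + (T (y t) + e t *s sh \<mu> b)) (at t)"
      by (intro has_vector_derivative_add y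
          bounded_linear.has_vector_derivative[OF bounded_linear_smult_left e])
    moreover have "(\<mu> * e t) *s b + (T (y t) + e t *s sh \<mu> b) = T (?x t)"
      by (simp add: sh_def T_add T_smult vec_eq_iff algebra_simps)
    ultimately show ?thesis by (rule has_vector_derivative_eq_rhs)
  qed
  moreover have "norm (?x t) \<le> (norm b + C) * exp (\<eta> * \<bar>t\<bar>)" for t
  proof -
    have "norm (?x t) \<le> norm (e t) * norm b + norm (y t)"
      using norm_triangle_ineq[of "e t *s b" "y t"] by (simp add: norm_vector_smult)
    also have "\<dots> \<le> 1 * exp (\<eta> * \<bar>t\<bar>) * norm b + C * exp (\<eta> * \<bar>t\<bar>)"
      using yb neb by (intro add_mono mult_right_mono) auto
    finally show ?thesis by (simp add: algebra_simps)
  qed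
  ultimately show ?thesis by (intro exI[of _ ?x] exI[of _ "norm b + C"]) blast
qed

section \<open>Uniqueness of slow solutions of the linear equation\<close>

lemma exponential_growth_zero:
  fixes z :: "real \<Rightarrow> complex^'n"
  assumes z: "\<And>t. (z has_vector_derivative a *s z t) (at t)"
    and b: "\<And>t. norm (z t) \<le> B * exp (\<eta> * \<bar>t\<bar>)" and a: "\<eta> < \<bar>Re a\<bar>"
  shows "z t = 0"
proof -
  define e where "e = (\<lambda>t. exp (- a * complex_of_real t))"
  have "((\<lambda>t. e t *s z t) has_vector_derivative 0) (at t)" for t
  proof -
    have e: "(e has_vector_derivative - a * e t) (at t)"
      using exp_times_vector_derivative[of "\<lambda>_. 1" "- a" t 0] unfolding e_def by simp
    have bb: "bounded_bilinear (\<lambda>(c::complex) (v::complex^'n). c *s v)"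
      by (rule bounded_bilinear.intro)
        (auto simp: vec_eq_iff algebra_simps norm_vector_smult intro!: exI[of _ 1])
    have "((\<lambda>t. e t *s z t) has_vector_derivative e t *s (a *s z t) + (- a * e t) *s z t) (at t)"
      by (rule bounded_bilinear.has_vector_derivative[OF bb e z])
    then show ?thesis by (simp add: vector_smult_assoc vec_eq_iff algebra_simps)
  qed
  then obtain c where c: "\<And>t. e t *s z t = c"
    using has_vector_derivative_zero_constant[of UNIV "\<lambda>t. e t *s z t"] by auto
  have nb: "norm c \<le> B * exp (\<eta> * \<bar>t\<bar> - Re a * t)" for t
  proof -
    have "norm c = exp (- Re a * t) * norm (z t)"
      using c[of t] norm_exp_mult_of_real[of "- a" t] by (metis e_def norm_vector_smult uminus_complex.sel(1))
    also have "\<dots> \<le> exp (- Re a * t) * (B * exp (\<eta> * \<bar>t\<bar>))"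
      by (intro mult_left_mono b) simp
    finally show ?thesis by (simp add: exp_diff exp_minus field_simps)
  qed
  have "norm c \<le> B * exp (- (\<bar>Re a\<bar> - \<eta>) * real n)" for n
    using nb[of "if Re a > 0 then real n else - real n"]
    by (cases "Re a > 0") (simp_all add: algebra_simps)
  moreover have "(\<lambda>n. B * exp (- (\<bar>Re a\<bar> - \<eta>) * real n)) \<longlonglongrightarrow> B * 0"
  proof (intro tendsto_mult tendsto_const filterlim_compose[OF exp_at_bot])
    show "LIM n sequentially. - (\<bar>Re a\<bar> - \<eta>) * real n :> at_bot"
      by (rule filterlim_tendsto_neg_mult_at_bot[OF tendsto_const])
        (use a in \<open>auto intro: filterlim_real_sequentially\<close>)
  qed
  ultimately have "norm c \<le> B * 0"
    by (intro tendsto_lowerbound[of "\<lambda>n. B * exp (- (\<bar>Re a\<bar> - \<eta>) * real n)"]) auto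
  then have "e t *s z t = 0" using c by simp
  then show ?thesis by (simp add: vec_eq_iff e_def)
qed

text \<open>\<open>sh a\<close> commutes with \<open>T\<close> and hence maps slow solutions to slow
  solutions. By induction \<open>sh a z\<close> vanishes, so that z' = a z, which has no nonzero
  slow solution. The empty list means a zero initial value, where Gronwall's inequality
  applies.\<close>

lemma kill_solution_zero:
  assumes "\<And>t. (z has_vector_derivative T (z t)) (at t)"
    and "\<And>t. norm (z t) \<le> B * exp (\<eta> * \<bar>t\<bar>)"
    and "kill L (z 0) = 0" "\<And>\<mu>. \<mu> \<in> set L \<Longrightarrow> \<eta> < \<bar>Re \<mu>\<bar>"
  shows "z t = 0"
  using assms
proof (induction L arbitrary: z B t)
  case (Nil z B t)
  obtain K where "\<And>v. norm (T v) \<le> norm v * K"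
    using bounded_linear.bounded[OF bounded_linear_T] by blast
  then have K: "norm (T (z t)) \<le> K * norm (z t)" for t by (simp add: mult.commute)
  show ?case
    by (rule vector_derivative_zero_of_norm_bound[where T = UNIV and r = 0 and z = z
          and z' = "\<lambda>t. T (z t)" and K = K])
      (use Nil K in auto)
next
  case (Cons a L z B t)
  have bl: "bounded_linear (sh a)"
    unfolding linear_conv_bounded_linear[symmetric]
    by (rule linearI) (auto simp: sh_add sh_smult scaleR_eq_smult)
  obtain K where K: "K \<ge> 0" "\<And>v. norm (sh a v) \<le> norm v * K"
    using bounded_linear.nonneg_bounded[OF bl] by blast
  have "sh a (z t) = 0" for t
  proof (rule Cons.IH[where B = "B * K"])
    show "((\<lambda>t. sh a (z t)) has_vector_derivative T (sh a (z t))) (at t)" for t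
      unfolding T_sh by (intro bounded_linear.has_vector_derivative[OF bl] Cons)
    show "norm (sh a (z t)) \<le> B * K * exp (\<eta> * \<bar>t\<bar>)" for t
      using mult_right_mono[OF Cons.prems(2)[of t] K(1)] K(2)[of "z t"] by (simp add: mult_ac)
  qed (use Cons in auto)
  then have Tz: "T (z t) = a *s z t" for t by (simp add: sh_def)
  show ?case
  proof (rule exponential_growth_zero)
    show "(z has_vector_derivative a *s z t) (at t)" for t
      using Cons.prems(1)[of t] unfolding Tz .
  qed (use Cons.prems in auto)
qed

end

section \<open>From complex vectors to real ones\<close>

definition re_vec :: "complex^'n \<Rightarrow> real^'n" where
  "re_vec v = (\<chi> i. Re (v $ i))"

definition complex_vec :: "real^'n \<Rightarrow> complex^'n" where
  "complex_vec x = (\<chi> i. complex_of_real (x $ i))"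

definition cnj_vec :: "complex^'n \<Rightarrow> complex^'n" where
  "cnj_vec v = (\<chi> i. cnj (v $ i))"

lemma linear_re_vec: "linear re_vec"
  by (rule linearI) (auto simp: re_vec_def vec_eq_iff)

lemma linear_complex_vec: "linear complex_vec"
  by (rule linearI) (auto simp: complex_vec_def vec_eq_iff scaleR_conv_of_real[where 'a = complex])

lemma norm_re_vec_le: "norm (re_vec v) \<le> norm v" for v :: "complex^'n"
  unfolding norm_vec_def re_vec_def by (rule L2_set_mono) (auto simp: abs_Re_le_cmod)

lemma norm_complex_vec: "norm (complex_vec x) = norm x" for x :: "real^'n"
  unfolding norm_vec_def complex_vec_def by simp

lemma re_vec_complex_vec [simp]: "re_vec (complex_vec x) = x"
  by (simp add: re_vec_def complex_vec_def vec_eq_iff)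

lemma re_vec_in_coord_space: "v \<in> coord_space K \<Longrightarrow> re_vec v \<in> coord_space K"
  by (simp add: re_vec_def coord_space_def)

lemma complex_vec_in_coord_space: "x \<in> coord_space K \<Longrightarrow> complex_vec x \<in> coord_space K"
  by (simp add: complex_vec_def coord_space_def)

lemma subspace_coord_space: "subspace (coord_space K :: (real^'n) set)"
  by (simp add: subspace_def coord_space_def)

text \<open>With \<open>A\<close> supported in its \<open>K\<close> block,
  \<open>complex_block K A\<close> is the complexification of all of \<open>A\<close>, and real
  parts of complex solutions solve the real equation.\<close>

locale matrix_block =
  fixes A :: "real^'n::finite^'n" and K :: "'n set"
  assumes supp: "A $ i $ j \<noteq> 0 \<Longrightarrow> i \<in> K \<and> j \<in> K"
begin

lemma supp_zero: "i \<notin> K \<Longrightarrow> A $ i $ j = 0"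
  using supp by blast

lemma complex_block_nth: "complex_block K A $ i $ j = complex_of_real (A $ i $ j)"
  using supp[of i j] by (auto simp: complex_block_def)

sublocale complex_operator "(*v) (complex_block K A)" "coord_space K"
proof
  show "complex_block K A *v x \<in> coord_space K" for x
    by (auto simp: coord_space_def matrix_vector_mult_def complex_block_nth intro!: sum.neutral simp: supp_zero)
qed (auto simp: matrix_vector_right_distrib vector_scalar_commute coord_space_def)

lemma re_vec_T: "re_vec (complex_block K A *v v) = A *v re_vec v"
  by (simp add: re_vec_def matrix_vector_mult_def complex_block_nth)

lemma T_complex_vec: "complex_block K A *v complex_vec x = complex_vec (A *v x)"
  by (simp add: complex_vec_def matrix_vector_mult_def complex_block_nth)

lemma cnj_vec_T: "cnj_vec (complex_block K A *v v) = complex_block K A *v cnj_vec v"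
  by (simp add: cnj_vec_def matrix_vector_mult_def complex_block_nth)

lemma sh_pow_cnj: "(sh (cnj \<mu>) ^^ m) (cnj_vec v) = cnj_vec ((sh \<mu> ^^ m) v)"
proof (induction m)
  case (Suc m)
  have "sh (cnj \<mu>) (cnj_vec w) = cnj_vec (sh \<mu> w)" for w
    unfolding sh_def cnj_vec_T[symmetric] by (simp add: cnj_vec_def vec_eq_iff)
  then show ?case by (simp add: Suc)
qed simp

lemma spectral_space_eq: "spectral_space K P A = span (re_vec ` gen P)"
  unfolding spectral_space_def gen_def sh_def re_vec_def
  by (rule arg_cong[where f = span]) auto

lemma subspace_spectral_space: "subspace (spectral_space K P A)"
  by (simp add: spectral_space_eq subspace_span)

lemma spectral_space_subset: "spectral_space K P A \<subseteq> coord_space K"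
  unfolding spectral_space_eq
  by (rule span_minimal[OF _ subspace_coord_space]) (auto simp: gen_def re_vec_in_coord_space)

text \<open>The complexified vector is decomposed and real parts are taken. Only existence is
  obtained here; that the two parts are unique comes later from the uniqueness of slow
  solutions.\<close>

lemma coord_space_split:
  assumes "x \<in> coord_space K"
  shows "\<exists>c\<in>center_space K A. \<exists>h\<in>hyperbolic_space K A. x = c + h"
proof -
  have "gen (\<lambda>_. True) = gen (\<lambda>\<mu>. Re \<mu> = 0) \<union> gen (\<lambda>\<mu>. Re \<mu> \<noteq> 0)"
    by (auto simp: gen_def)
  moreover have "complex_vec x \<in> span (gen (\<lambda>_. True))"
    using V_eq_span_gen complex_vec_in_coord_space[OF assms] by blast
  ultimately obtain c h where ch: "c \<in> span (gen (\<lambda>\<mu>. Re \<mu> = 0))" "h \<in> span (gen (\<lambda>\<mu>. Re \<mu> \<noteq> 0))"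
    "complex_vec x = c + h"
    by (auto simp: span_Un)
  have "x = re_vec c + re_vec h"
    using ch(3) re_vec_complex_vec[of x] linear_add[OF linear_re_vec] by metis
  moreover have "re_vec c \<in> center_space K A" "re_vec h \<in> hyperbolic_space K A"
    using ch(1,2) by (simp_all add: spectral_space_eq linear_span_image[OF linear_re_vec])
  ultimately show ?thesis by blast
qed

lemma re_vec_solution:
  assumes "(x has_vector_derivative complex_block K A *v x t + q) (at t)"
  shows "((\<lambda>t. re_vec (x t)) has_vector_derivative A *v re_vec (x t) + re_vec q) (at t)"
  using bounded_linear.has_vector_derivative[OF linear_re_vec[unfolded linear_conv_bounded_linear] assms]
  by (simp add: linear_add[OF linear_re_vec] re_vec_T)

lemma ex_hyperbolic_solution:
  assumes \<eta>: "\<eta> > 0"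
    and gap: "gap \<eta>"
  shows "\<exists>C\<ge>0. \<forall>p P. continuous_on UNIV p \<longrightarrow>
     (\<forall>t. p t \<in> coord_space K \<and> norm (p t) \<le> P * exp (\<eta> * \<bar>t\<bar>)) \<longrightarrow>
     (\<exists>x. x 0 \<in> hyperbolic_space K A \<and> (\<forall>t. x t \<in> coord_space K \<and>
        (x has_vector_derivative A *v x t + p t) (at t) \<and> norm (x t) \<le> C * P * exp (\<eta> * \<bar>t\<bar>)))"
proof -
  \<comment> \<open>The solution is a superposition over coordinate directions. Directions outside
    \<open>K\<close> are replaced by 0 to stay in the coordinate space; the forcing has no component
    there.\<close>
  define e :: "'n \<Rightarrow> complex^'n" where "e k = (if k \<in> K then axis k 1 else 0)" for k
  have e: "e k \<in> coord_space K" for k by (auto simp: e_def coord_space_def axis_def)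
  have "\<forall>k. \<exists>C\<ge>0. \<forall>p P. continuous_on UNIV p \<longrightarrow>
     (\<forall>t. norm (p t :: complex) \<le> P * exp (\<eta> * \<bar>t\<bar>)) \<longrightarrow>
     (\<exists>x. x 0 \<in> span (gen (\<lambda>\<mu>. Re \<mu> \<noteq> 0)) \<and> (\<forall>t. x t \<in> coord_space K \<and>
        (x has_vector_derivative complex_block K A *v x t + p t *s e k) (at t)
        \<and> norm (x t) \<le> C * P * exp (\<eta> * \<bar>t\<bar>)))"
    using solvable_all[OF \<eta> gap e] unfolding solvable_def by blast
  then obtain C where C0: "\<And>k. C k \<ge> 0" and C: "\<And>k p P. continuous_on UNIV p \<Longrightarrow>
     (\<forall>t. norm (p t :: complex) \<le> P * exp (\<eta> * \<bar>t\<bar>)) \<Longrightarrow>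
     (\<exists>x. x 0 \<in> span (gen (\<lambda>\<mu>. Re \<mu> \<noteq> 0)) \<and> (\<forall>t. x t \<in> coord_space K \<and>
        (x has_vector_derivative complex_block K A *v x t + p t *s e k) (at t)
        \<and> norm (x t) \<le> C k * P * exp (\<eta> * \<bar>t\<bar>)))"
    by metis
  show ?thesis
  proof (intro exI[of _ "\<Sum>k\<in>UNIV. C k"] conjI allI impI)
    show "0 \<le> (\<Sum>k\<in>UNIV. C k)" using C0 by (simp add: sum_nonneg)
    fix p :: "real \<Rightarrow> real^'n" and P
    assume p: "continuous_on UNIV p" "\<forall>t. p t \<in> coord_space K \<and> norm (p t) \<le> P * exp (\<eta> * \<bar>t\<bar>)"
    have "\<forall>k. \<exists>x. x 0 \<in> span (gen (\<lambda>\<mu>. Re \<mu> \<noteq> 0)) \<and> (\<forall>t. x t \<in> coord_space K \<and>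
        (x has_vector_derivative complex_block K A *v x t + complex_of_real (p t $ k) *s e k) (at t)
        \<and> norm (x t) \<le> C k * P * exp (\<eta> * \<bar>t\<bar>))"
    proof (intro allI C)
      show "continuous_on UNIV (\<lambda>t. complex_of_real (p t $ k))" for k
        by (intro continuous_intros p)
      show "norm (complex_of_real (p t $ k)) \<le> P * exp (\<eta> * \<bar>t\<bar>)" for k t
        using p(2) component_le_norm_cart[of "p t" k] by (auto intro: order_trans)
    qed
    then obtain x where x0: "\<And>k. x k 0 \<in> span (gen (\<lambda>\<mu>. Re \<mu> \<noteq> 0))"
      and xV: "\<And>k t. x k t \<in> coord_space K"
      and xd: "\<And>k t. (x k has_vector_derivative
          complex_block K A *v x k t + complex_of_real (p t $ k) *s e k) (at t)"
      and xb: "\<And>k t. norm (x k t) \<le> C k * P * exp (\<eta> * \<bar>t\<bar>)"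
      by metis
    let ?y = "\<lambda>t. \<Sum>k\<in>UNIV. x k t"
    let ?x = "\<lambda>t. re_vec (?y t)"
    have "?y 0 \<in> span (gen (\<lambda>\<mu>. Re \<mu> \<noteq> 0))" by (intro span_sum x0)
    then have x0': "?x 0 \<in> hyperbolic_space K A"
      by (simp only: spectral_space_eq linear_span_image[OF linear_re_vec]) (rule imageI)
    have xV': "?x t \<in> coord_space K" for t
      by (intro re_vec_in_coord_space subspace_sum[OF subspace_V] xV)
    have xd': "(?x has_vector_derivative A *v ?x t + p t) (at t)" for t
    proof -
      have "(?y has_vector_derivative (\<Sum>k\<in>UNIV. complex_block K A *v x k t
          + complex_of_real (p t $ k) *s e k)) (at t)"
        by (intro has_vector_derivative_sum xd)
      moreover have "(\<Sum>k\<in>UNIV. complex_block K A *v x k t + complex_of_real (p t $ k) *s e k)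
          = complex_block K A *v ?y t + complex_vec (p t)"
      proof -
        have "(\<Sum>k\<in>UNIV. complex_of_real (p t $ k) *s e k) $ i = complex_vec (p t) $ i" for i
        proof -
          have "(\<Sum>k\<in>UNIV. complex_of_real (p t $ k) *s e k) $ i
              = (\<Sum>k\<in>UNIV. if k = i then complex_of_real (p t $ i) else 0)"
            unfolding sum_component
            using p(2) by (intro sum.cong) (auto simp: e_def axis_def coord_space_def)
          then show ?thesis by (simp add: complex_vec_def)
        qed
        then have "(\<Sum>k\<in>UNIV. complex_of_real (p t $ k) *s e k) = complex_vec (p t)"
          by (simp add: vec_eq_iff del: sum_component)
        then show ?thesis
          by (simp only: sum.distrib linear_sum[OF bounded_linear.linear[OF bounded_linear_T]])
      qed
      ultimately have "(?y has_vector_derivative complex_block K A *v ?y t + complex_vec (p t)) (at t)"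
        by (rule has_vector_derivative_eq_rhs)
      from re_vec_solution[OF this] show ?thesis by simp
    qed
    have xb': "norm (?x t) \<le> (\<Sum>k\<in>UNIV. C k) * P * exp (\<eta> * \<bar>t\<bar>)" for t
    proof -
      have "norm (?x t) \<le> norm (?y t)" by (rule norm_re_vec_le)
      also have "\<dots> \<le> (\<Sum>k\<in>UNIV. C k * P * exp (\<eta> * \<bar>t\<bar>))" by (intro sum_norm_le xb)
      finally show ?thesis by (simp add: sum_distrib_right)
    qed
    show "\<exists>x. x 0 \<in> hyperbolic_space K A \<and> (\<forall>t. x t \<in> coord_space K \<and>
        (x has_vector_derivative A *v x t + p t) (at t)
        \<and> norm (x t) \<le> (\<Sum>k\<in>UNIV. C k) * P * exp (\<eta> * \<bar>t\<bar>))"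
      by (intro exI[of _ ?x] conjI allI x0' xV' xd' xb')
  qed
qed

lemma ex_center_space_solution:
  assumes \<eta>: "\<eta> > 0" and v: "v \<in> center_space K A"
  shows "\<exists>x C. C \<ge> 0 \<and> x 0 = v \<and> (\<forall>t. x t \<in> coord_space K \<and>
     (x has_vector_derivative A *v x t) (at t) \<and> norm (x t) \<le> C * exp (\<eta> * \<bar>t\<bar>))"
  using v unfolding spectral_space_eq
proof (induction rule: span_induct_alt)
  case base
  show ?case
    by (intro exI[of _ "\<lambda>_. 0"] exI[of _ "0::real"]) (auto simp: V_0 coord_space_def)
next
  case (step c w v)
  obtain b \<mu> m where b: "b \<in> coord_space K" "Re \<mu> = 0" "(sh \<mu> ^^ m) b = 0" "w = re_vec b"
    using step(1) by (auto simp: gen_def)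
  obtain z D where z: "z 0 = b" "\<And>t. z t \<in> coord_space K"
     "\<And>t. (z has_vector_derivative complex_block K A *v z t + 0) (at t)"
     "\<And>t. norm (z t) \<le> D * exp (\<eta> * \<bar>t\<bar>)"
    using ex_center_solution[OF b(2) \<eta> b(1) b(3)] by auto
  have D: "D \<ge> 0" using order_trans[OF norm_ge_zero z(4)[of 0]] by simp
  obtain y C where y: "C \<ge> 0" "y 0 = v" "\<And>t. y t \<in> coord_space K"
    "\<And>t. (y has_vector_derivative A *v y t) (at t)" "\<And>t. norm (y t) \<le> C * exp (\<eta> * \<bar>t\<bar>)"
    using step(2) by blast
  let ?x = "\<lambda>t. c *\<^sub>R re_vec (z t) + y t"
  have re0: "re_vec 0 = (0 :: real^'n)" by (rule linear_0[OF linear_re_vec])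
  have xV: "?x t \<in> coord_space K" for t
    by (intro subspace_add[OF subspace_coord_space] subspace_mul[OF subspace_coord_space]
        re_vec_in_coord_space z y)
  have xd: "(?x has_vector_derivative A *v ?x t) (at t)" for t
  proof -
    have "(?x has_vector_derivative c *\<^sub>R (A *v re_vec (z t) + re_vec 0) + A *v y t) (at t)"
      by (intro has_vector_derivative_add y re_vec_solution z
          bounded_linear.has_vector_derivative[OF bounded_linear_scaleR_right])
    then show ?thesis
      by (rule has_vector_derivative_eq_rhs)
        (simp add: re0 matrix_vector_right_distrib matrix_vector_mult_scaleR)
  qed
  have xb: "norm (?x t) \<le> (\<bar>c\<bar> * D + C) * exp (\<eta> * \<bar>t\<bar>)" for t
  proof -
    have "norm (?x t) \<le> \<bar>c\<bar> * norm (re_vec (z t)) + norm (y t)"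
      using norm_triangle_ineq[of "c *\<^sub>R re_vec (z t)" "y t"] by simp
    also have "\<dots> \<le> \<bar>c\<bar> * (D * exp (\<eta> * \<bar>t\<bar>)) + C * exp (\<eta> * \<bar>t\<bar>)"
      by (intro add_mono mult_left_mono order_trans[OF norm_re_vec_le] z y) simp
    finally show ?thesis by (simp add: algebra_simps)
  qed
  have "?x 0 = c *\<^sub>R w + v" by (simp add: z y b)
  moreover have "\<bar>c\<bar> * D + C \<ge> 0" using D y by simp
  ultimately show ?case using xV xd xb
    by (intro exI[of _ ?x] exI[of _ "\<bar>c\<bar> * D + C"] conjI allI)
qed

text \<open>An orthonormal basis makes the bound linear in \<open>norm v\<close>, because the
  coefficients \<open>v \<bullet> b\<close> are at most \<open>norm v\<close> in absolute
  value.\<close>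

lemma ex_center_space_solution_uniform:
  assumes \<eta>: "\<eta> > 0"
  shows "\<exists>C\<ge>0. \<forall>v\<in>center_space K A. \<exists>x. x 0 = v \<and> (\<forall>t. x t \<in> coord_space K \<and>
     (x has_vector_derivative A *v x t) (at t) \<and> norm (x t) \<le> C * norm v * exp (\<eta> * \<bar>t\<bar>))"
proof -
  obtain B where B: "B \<subseteq> center_space K A" "pairwise orthogonal B" "\<And>x. x \<in> B \<Longrightarrow> norm x = 1"
    "independent B" "span B = center_space K A"
    using orthonormal_basis_subspace[OF subspace_spectral_space] by metis
  have fin: "finite B" using B(4) by (rule independent_imp_finite)
  have "\<forall>b\<in>B. \<exists>x C. C \<ge> 0 \<and> x 0 = b \<and> (\<forall>t. x t \<in> coord_space K \<and>
     (x has_vector_derivative A *v x t) (at t) \<and> norm (x t) \<le> C * exp (\<eta> * \<bar>t\<bar>))"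
    using ex_center_space_solution[OF \<eta>] B(1) by blast
  then obtain x C where x: "\<And>b. b \<in> B \<Longrightarrow> C b \<ge> 0" "\<And>b. b \<in> B \<Longrightarrow> x b 0 = b"
    "\<And>b t. b \<in> B \<Longrightarrow> x b t \<in> coord_space K"
    "\<And>b t. b \<in> B \<Longrightarrow> (x b has_vector_derivative A *v x b t) (at t)"
    "\<And>b t. b \<in> B \<Longrightarrow> norm (x b t) \<le> C b * exp (\<eta> * \<bar>t\<bar>)"
    by metis
  show ?thesis
  proof (intro exI[of _ "\<Sum>b\<in>B. C b"] conjI ballI)
    show "0 \<le> (\<Sum>b\<in>B. C b)" using x by (simp add: sum_nonneg)
    fix v assume v: "v \<in> center_space K A"
    let ?x = "\<lambda>t. \<Sum>b\<in>B. (v \<bullet> b) *\<^sub>R x b t"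
    have x0: "?x 0 = v"
      using orthonormal_basis_expand[OF B(2,3) _ fin, of v] v B(5) x(2) by simp
    have xV: "?x t \<in> coord_space K" for t
      by (intro subspace_sum[OF subspace_coord_space] subspace_mul[OF subspace_coord_space] x)
    have xd: "(?x has_vector_derivative A *v ?x t) (at t)" for t
    proof -
      have "(?x has_vector_derivative (\<Sum>b\<in>B. (v \<bullet> b) *\<^sub>R (A *v x b t))) (at t)"
        by (intro has_vector_derivative_sum x
            bounded_linear.has_vector_derivative[OF bounded_linear_scaleR_right])
      then show ?thesis
        by (rule has_vector_derivative_eq_rhs)
          (simp add: linear_sum[OF matrix_vector_mul_linear] matrix_vector_mult_scaleR)
    qed
    have xb: "norm (?x t) \<le> (\<Sum>b\<in>B. C b) * norm v * exp (\<eta> * \<bar>t\<bar>)" for t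
    proof -
      have "norm (?x t) \<le> (\<Sum>b\<in>B. norm v * (C b * exp (\<eta> * \<bar>t\<bar>)))"
      proof (rule sum_norm_le)
        fix b assume b: "b \<in> B"
        have "\<bar>v \<bullet> b\<bar> \<le> norm v" using Cauchy_Schwarz_ineq2[of v b] B(3)[OF b] by simp
        then show "norm ((v \<bullet> b) *\<^sub>R x b t) \<le> norm v * (C b * exp (\<eta> * \<bar>t\<bar>))"
          using x(5)[OF b, of t] by (simp add: mult_mono)
      qed
      then show ?thesis by (simp add: sum_distrib_left sum_distrib_right mult_ac)
    qed
    show "\<exists>x. x 0 = v \<and> (\<forall>t. x t \<in> coord_space K \<and> (x has_vector_derivative A *v x t) (at t)
        \<and> norm (x t) \<le> (\<Sum>b\<in>B. C b) * norm v * exp (\<eta> * \<bar>t\<bar>))"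
      by (intro exI[of _ ?x] conjI allI x0 xV xd xb)
  qed
qed

text \<open>The real part of a vector is half the sum of the vector and its conjugate. As
  \<open>A\<close> is real, the conjugate belongs to the conjugate eigenvalue, so each root enters
  the list together with its conjugate, which is equally far from the imaginary axis.\<close>

lemma ex_hyperbolic_kill_list:
  assumes gap: "gap \<eta>"
    and w: "w \<in> hyperbolic_space K A"
  shows "\<exists>L. (\<forall>\<mu>\<in>set L. \<eta> < \<bar>Re \<mu>\<bar>) \<and> kill L (complex_vec w) = 0"
  using w unfolding spectral_space_eq
proof (induction rule: span_induct_alt)
  case base
  show ?case by (intro exI[of _ "[]"]) (simp add: linear_0[OF linear_complex_vec])
next
  case (step c x y)
  obtain L where L: "\<forall>\<mu>\<in>set L. \<eta> < \<bar>Re \<mu>\<bar>" "kill L (complex_vec y) = 0" using step by blast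
  obtain v \<mu> m where v: "v \<in> coord_space K" "Re \<mu> \<noteq> 0" "(sh \<mu> ^^ m) v = 0" "x = re_vec v"
    using step(1) by (auto simp: gen_def)
  show ?case
  proof (cases "v = 0")
    case True
    have "re_vec 0 = (0 :: real^'n)" by (rule linear_0[OF linear_re_vec])
    then have "c *\<^sub>R x + y = y" using True v by simp
    then show ?thesis using L by auto
  next
    case False
    define L' where "L' = replicate m \<mu> @ replicate m (cnj \<mu>)"
    have "\<eta> < \<bar>Re \<mu>\<bar>" using gap v(1-3) False unfolding gap_def by blast
    then have gap': "\<forall>\<mu>\<in>set L'. \<eta> < \<bar>Re \<mu>\<bar>" by (auto simp: L'_def)
    have "kill L' v = 0" using v(3) by (simp add: L'_def kill_append kill_replicate)
    moreover have "cnj_vec 0 = (0 :: complex^'n)" by (simp add: cnj_vec_def vec_eq_iff)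
    then have "kill (replicate m (cnj \<mu>)) (cnj_vec v) = 0"
      by (simp only: kill_replicate sh_pow_cnj v(3))
    then have "kill L' (cnj_vec v) = 0"
      using kill_kill[of "replicate m (cnj \<mu>)" "replicate m \<mu>" "cnj_vec v"]
      by (simp add: L'_def kill_append)
    moreover have "complex_vec x = (1/2) *s (v + cnj_vec v)"
      by (simp add: v(4) complex_vec_def re_vec_def cnj_vec_def vec_eq_iff complex_eq_iff)
    ultimately have x: "kill L' (complex_vec x) = 0"
      by (simp only: kill_smult kill_add) simp
    have "complex_vec (c *\<^sub>R x + y) = complex_of_real c *s complex_vec x + complex_vec y"
      by (simp add: linear_add[OF linear_complex_vec] linear_cmul[OF linear_complex_vec] scaleR_eq_smult)
    then have "kill (L @ L') (complex_vec (c *\<^sub>R x + y)) = 0"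
      using x L(2) kill_kill[of L' L "complex_vec x"]
      by (simp add: kill_add kill_smult kill_append)
    then show ?thesis using L gap' by (intro exI[of _ "L @ L'"]) auto
  qed
qed

lemma bounded_solution_zero:
  assumes gap: "gap \<eta>"
    and x: "\<And>t. (x has_vector_derivative A *v x t) (at t)"
    and b: "\<And>t. norm (x t) \<le> B * exp (\<eta> * \<bar>t\<bar>)"
    and x0: "x 0 \<in> hyperbolic_space K A"
  shows "x t = 0"
proof -
  obtain L where L: "\<forall>\<mu>\<in>set L. \<eta> < \<bar>Re \<mu>\<bar>" "kill L (complex_vec (x 0)) = 0"
    using ex_hyperbolic_kill_list[OF gap x0] by blast
  have "complex_vec (x t) = 0"
  proof (rule kill_solution_zero[of "\<lambda>t. complex_vec (x t)" B \<eta> L])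
    show "((\<lambda>t. complex_vec (x t)) has_vector_derivative complex_block K A *v complex_vec (x t)) (at t)" for t
      unfolding T_complex_vec
      by (rule bounded_linear.has_vector_derivative[OF linear_complex_vec[unfolded linear_conv_bounded_linear] x])
  qed (use L b in \<open>auto simp: norm_complex_vec\<close>)
  then show ?thesis using norm_complex_vec[of "x t"] by simp
qed

end

section \<open>Solutions of slow growth\<close>

text \<open>An interface to the linear part that mentions neither eigenvalues nor a projection:
  \<open>x 0 - v \<in> Eh\<close> expresses that \<open>v\<close> is the center component of
  \<open>x 0\<close>. \<open>\<beta>\<close> is the spectral gap, below which slow forcing has slow
  responses and slow solutions are unique.\<close>

locale lyapunov_perron =
  fixes A :: "'a::euclidean_space \<Rightarrow> 'a" and X Ec Eh :: "'a set" and \<beta> :: real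
  assumes A: "bounded_linear A"
    and X: "subspace X" and Ec: "subspace Ec" and Eh: "subspace Eh"
    and split: "x \<in> X \<Longrightarrow> \<exists>c\<in>Ec. \<exists>h\<in>Eh. x = c + h"
    and center_solution: "0 < \<eta> \<Longrightarrow> \<exists>C\<ge>0. \<forall>v\<in>Ec. \<exists>x. x 0 = v \<and> (\<forall>t. x t \<in> X \<and>
       (x has_vector_derivative A (x t)) (at t) \<and> norm (x t) \<le> C * norm v * exp (\<eta> * \<bar>t\<bar>))"
    and hyperbolic_solution: "0 < \<eta> \<Longrightarrow> \<eta> < \<beta> \<Longrightarrow> \<exists>C\<ge>0. \<forall>p P. continuous_on UNIV p \<longrightarrow>
       (\<forall>t. p t \<in> X \<and> norm (p t) \<le> P * exp (\<eta> * \<bar>t\<bar>)) \<longrightarrow>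
       (\<exists>x. x 0 \<in> Eh \<and> (\<forall>t. x t \<in> X \<and> (x has_vector_derivative A (x t) + p t) (at t)
          \<and> norm (x t) \<le> C * P * exp (\<eta> * \<bar>t\<bar>)))"
    and solution_unique: "0 < \<eta> \<Longrightarrow> \<eta> < \<beta> \<Longrightarrow> (\<And>t. (z has_vector_derivative A (z t)) (at t)) \<Longrightarrow>
       (\<And>t. norm (z t) \<le> B * exp (\<eta> * \<bar>t\<bar>)) \<Longrightarrow> z 0 \<in> Eh \<Longrightarrow> z r = 0"
begin

definition admissible :: "real \<Rightarrow> real \<Rightarrow> bool" where
  "admissible \<eta> C \<longleftrightarrow> 0 < \<eta> \<and> \<eta> < \<beta> \<and> 0 \<le> C \<and>
     (\<forall>v\<in>Ec. \<forall>p P. continuous_on UNIV p \<longrightarrow> (\<forall>t. p t \<in> X \<and> norm (p t) \<le> P * exp (\<eta> * \<bar>t\<bar>)) \<longrightarrow>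
       (\<exists>x. x 0 - v \<in> Eh \<and> (\<forall>t. x t \<in> X \<and> (x has_vector_derivative A (x t) + p t) (at t)
          \<and> norm (x t) \<le> C * (norm v + P) * exp (\<eta> * \<bar>t\<bar>))))"

lemma ex_admissible:
  assumes "0 < \<eta>" "\<eta> < \<beta>"
  shows "\<exists>C. admissible \<eta> C"
proof -
  obtain C1 where C1: "C1 \<ge> 0" and c: "\<And>v. v \<in> Ec \<Longrightarrow> \<exists>x. x 0 = v \<and> (\<forall>t. x t \<in> X \<and>
       (x has_vector_derivative A (x t)) (at t) \<and> norm (x t) \<le> C1 * norm v * exp (\<eta> * \<bar>t\<bar>))"
    using center_solution[OF assms(1)] by blast
  obtain C2 where C2: "C2 \<ge> 0" and h: "\<And>p P. continuous_on UNIV p \<Longrightarrow>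
       (\<forall>t. p t \<in> X \<and> norm (p t) \<le> P * exp (\<eta> * \<bar>t\<bar>)) \<Longrightarrow>
       (\<exists>x. x 0 \<in> Eh \<and> (\<forall>t. x t \<in> X \<and> (x has_vector_derivative A (x t) + p t) (at t)
          \<and> norm (x t) \<le> C2 * P * exp (\<eta> * \<bar>t\<bar>)))"
    using hyperbolic_solution[OF assms] by blast
  have "admissible \<eta> (C1 + C2)"
    unfolding admissible_def
  proof (intro conjI ballI allI impI)
    fix v p P
    assume v: "v \<in> Ec" and p: "continuous_on UNIV p" "\<forall>t. p t \<in> X \<and> norm (p t) \<le> P * exp (\<eta> * \<bar>t\<bar>)"
    have P: "P \<ge> 0" using order_trans[OF norm_ge_zero conjunct2[OF spec[OF p(2), of 0]]] by simp
    obtain x where x: "x 0 = v" "\<And>t. x t \<in> X" "\<And>t. (x has_vector_derivative A (x t)) (at t)"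
      "\<And>t. norm (x t) \<le> C1 * norm v * exp (\<eta> * \<bar>t\<bar>)" using c[OF v] by blast
    obtain y where y: "y 0 \<in> Eh" "\<And>t. y t \<in> X" "\<And>t. (y has_vector_derivative A (y t) + p t) (at t)"
      "\<And>t. norm (y t) \<le> C2 * P * exp (\<eta> * \<bar>t\<bar>)" using h[OF p] by blast
    have xb: "norm (x t + y t) \<le> (C1 + C2) * (norm v + P) * exp (\<eta> * \<bar>t\<bar>)" for t
    proof -
      have "norm (x t + y t) \<le> C1 * norm v * exp (\<eta> * \<bar>t\<bar>) + C2 * P * exp (\<eta> * \<bar>t\<bar>)"
        by (intro norm_triangle_le add_mono x y)
      also have "\<dots> = (C1 * norm v + C2 * P) * exp (\<eta> * \<bar>t\<bar>)" by (simp add: algebra_simps)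
      also have "\<dots> \<le> (C1 + C2) * (norm v + P) * exp (\<eta> * \<bar>t\<bar>)"
        using C1 C2 P by (intro mult_right_mono) (auto simp: algebra_simps)
      finally show ?thesis .
    qed
    have xd: "((\<lambda>t. x t + y t) has_vector_derivative A (x t + y t) + p t) (at t)" for t
      by (rule has_vector_derivative_eq_rhs[OF has_vector_derivative_add[OF x(3) y(3)]])
        (simp add: linear_add[OF bounded_linear.linear[OF A]])
    show "\<exists>x. x 0 - v \<in> Eh \<and> (\<forall>t. x t \<in> X \<and> (x has_vector_derivative A (x t) + p t) (at t)
          \<and> norm (x t) \<le> (C1 + C2) * (norm v + P) * exp (\<eta> * \<bar>t\<bar>))"
      using y(1) by (intro exI[of _ "\<lambda>t. x t + y t"] conjI allI xb xd subspace_add[OF X] x y) (simp add: x)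
  qed (use assms C1 C2 in auto)
  then show ?thesis ..
qed

lemma A_diff: "A (x - y) = A x - A y"
  by (rule linear_diff[OF bounded_linear.linear[OF A]])

text \<open>An a priori bound. The constant \<open>B\<close> merely certifies slow growth;
  uniqueness then identifies \<open>z\<close> with the solution supplied by
  \<open>admissible\<close>, whose bound does not involve \<open>B\<close>.\<close>

lemma linear_estimate:
  assumes ad: "admissible \<eta> C" and w: "w \<in> Ec" and p: "continuous_on UNIV p"
    and pX: "\<And>t. p t \<in> X" and pb: "\<And>t. norm (p t) \<le> P * exp (\<eta> * \<bar>t\<bar>)"
    and z: "\<And>t. (z has_vector_derivative A (z t) + p t) (at t)"
    and zb: "\<And>t. norm (z t) \<le> B * exp (\<eta> * \<bar>t\<bar>)" and z0: "z 0 - w \<in> Eh"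
  shows "norm (z t) \<le> C * (norm w + P) * exp (\<eta> * \<bar>t\<bar>)"
proof -
  have \<eta>: "0 < \<eta>" "\<eta> < \<beta>" using ad by (auto simp: admissible_def)
  obtain x where x: "x 0 - w \<in> Eh" "\<And>t. (x has_vector_derivative A (x t) + p t) (at t)"
    and xb: "\<And>t. norm (x t) \<le> C * (norm w + P) * exp (\<eta> * \<bar>t\<bar>)"
    using ad w p pX pb unfolding admissible_def by metis
  have "z t - x t = 0"
  proof (rule solution_unique[OF \<eta>, of "\<lambda>t. z t - x t" "B + C * (norm w + P)"])
    show "((\<lambda>t. z t - x t) has_vector_derivative A (z t - x t)) (at t)" for t
      by (rule has_vector_derivative_eq_rhs[OF has_vector_derivative_diff[OF z x(2)]])
        (simp add: A_diff)
    show "norm (z t - x t) \<le> (B + C * (norm w + P)) * exp (\<eta> * \<bar>t\<bar>)" for t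
      using norm_triangle_ineq4[of "z t" "x t"] zb[of t] xb[of t] by (simp add: distrib_right)
    show "z 0 - x 0 \<in> Eh" using subspace_diff[OF Eh z0 x(1)] by simp
  qed
  then show ?thesis using xb by simp
qed

text \<open>Absorption: the weighted supremum \<open>N\<close> of \<open>z\<close> satisfies
  \<open>N \<le> C * (norm w + P) + (C * L) * N\<close>, and the last term is at most half of
  \<open>N\<close>. The bound by \<open>B\<close> makes \<open>N\<close> finite. Uniqueness,
  Lipschitz dependence and differentiability are all obtained from this estimate.\<close>

lemma perturbed_estimate:
  assumes ad: "admissible \<eta> C" and L: "0 \<le> L" "C * L \<le> 1 / 2" and P: "0 \<le> P"
    and w: "w \<in> Ec" and p: "continuous_on UNIV p"
    and pX: "\<And>t. p t \<in> X" and pb: "\<And>t. norm (p t) \<le> L * norm (z t) + P * exp (\<eta> * \<bar>t\<bar>)"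
    and z: "\<And>t. (z has_vector_derivative A (z t) + p t) (at t)"
    and zb: "\<And>t. norm (z t) \<le> B * exp (\<eta> * \<bar>t\<bar>)" and z0: "z 0 - w \<in> Eh"
  shows "norm (z t) \<le> 2 * C * (norm w + P) * exp (\<eta> * \<bar>t\<bar>)"
proof -
  define n where "n t = norm (z t) * exp (- (\<eta> * \<bar>t\<bar>))" for t
  have n: "norm (z t) = n t * exp (\<eta> * \<bar>t\<bar>)" for t by (simp add: n_def exp_minus field_simps)
  have nle: "n t \<le> D" if "norm (z t) \<le> D * exp (\<eta> * \<bar>t\<bar>)" for t D
    using that unfolding n by simp
  define N where "N = (SUP t. n t)"
  have "bdd_above (range n)" using nle[OF zb] by (intro bdd_aboveI[of _ B]) auto
  then have nN: "n t \<le> N" for t unfolding N_def by (intro cSUP_upper) auto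
  have pb': "norm (p t) \<le> (L * N + P) * exp (\<eta> * \<bar>t\<bar>)" for t
  proof -
    have "norm (p t) \<le> L * (n t * exp (\<eta> * \<bar>t\<bar>)) + P * exp (\<eta> * \<bar>t\<bar>)" using pb[of t] n by simp
    also have "\<dots> \<le> L * (N * exp (\<eta> * \<bar>t\<bar>)) + P * exp (\<eta> * \<bar>t\<bar>)"
      using nN L by (intro add_mono mult_left_mono mult_right_mono) auto
    finally show ?thesis by (simp add: algebra_simps)
  qed
  have "n t \<le> C * (norm w + (L * N + P))" for t
    by (rule nle) (rule linear_estimate[OF ad w p pX pb' z zb z0])
  then have "N \<le> C * (norm w + (L * N + P))" unfolding N_def by (intro cSUP_least) auto
  also have "\<dots> = C * (norm w + P) + (C * L) * N" by (simp add: algebra_simps)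
  also have "\<dots> \<le> C * (norm w + P) + 1 / 2 * N"
    using L(2) order_trans[OF _ nN[of 0]] by (intro add_left_mono mult_right_mono) (auto simp: n_def)
  finally have "N \<le> 2 * C * (norm w + P)" by simp
  then have "n t * exp (\<eta> * \<bar>t\<bar>) \<le> 2 * C * (norm w + P) * exp (\<eta> * \<bar>t\<bar>)"
    using nN[of t] by (intro mult_right_mono) auto
  then show ?thesis using n by simp
qed

text \<open>The perturbation \<open>G\<close> may depend on time, so that the nonlinear equation and
  its linearization along a solution are both covered.\<close>

lemma ex_perturbed_solution:
  assumes ad: "admissible \<eta> C" and L: "0 \<le> L" "C * L \<le> 1 / 2" and v: "v \<in> Ec"
    and G: "\<And>x. continuous_on UNIV x \<Longrightarrow> continuous_on UNIV (\<lambda>t. G t (x t))"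
    and GX: "\<And>t z. G t z \<in> X" and G0: "\<And>t. G t 0 = 0"
    and Lip: "\<And>t y z. norm (G t y - G t z) \<le> L * norm (y - z)"
  shows "\<exists>x. x 0 - v \<in> Eh \<and> (\<forall>t. x t \<in> X \<and> (x has_vector_derivative A (x t) + G t (x t)) (at t)
     \<and> norm (x t) \<le> 2 * C * norm v * exp (\<eta> * \<bar>t\<bar>))"
proof -
  have C0: "C \<ge> 0" using ad by (simp add: admissible_def)
  define e where "e t = exp (\<eta> * \<bar>t\<bar>)" for t
  have e: "e t > 0" for t by (simp add: e_def)
  have ce: "continuous_on UNIV e" unfolding e_def[abs_def] by (intro continuous_intros)
  \<comment> \<open>The unknown of the fixed point equation is the solution divided by the weight
    \<open>e\<close>. This turns the weighted space into bounded continuous functions with the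
    supremum norm, which form a complete space.\<close>
  define p where "p y t = G t (e t *\<^sub>R apply_bcontfun y t)" for y t
  have p: "continuous_on UNIV (p y)" for y
    unfolding p_def[abs_def] by (intro G continuous_intros ce) simp
  have pX: "p y t \<in> X" for y t by (simp add: p_def GX)
  have pdiff: "norm (p y t - p y' t) \<le> L * dist y y' * e t" for y y' t
  proof -
    have "norm (p y t - p y' t) \<le> L * norm (e t *\<^sub>R apply_bcontfun y t - e t *\<^sub>R apply_bcontfun y' t)"
      unfolding p_def by (rule Lip)
    also have "\<dots> = L * (e t * dist (apply_bcontfun y t) (apply_bcontfun y' t))"
      using e[of t] by (simp add: dist_norm scaleR_diff_right[symmetric])
    also have "\<dots> \<le> L * (e t * dist y y')"
      using L e[of t] by (intro mult_left_mono dist_bounded) auto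
    finally show ?thesis by (simp add: mult_ac)
  qed
  have p0: "p 0 t = 0" for t by (simp add: p_def G0)
  have pb: "norm (p y t) \<le> L * norm y * exp (\<eta> * \<bar>t\<bar>)" for y t
    using pdiff[of y t 0] by (simp add: p0 e_def)
  have "\<forall>y. \<exists>x. x 0 - v \<in> Eh \<and> (\<forall>t. x t \<in> X \<and> (x has_vector_derivative A (x t) + p y t) (at t)
     \<and> norm (x t) \<le> C * (norm v + L * norm y) * exp (\<eta> * \<bar>t\<bar>))"
    using ad v p pX pb unfolding admissible_def by blast
  then obtain S where S0: "\<And>y. S y 0 - v \<in> Eh" and SX: "\<And>y t. S y t \<in> X"
    and S: "\<And>y t. (S y has_vector_derivative A (S y t) + p y t) (at t)"
    and Sb: "\<And>y t. norm (S y t) \<le> C * (norm v + L * norm y) * e t"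
    unfolding e_def by metis
  define \<Psi> where "\<Psi> y = Bcontfun (\<lambda>t. (1 / e t) *\<^sub>R S y t)" for y
  have \<Psi>: "apply_bcontfun (\<Psi> y) t = (1 / e t) *\<^sub>R S y t" for y t
  proof -
    have "continuous_on UNIV (S y)"
      using S by (meson continuous_at_imp_continuous_on has_vector_derivative_continuous)
    then have "(\<lambda>t. (1 / e t) *\<^sub>R S y t) \<in> bcontfun"
      using e Sb[of y]
      by (intro bcontfun_normI[where b = "C * (norm v + L * norm y)"] continuous_intros ce)
        (auto simp: less_imp_neq[symmetric] divide_le_eq abs_of_pos)
    then show ?thesis by (simp add: \<Psi>_def Bcontfun_inverse)
  qed
  have "dist (\<Psi> y) (\<Psi> y') \<le> 1 / 2 * dist y y'" for y y'
  proof (rule dist_bound)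
    fix t
    have "norm (S y t - S y' t) \<le> C * (norm (0::'a) + L * dist y y') * exp (\<eta> * \<bar>t\<bar>)"
    proof (rule linear_estimate[OF ad subspace_0[OF Ec],
          where z = "\<lambda>t. S y t - S y' t" and p = "\<lambda>t. p y t - p y' t"])
      show "continuous_on UNIV (\<lambda>t. p y t - p y' t)" by (intro continuous_intros p)
      show "p y t - p y' t \<in> X" for t by (intro subspace_diff[OF X] pX)
      show "norm (p y t - p y' t) \<le> L * dist y y' * exp (\<eta> * \<bar>t\<bar>)" for t
        using pdiff by (simp add: e_def)
      show "((\<lambda>t. S y t - S y' t) has_vector_derivative A (S y t - S y' t) + (p y t - p y' t)) (at t)" for t
        by (rule has_vector_derivative_eq_rhs[OF has_vector_derivative_diff[OF S S]])
          (simp add: A_diff)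
      show "norm (S y t - S y' t)
          \<le> (C * (norm v + L * norm y) + C * (norm v + L * norm y')) * exp (\<eta> * \<bar>t\<bar>)" for t
        using norm_triangle_ineq4[of "S y t" "S y' t"] Sb[of y t] Sb[of y' t]
        by (simp add: e_def distrib_right)
      show "S y 0 - S y' 0 - 0 \<in> Eh"
        using subspace_diff[OF Eh S0[of y] S0[of y']] by simp
    qed
    also have "\<dots> = (C * L) * (dist y y' * e t)" by (simp add: e_def)
    also have "\<dots> \<le> 1 / 2 * (dist y y' * e t)"
      using L e[of t] by (intro mult_right_mono) auto
    finally have "norm (S y t - S y' t) \<le> 1 / 2 * dist y y' * e t" by simp
    then show "dist (apply_bcontfun (\<Psi> y) t) (apply_bcontfun (\<Psi> y') t) \<le> 1 / 2 * dist y y'"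
      using e[of t] by (simp add: \<Psi> dist_norm scaleR_diff_right[symmetric] divide_le_eq)
  qed
  then have "\<exists>!y. \<Psi> y = y" by (intro banach_fix_type[of "1/2"]) auto
  then obtain y where y: "\<Psi> y = y" by blast
  define x where "x = S y"
  have yx: "e t *\<^sub>R apply_bcontfun y t = x t" for t
    using \<Psi>[of y t] e[of t] by (simp add: y x_def less_imp_neq[symmetric])
  have px: "p y t = G t (x t)" for t by (simp add: p_def yx)
  have xd: "(x has_vector_derivative A (x t) + G t (x t)) (at t)" for t
    using S[of y t] px by (simp add: x_def)
  have xc: "continuous_on UNIV x"
    using xd by (meson continuous_at_imp_continuous_on has_vector_derivative_continuous)
  \<comment> \<open>So far \<open>x\<close> is bounded only in terms of the unknown
    \<open>norm y\<close>; absorption replaces this by a bound in terms of \<open>v\<close>.\<close>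
  have xb: "norm (x t) \<le> 2 * C * (norm v + 0) * exp (\<eta> * \<bar>t\<bar>)" for t
  proof (rule perturbed_estimate[OF ad L order_refl v G[OF xc] GX _ xd])
    show "norm (G t (x t)) \<le> L * norm (x t) + 0 * exp (\<eta> * \<bar>t\<bar>)" for t
      using Lip[of t "x t" 0] by (simp add: G0)
    show "norm (x t) \<le> C * (norm v + L * norm y) * exp (\<eta> * \<bar>t\<bar>)" for t
      using Sb by (simp add: x_def e_def)
    show "x 0 - v \<in> Eh" by (simp add: x_def S0)
  qed
  show ?thesis
    using S0[of y] SX[of y] xd xb by (intro exI[of _ x]) (auto simp: x_def)
qed

end

text \<open>\<open>\<eta>\<close> is the growth rate of the solutions, and the larger
  \<open>\<eta>'\<close> is that of the error terms when they are differentiated in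
  \<open>v\<close>. The Lipschitz constant \<open>L\<close> has to be small for the solution
  operators at both rates.\<close>

locale center_manifold_equation = lyapunov_perron +
  fixes g :: "'a \<Rightarrow> 'a" and g' :: "'a \<Rightarrow> 'a \<Rightarrow>\<^sub>L 'a" and L \<eta> \<eta>' C C' :: real
  assumes g: "(g has_derivative blinfun_apply (g' x)) (at x)"
    and g': "continuous_on UNIV g'"
    and g'_bound: "norm (g' x) \<le> L"
    and g_0: "g 0 = 0" and g'_0: "g' 0 = 0"
    and g_X: "g x \<in> X" and g'_X: "blinfun_apply (g' x) y \<in> X"
    and ad: "admissible \<eta> C" and ad': "admissible \<eta>' C'" and \<eta>: "\<eta> < \<eta>'"
    and CL: "C * L \<le> 1 / 2" "C' * L \<le> 1 / 2"
begin

lemma L0: "0 \<le> L"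
  using order_trans[OF norm_ge_zero g'_bound] .

lemma C0: "0 \<le> C" "0 \<le> C'"
  using ad ad' by (auto simp: admissible_def)

lemma \<eta>0: "0 < \<eta>" using ad by (simp add: admissible_def)

lemma g'_apply_bound: "norm (blinfun_apply (g' x) y) \<le> L * norm y"
  using norm_blinfun[of "g' x" y] mult_right_mono[OF g'_bound[of x] norm_ge_zero[of y]] by linarith

lemma g_Lipschitz: "norm (g y - g z) \<le> L * norm (y - z)"
proof (rule differentiable_bound[of UNIV g "\<lambda>x. blinfun_apply (g' x)"])
  show "onorm (blinfun_apply (g' x)) \<le> L" for x
    using g'_bound[of x] by (simp add: norm_blinfun.rep_eq)
qed (use g in auto)

lemma g_continuous:
  assumes "continuous_on UNIV x"
  shows "continuous_on UNIV (\<lambda>t. g (x t))"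
proof (rule continuous_on_compose2[OF _ assms])
  show "continuous_on UNIV g"
    using has_derivative_continuous[OF g] by (intro continuous_at_imp_continuous_on) blast
qed simp

lemma g'_continuous:
  assumes "continuous_on UNIV x" "continuous_on UNIV y"
  shows "continuous_on UNIV (\<lambda>t. blinfun_apply (g' (x t)) (y t))"
  by (rule blinfun.continuous_on[OF continuous_on_compose2[OF g' assms(1)] assms(2)]) simp

section \<open>Slow solutions of the nonlinear equation\<close>

definition sol :: "'a \<Rightarrow> real \<Rightarrow> 'a" where
  "sol v = (SOME x. x 0 - v \<in> Eh \<and> (\<forall>t. x t \<in> X \<and> (x has_vector_derivative A (x t) + g (x t)) (at t)
     \<and> norm (x t) \<le> 2 * C * norm v * exp (\<eta> * \<bar>t\<bar>)))"

lemma sol: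
  assumes "v \<in> Ec"
  shows "sol v 0 - v \<in> Eh" "sol v t \<in> X" "(sol v has_vector_derivative A (sol v t) + g (sol v t)) (at t)"
    "norm (sol v t) \<le> 2 * C * norm v * exp (\<eta> * \<bar>t\<bar>)"
proof -
  have "\<exists>x. x 0 - v \<in> Eh \<and> (\<forall>t. x t \<in> X \<and> (x has_vector_derivative A (x t) + g (x t)) (at t)
     \<and> norm (x t) \<le> 2 * C * norm v * exp (\<eta> * \<bar>t\<bar>))"
    by (rule ex_perturbed_solution[OF ad L0 CL(1) assms, of "\<lambda>_. g"])
      (auto simp: g_0 g_X g_Lipschitz g_continuous)
  from someI_ex[OF this] show "sol v 0 - v \<in> Eh" "sol v t \<in> X"
    "(sol v has_vector_derivative A (sol v t) + g (sol v t)) (at t)"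
    "norm (sol v t) \<le> 2 * C * norm v * exp (\<eta> * \<bar>t\<bar>)"
    unfolding sol_def[symmetric] by blast+
qed

lemma sol_continuous: "v \<in> Ec \<Longrightarrow> continuous_on UNIV (sol v)"
  using sol(3) by (meson continuous_at_imp_continuous_on has_vector_derivative_continuous)

text \<open>\<open>y\<close> is any slow solution with center component \<open>w\<close>, not
  necessarily the chosen one: \<open>w = v\<close> gives uniqueness, and \<open>y = sol w\<close>
  gives Lipschitz dependence.\<close>

lemma sol_estimate:
  assumes v: "v \<in> Ec" and w: "w \<in> Ec"
    and y: "\<And>t. (y has_vector_derivative A (y t) + g (y t)) (at t)"
    and yb: "\<And>t. norm (y t) \<le> B * exp (\<eta> * \<bar>t\<bar>)" and y0: "y 0 - w \<in> Eh"
  shows "norm (y t - sol v t) \<le> 2 * C * (norm (w - v) + 0) * exp (\<eta> * \<bar>t\<bar>)"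
proof (rule perturbed_estimate[OF ad L0 CL(1) order_refl subspace_diff[OF Ec w v],
      where z = "\<lambda>t. y t - sol v t" and p = "\<lambda>t. g (y t) - g (sol v t)" and B = "B + 2 * C * norm v"])
  have "continuous_on UNIV y"
    using y by (meson continuous_at_imp_continuous_on has_vector_derivative_continuous)
  then show "continuous_on UNIV (\<lambda>t. g (y t) - g (sol v t))"
    by (intro continuous_intros g_continuous sol_continuous v)
  show "g (y t) - g (sol v t) \<in> X" for t by (intro subspace_diff[OF X] g_X)
  show "norm (g (y t) - g (sol v t)) \<le> L * norm (y t - sol v t) + 0 * exp (\<eta> * \<bar>t\<bar>)" for t
    using g_Lipschitz by simp
  show "((\<lambda>t. y t - sol v t) has_vector_derivative
      A (y t - sol v t) + (g (y t) - g (sol v t))) (at t)" for t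
    by (rule has_vector_derivative_eq_rhs[OF has_vector_derivative_diff[OF y sol(3)[OF v]]])
      (simp add: A_diff)
  show "norm (y t - sol v t) \<le> (B + 2 * C * norm v) * exp (\<eta> * \<bar>t\<bar>)" for t
    using norm_triangle_ineq4[of "y t" "sol v t"] yb[of t] sol(4)[OF v, of t] by (simp add: distrib_right)
  show "y 0 - sol v 0 - (w - v) \<in> Eh"
    using subspace_diff[OF Eh y0 sol(1)[OF v]] by (simp add: algebra_simps)
qed

lemma sol_diff:
  assumes "v \<in> Ec" "v' \<in> Ec"
  shows "norm (sol v' t - sol v t) \<le> 2 * C * norm (v' - v) * exp (\<eta> * \<bar>t\<bar>)"
  using sol_estimate[OF assms sol(3)[OF assms(2)] sol(4)[OF assms(2)] sol(1)[OF assms(2)]] by simp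

lemma sol_unique:
  assumes v: "v \<in> Ec"
    and y: "\<And>t. (y has_vector_derivative A (y t) + g (y t)) (at t)"
    and yb: "\<And>t. norm (y t) \<le> B * exp (\<eta> * \<bar>t\<bar>)" and y0: "y 0 - v \<in> Eh"
  shows "y t = sol v t"
  using sol_estimate[OF v v y yb y0, of t] by simp

text \<open>A time shift multiplies the weighted norm by at most
  \<open>exp (\<eta> * \<bar>r\<bar>)\<close>, so the shifted solution is still slow and equals the
  one selected by its own center component. This is the invariance of the graph.\<close>

lemma sol_translate:
  assumes v: "v \<in> Ec"
  shows "\<exists>c\<in>Ec. sol v r = sol c 0"
proof -
  obtain c h where ch: "c \<in> Ec" "h \<in> Eh" "sol v r = c + h" using split[OF sol(2)[OF v]] by blast
  have "sol v (0 + r) = sol c 0"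
  proof (rule sol_unique[OF ch(1), of "\<lambda>t. sol v (t + r)" "2 * C * norm v * exp (\<eta> * \<bar>r\<bar>)"])
    fix t
    have "((sol v \<circ> (\<lambda>t. t + r)) has_vector_derivative
        1 *\<^sub>R (A (sol v (t + r)) + g (sol v (t + r)))) (at t)"
      by (rule vector_diff_chain_at[OF _ sol(3)[OF v]]) (auto intro!: derivative_eq_intros)
    then show "((\<lambda>t. sol v (t + r)) has_vector_derivative A (sol v (t + r)) + g (sol v (t + r))) (at t)"
      by (simp add: o_def)
    have "norm (sol v (t + r)) \<le> 2 * C * norm v * exp (\<eta> * \<bar>t + r\<bar>)" by (rule sol(4)[OF v])
    also have "\<dots> \<le> 2 * C * norm v * (exp (\<eta> * \<bar>r\<bar>) * exp (\<eta> * \<bar>t\<bar>))"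
      using weighted_exp_le[of \<eta> "t + r" r] \<eta>0 C0 by (intro mult_left_mono) auto
    finally show "norm (sol v (t + r)) \<le> 2 * C * norm v * exp (\<eta> * \<bar>r\<bar>) * exp (\<eta> * \<bar>t\<bar>)"
      by (simp add: mult.assoc)
    show "sol v (0 + r) - c \<in> Eh" using ch by simp
  qed
  then show ?thesis using ch by auto
qed

section \<open>The variational equation along \<open>sol v\<close>, and differentiability in the
  center component\<close>

definition var :: "'a \<Rightarrow> 'a \<Rightarrow> real \<Rightarrow> 'a" where
  "var v w = (SOME y. y 0 - w \<in> Eh \<and>
     (\<forall>t. y t \<in> X \<and> (y has_vector_derivative A (y t) + blinfun_apply (g' (sol v t)) (y t)) (at t)
     \<and> norm (y t) \<le> 2 * C * norm w * exp (\<eta> * \<bar>t\<bar>)))"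

lemma var:
  assumes v: "v \<in> Ec" and w: "w \<in> Ec"
  shows "var v w 0 - w \<in> Eh" "var v w t \<in> X"
    "(var v w has_vector_derivative A (var v w t) + blinfun_apply (g' (sol v t)) (var v w t)) (at t)"
    "norm (var v w t) \<le> 2 * C * norm w * exp (\<eta> * \<bar>t\<bar>)"
proof -
  have "\<exists>y. y 0 - w \<in> Eh \<and>
     (\<forall>t. y t \<in> X \<and> (y has_vector_derivative A (y t) + blinfun_apply (g' (sol v t)) (y t)) (at t)
     \<and> norm (y t) \<le> 2 * C * norm w * exp (\<eta> * \<bar>t\<bar>))"
    by (rule ex_perturbed_solution[OF ad L0 CL(1) w, of "\<lambda>t. blinfun_apply (g' (sol v t))"])
      (auto simp: g'_X g'_apply_bound blinfun.diff_right[symmetric] intro!: g'_continuous sol_continuous v)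
  from someI_ex[OF this] show "var v w 0 - w \<in> Eh" "var v w t \<in> X"
    "(var v w has_vector_derivative A (var v w t) + blinfun_apply (g' (sol v t)) (var v w t)) (at t)"
    "norm (var v w t) \<le> 2 * C * norm w * exp (\<eta> * \<bar>t\<bar>)"
    unfolding var_def[symmetric] by blast+
qed

lemma var_continuous: "v \<in> Ec \<Longrightarrow> w \<in> Ec \<Longrightarrow> continuous_on UNIV (var v w)"
  using var(3) by (meson continuous_at_imp_continuous_on has_vector_derivative_continuous)

lemma var_unique:
  assumes v: "v \<in> Ec" and w: "w \<in> Ec"
    and y: "\<And>t. (y has_vector_derivative A (y t) + blinfun_apply (g' (sol v t)) (y t)) (at t)"
    and yb: "\<And>t. norm (y t) \<le> B * exp (\<eta> * \<bar>t\<bar>)" and y0: "y 0 - w \<in> Eh"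
  shows "y t = var v w t"
proof -
  have yc: "continuous_on UNIV y"
    using y by (meson continuous_at_imp_continuous_on has_vector_derivative_continuous)
  have "norm (y t - var v w t) \<le> 2 * C * (norm (0::'a) + 0) * exp (\<eta> * \<bar>t\<bar>)"
  proof (rule perturbed_estimate[OF ad L0 CL(1) order_refl subspace_0[OF Ec], where z = "\<lambda>t. y t - var v w t"
        and p = "\<lambda>t. blinfun_apply (g' (sol v t)) (y t - var v w t)" and B = "B + 2 * C * norm w"])
    show "continuous_on UNIV (\<lambda>t. blinfun_apply (g' (sol v t)) (y t - var v w t))"
      by (intro g'_continuous continuous_intros sol_continuous var_continuous v w yc)
    show "((\<lambda>t. y t - var v w t) has_vector_derivative
        A (y t - var v w t) + blinfun_apply (g' (sol v t)) (y t - var v w t)) (at t)" for t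
      by (rule has_vector_derivative_eq_rhs[OF has_vector_derivative_diff[OF y var(3)[OF v w]]])
        (simp add: A_diff blinfun.diff_right)
    show "norm (y t - var v w t) \<le> (B + 2 * C * norm w) * exp (\<eta> * \<bar>t\<bar>)" for t
      using norm_triangle_ineq4[of "y t" "var v w t"] yb[of t] var(4)[OF v w, of t]
      by (simp add: distrib_right)
    show "y 0 - var v w 0 - 0 \<in> Eh"
      using subspace_diff[OF Eh y0 var(1)[OF v w]] by simp
  qed (use g'_X g'_apply_bound in auto)
  then show ?thesis by simp
qed

lemma var_lincomb:
  assumes v: "v \<in> Ec" and w: "w \<in> Ec" "w' \<in> Ec"
  shows "r *\<^sub>R var v w t + var v w' t = var v (r *\<^sub>R w + w') t"
proof (rule var_unique[OF v, of _ "\<lambda>t. r *\<^sub>R var v w t + var v w' t" "\<bar>r\<bar> * (2 * C * norm w) + 2 * C * norm w'"])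
  show "r *\<^sub>R w + w' \<in> Ec" by (intro subspace_add[OF Ec] subspace_mul[OF Ec] w)
  fix t
  have "((\<lambda>t. r *\<^sub>R var v w t + var v w' t) has_vector_derivative
     r *\<^sub>R (A (var v w t) + blinfun_apply (g' (sol v t)) (var v w t))
      + (A (var v w' t) + blinfun_apply (g' (sol v t)) (var v w' t))) (at t)"
    by (intro has_vector_derivative_add var v w
        bounded_linear.has_vector_derivative[OF bounded_linear_scaleR_right])
  then show "((\<lambda>t. r *\<^sub>R var v w t + var v w' t) has_vector_derivative
     A (r *\<^sub>R var v w t + var v w' t) + blinfun_apply (g' (sol v t)) (r *\<^sub>R var v w t + var v w' t)) (at t)"
    by (rule has_vector_derivative_eq_rhs)
      (simp add: blinfun.add_right blinfun.scaleR_right algebra_simps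
        linear_add[OF bounded_linear.linear[OF A]] linear_cmul[OF bounded_linear.linear[OF A]])
  have "norm (r *\<^sub>R var v w t + var v w' t) \<le> \<bar>r\<bar> * norm (var v w t) + norm (var v w' t)"
    using norm_triangle_ineq[of "r *\<^sub>R var v w t" "var v w' t"] by simp
  also have "\<dots> \<le> \<bar>r\<bar> * (2 * C * norm w * exp (\<eta> * \<bar>t\<bar>)) + 2 * C * norm w' * exp (\<eta> * \<bar>t\<bar>)"
    by (intro add_mono mult_left_mono var v w) simp
  finally show "norm (r *\<^sub>R var v w t + var v w' t)
      \<le> (\<bar>r\<bar> * (2 * C * norm w) + 2 * C * norm w') * exp (\<eta> * \<bar>t\<bar>)"
    by (simp add: algebra_simps)
  have "r *\<^sub>R (var v w 0 - w) + (var v w' 0 - w') \<in> Eh"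
    by (intro subspace_add[OF Eh] subspace_mul[OF Eh] var v w)
  then show "r *\<^sub>R var v w 0 + var v w' 0 - (r *\<^sub>R w + w') \<in> Eh" by (simp add: algebra_simps)
qed

lemma sol_0: "sol 0 t = 0"
  using sol(4)[OF subspace_0[OF Ec], of t] by simp

text \<open>As \<open>sol 0\<close> and \<open>g' 0\<close> vanish, the variational equation at 0 is
  the linear one, whose slow solution with center component \<open>w\<close> starts at
  \<open>w\<close> itself. This makes the graph tangent to the center space.\<close>

lemma var_0:
  assumes w: "w \<in> Ec"
  shows "var 0 w 0 = w"
proof -
  obtain D x where x: "x 0 = w" "\<And>t. (x has_vector_derivative A (x t)) (at t)"
     "\<And>t. norm (x t) \<le> D * norm w * exp (\<eta> * \<bar>t\<bar>)"
    using center_solution[OF \<eta>0] w by blast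
  have "x 0 = var 0 w 0"
    by (rule var_unique[OF subspace_0[OF Ec] w _ x(3)])
      (auto simp: x sol_0 g'_0 subspace_0[OF Eh])
  then show ?thesis using x by simp
qed

text \<open>The loss from \<open>\<eta>\<close> to \<open>\<eta>'\<close> makes up for the missing uniform continuity of \<open>g'\<close> along \<open>x\<close>:
  for large times the exponential weight beats the bound \<open>2 * L\<close>, and for bounded times
  a compactness argument applies.\<close>

lemma g'_modulus:
  assumes x: "continuous_on UNIV x" and \<epsilon>: "\<epsilon> > 0"
  shows "\<exists>d>0. \<forall>t s. norm s \<le> d * exp (\<eta> * \<bar>t\<bar>) \<longrightarrow>
     norm (g' (x t + s) - g' (x t)) \<le> \<epsilon> * exp ((\<eta>' - \<eta>) * \<bar>t\<bar>)"
proof -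
  define a where "a = \<eta>' - \<eta>"
  have a: "a > 0" using \<eta> by (simp add: a_def)
  \<comment> \<open>Chosen so that \<open>\<epsilon> * (a * T) = 2 * L\<close>. Since the
    exponential exceeds its argument, the weight dominates the trivial bound \<open>2 * L\<close>
    from time \<open>T\<close> on.\<close>
  define T where "T = 2 * L / (\<epsilon> * a)"
  have T0: "T \<ge> 0" using L0 \<epsilon> a by (simp add: T_def)
  have large: "2 * L \<le> \<epsilon> * exp (a * \<bar>t\<bar>)" if "\<bar>t\<bar> \<ge> T" for t
  proof -
    have "a * T \<le> a * \<bar>t\<bar>" using that a by simp
    then have aT: "a * T \<le> exp (a * \<bar>t\<bar>)"
      using exp_ge_add_one_self[of "a * \<bar>t\<bar>"] by linarith
    have "2 * L = \<epsilon> * (a * T)" using \<epsilon> a by (simp add: T_def)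
    also have "\<dots> \<le> \<epsilon> * exp (a * \<bar>t\<bar>)"
      using aT \<epsilon> by (intro mult_left_mono) auto
    finally show ?thesis .
  qed
  have "compact (x ` {-T..T})"
    by (intro compact_continuous_image continuous_on_subset[OF x]) auto
  then obtain R where R: "\<And>t. t \<in> {-T..T} \<Longrightarrow> norm (x t) \<le> R"
    using compact_imp_bounded bounded_iff by (metis imageI)
  have "uniformly_continuous_on (cball 0 (R + 1)) g'"
    by (intro compact_uniformly_continuous continuous_on_subset[OF g']) auto
  then obtain d0 where d0: "d0 > 0" and uc: "\<And>y z. y \<in> cball 0 (R + 1) \<Longrightarrow> z \<in> cball 0 (R + 1) \<Longrightarrow>
      dist z y < d0 \<Longrightarrow> dist (g' z) (g' y) < \<epsilon>"
    using \<epsilon> unfolding uniformly_continuous_on_def by metis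
  \<comment> \<open>The exponential cancels the weight allowed on \<open>s\<close> for times in
    [-T, T]. The bound 1 keeps \<open>x t + s\<close> in the ball of radius \<open>R + 1\<close>,
    and \<open>d0 / 2\<close> keeps it within the modulus of uniform continuity.\<close>
  define d where "d = min 1 (d0 / 2) * exp (- (\<eta> * T))"
  have "d > 0" using d0 by (simp add: d_def)
  moreover have "norm (g' (x t + s) - g' (x t)) \<le> \<epsilon> * exp (a * \<bar>t\<bar>)"
    if s: "norm s \<le> d * exp (\<eta> * \<bar>t\<bar>)" for t s
  proof (cases "\<bar>t\<bar> \<ge> T")
    case True
    have "norm (g' (x t + s) - g' (x t)) \<le> 2 * L"
      using norm_triangle_ineq4[of "g' (x t + s)" "g' (x t)"] g'_bound[of "x t + s"] g'_bound[of "x t"]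
      by linarith
    then show ?thesis using large[OF True] by linarith
  next
    case False
    then have t: "t \<in> {-T..T}" by auto
    have "d * exp (\<eta> * \<bar>t\<bar>) \<le> d * exp (\<eta> * T)"
      using False \<eta>0 \<open>d > 0\<close> by (intro mult_left_mono) auto
    also have "\<dots> = min 1 (d0 / 2)" by (simp add: d_def exp_minus)
    finally have s': "norm s \<le> min 1 (d0 / 2)" using s by linarith
    then have "x t + s \<in> cball 0 (R + 1)" "x t \<in> cball 0 (R + 1)" "dist (x t + s) (x t) < d0"
      using R[OF t] d0 norm_triangle_ineq[of "x t" s] unfolding mem_cball_0 dist_norm by auto
    then have "dist (g' (x t + s)) (g' (x t)) < \<epsilon>" by (intro uc)
    moreover have "\<epsilon> * 1 \<le> \<epsilon> * exp (a * \<bar>t\<bar>)" using \<epsilon> a by (intro mult_left_mono) auto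
    ultimately show ?thesis by (simp add: dist_norm)
  qed
  ultimately show ?thesis unfolding a_def by blast
qed

lemma weight_mono: "0 \<le> B \<Longrightarrow> norm y \<le> B * exp (\<eta> * \<bar>t\<bar>) \<Longrightarrow> norm y \<le> B * exp (\<eta>' * \<bar>t\<bar>)"
  for t :: real and y :: 'a
  using \<eta> by (elim order_trans) (auto intro!: mult_left_mono mult_right_mono)

lemma weight_add: "exp ((\<eta>' - \<eta>) * \<bar>t\<bar>) * exp (\<eta> * \<bar>t\<bar>) = exp (\<eta>' * \<bar>t\<bar>)" for t :: real
  by (simp add: exp_add[symmetric] algebra_simps)

text \<open>The remainder \<open>R\<close> of the first order expansion solves the variational
  equation with forcing \<open>q\<close>, the linearization error of \<open>g\<close>. That error is
  small only in the weight of rate \<open>\<eta>'\<close>, so absorption is applied at that rate,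
  with center component 0 because the center components of \<open>sol v'\<close>,
  \<open>sol v\<close> and \<open>var v (v' - v)\<close> cancel.\<close>

lemma sol_deriv:
  assumes v: "v \<in> Ec" and \<epsilon>: "\<epsilon> > 0"
  shows "\<exists>d>0. \<forall>v'\<in>Ec. norm (v' - v) < d \<longrightarrow>
     norm (sol v' 0 - sol v 0 - var v (v' - v) 0) \<le> \<epsilon> * norm (v' - v)"
proof -
  \<comment> \<open>The final estimate carries the factor \<open>4 * C * C'\<close>:
    \<open>2 * C\<close> from the size of \<open>\<Delta>\<close> and \<open>2 * C'\<close> from
    absorption. Adding 1 keeps the denominator positive when a constant is 0.\<close>
  define \<epsilon>1 where "\<epsilon>1 = \<epsilon> / (4 * C * C' + 1)"
  have CC: "4 * C * C' + 1 > 0" using C0 by (simp add: add_nonneg_pos)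
  then have \<epsilon>1: "\<epsilon>1 > 0" using \<epsilon> by (simp add: \<epsilon>1_def)
  obtain d1 where d1: "d1 > 0" and mod: "\<And>t s. norm s \<le> d1 * exp (\<eta> * \<bar>t\<bar>) \<Longrightarrow>
     norm (g' (sol v t + s) - g' (sol v t)) \<le> \<epsilon>1 * exp ((\<eta>' - \<eta>) * \<bar>t\<bar>)"
    using g'_modulus[OF sol_continuous[OF v] \<epsilon>1] by blast
  define d where "d = d1 / (2 * C + 1)"
  have C1: "2 * C + 1 > 0" using C0 by (simp add: add_nonneg_pos)
  have d: "d > 0" using d1 C1 by (simp add: d_def)
  have main: "norm (sol v' 0 - sol v 0 - var v (v' - v) 0) \<le> \<epsilon> * norm (v' - v)"
    if v': "v' \<in> Ec" and vd: "norm (v' - v) < d" for v'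
  proof -
    define w where "w = v' - v"
    have w: "w \<in> Ec" unfolding w_def by (rule subspace_diff[OF Ec v' v])
    define \<Delta> where "\<Delta> t = sol v' t - sol v t" for t
    define R where "R t = \<Delta> t - var v w t" for t
    define q where "q t = g (sol v' t) - g (sol v t) - blinfun_apply (g' (sol v t)) (\<Delta> t)" for t
    have \<Delta>b: "norm (\<Delta> t) \<le> 2 * C * norm w * exp (\<eta> * \<bar>t\<bar>)" for t
      unfolding \<Delta>_def w_def by (rule sol_diff[OF v v'])
    have \<Delta>d: "norm (\<Delta> t) \<le> d1 * exp (\<eta> * \<bar>t\<bar>)" for t
    proof -
      have "2 * C * norm w \<le> (2 * C + 1) * d" using vd C0 by (intro mult_mono) (auto simp: w_def)
      also have "\<dots> = d1" using C1 by (simp add: d_def)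
      finally show ?thesis
        using \<Delta>b[of t] by (meson exp_ge_zero mult_right_mono order_trans)
    qed
    have qb: "norm (q t) \<le> \<epsilon>1 * (2 * C * norm w) * exp (\<eta>' * \<bar>t\<bar>)" for t
    proof -
      have "norm (g (sol v' t) - g (sol v t) - blinfun_apply (g' (sol v t)) (sol v' t - sol v t))
         \<le> norm (sol v' t - sol v t) * (\<epsilon>1 * exp ((\<eta>' - \<eta>) * \<bar>t\<bar>))"
      \<comment> \<open>The set is the segment between the two solution values at time
        \<open>t\<close>; its points differ from \<open>sol v t\<close> by at most
        \<open>norm (\<Delta> t)\<close>, so the modulus of \<open>g'\<close> applies on all of
        it.\<close>
      proof (rule differentiable_bound_linearization[where f' = "\<lambda>x. blinfun_apply (g' x)"
            and S = "(\<lambda>r. sol v t + r *\<^sub>R \<Delta> t) ` {0..1}"])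
        show "sol v t + r *\<^sub>R (sol v' t - sol v t) \<in> (\<lambda>r. sol v t + r *\<^sub>R \<Delta> t) ` {0..1}"
          if "r \<in> {0..1}" for r using that by (auto simp: \<Delta>_def)
        show "sol v t \<in> (\<lambda>r. sol v t + r *\<^sub>R \<Delta> t) ` {0..1}" by (rule image_eqI[of _ _ 0]) auto
        show "(g has_derivative blinfun_apply (g' x)) (at x within S)" for x S
          by (rule has_derivative_at_withinI[OF g])
        show "onorm (blinfun_apply (g' x) - blinfun_apply (g' (sol v t))) \<le> \<epsilon>1 * exp ((\<eta>' - \<eta>) * \<bar>t\<bar>)"
          if x: "x \<in> (\<lambda>r. sol v t + r *\<^sub>R \<Delta> t) ` {0..1}" for x
        proof -
          obtain r where r: "r \<in> {0..1}" "x = sol v t + r *\<^sub>R \<Delta> t" using x by blast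
          have "\<bar>r\<bar> * norm (\<Delta> t) \<le> 1 * norm (\<Delta> t)" using r by (intro mult_right_mono) auto
          then have "norm (r *\<^sub>R \<Delta> t) \<le> d1 * exp (\<eta> * \<bar>t\<bar>)" using \<Delta>d[of t] by simp
          from mod[OF this] have "norm (g' x - g' (sol v t)) \<le> \<epsilon>1 * exp ((\<eta>' - \<eta>) * \<bar>t\<bar>)"
            by (simp add: r)
          moreover have "blinfun_apply (g' x) - blinfun_apply (g' (sol v t)) = blinfun_apply (g' x - g' (sol v t))"
            by (auto simp: blinfun.diff_left)
          ultimately show ?thesis by (simp add: norm_blinfun.rep_eq)
        qed
      qed
      then have "norm (q t) \<le> norm (\<Delta> t) * (\<epsilon>1 * exp ((\<eta>' - \<eta>) * \<bar>t\<bar>))"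
        by (simp add: q_def \<Delta>_def)
      also have "\<dots> \<le> 2 * C * norm w * exp (\<eta> * \<bar>t\<bar>) * (\<epsilon>1 * exp ((\<eta>' - \<eta>) * \<bar>t\<bar>))"
        using \<epsilon>1 by (intro mult_right_mono \<Delta>b) auto
      also have "\<dots> = \<epsilon>1 * (2 * C * norm w) * exp (\<eta>' * \<bar>t\<bar>)"
        unfolding weight_add[symmetric] by simp
      finally show ?thesis .
    qed
    have "norm (R 0) \<le> 2 * C' * (norm (0::'a) + \<epsilon>1 * (2 * C * norm w)) * exp (\<eta>' * \<bar>0\<bar>)"
    proof (rule perturbed_estimate[OF ad' L0 CL(2) _ subspace_0[OF Ec],
          where p = "\<lambda>t. blinfun_apply (g' (sol v t)) (R t) + q t"
          and B = "2 * C * norm w + 2 * C * norm w"])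
      show "0 \<le> \<epsilon>1 * (2 * C * norm w)" using \<epsilon>1 C0 by simp
      show "continuous_on UNIV (\<lambda>t. blinfun_apply (g' (sol v t)) (R t) + q t)"
        unfolding q_def R_def \<Delta>_def
        by (intro continuous_intros g'_continuous g_continuous sol_continuous var_continuous v v' w)
      show "blinfun_apply (g' (sol v t)) (R t) + q t \<in> X" for t
        unfolding q_def by (intro subspace_add[OF X] subspace_diff[OF X] g'_X g_X)
      show "norm (blinfun_apply (g' (sol v t)) (R t) + q t)
          \<le> L * norm (R t) + \<epsilon>1 * (2 * C * norm w) * exp (\<eta>' * \<bar>t\<bar>)" for t
        by (intro norm_triangle_le add_mono g'_apply_bound qb)
      show "(R has_vector_derivative A (R t) + (blinfun_apply (g' (sol v t)) (R t) + q t)) (at t)" for t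
        unfolding R_def[abs_def] \<Delta>_def
        by (rule has_vector_derivative_eq_rhs[OF has_vector_derivative_diff[OF
                has_vector_derivative_diff[OF sol(3)[OF v'] sol(3)[OF v]] var(3)[OF v w]]])
          (simp add: A_diff q_def \<Delta>_def blinfun.diff_right)
      show "norm (R t) \<le> (2 * C * norm w + 2 * C * norm w) * exp (\<eta>' * \<bar>t\<bar>)" for t
      proof (rule weight_mono)
        show "norm (R t) \<le> (2 * C * norm w + 2 * C * norm w) * exp (\<eta> * \<bar>t\<bar>)"
          using norm_triangle_ineq4[of "\<Delta> t" "var v w t"] \<Delta>b[of t] var(4)[OF v w, of t]
          by (simp add: R_def distrib_right)
      qed (use C0 in auto)
      have "sol v' 0 - v' - (sol v 0 - v) - (var v w 0 - w) \<in> Eh"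
        by (intro subspace_diff[OF Eh] sol var v v' w)
      then show "R 0 - 0 \<in> Eh" by (simp add: R_def \<Delta>_def w_def algebra_simps)
    qed
    also have "\<dots> = \<epsilon>1 * (4 * C * C') * norm w" by simp
    also have "\<dots> \<le> \<epsilon>1 * (4 * C * C' + 1) * norm w"
      using \<epsilon>1 by (intro mult_left_mono mult_right_mono) auto
    also have "\<dots> = \<epsilon> * norm w" using CC by (simp add: \<epsilon>1_def)
    finally show ?thesis by (simp add: R_def \<Delta>_def w_def)
  qed
  then show ?thesis using d by blast
qed

text \<open>The difference of the two variational solutions solves the equation along
  \<open>sol v'\<close> with a forcing caused by the change of \<open>g'\<close>, which is again
  small only at rate \<open>\<eta>'\<close>. Linearity of the bound in \<open>norm w\<close> is what
  gives continuity in the operator norm.\<close>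

lemma var_cont:
  assumes v: "v \<in> Ec" and \<epsilon>: "\<epsilon> > 0"
  shows "\<exists>d>0. \<forall>v'\<in>Ec. norm (v' - v) < d \<longrightarrow>
     (\<forall>w\<in>Ec. norm (var v' w 0 - var v w 0) \<le> \<epsilon> * norm w)"
proof -
  define \<epsilon>1 where "\<epsilon>1 = \<epsilon> / (4 * C * C' + 1)"
  have CC: "4 * C * C' + 1 > 0" using C0 by (simp add: add_nonneg_pos)
  then have \<epsilon>1: "\<epsilon>1 > 0" using \<epsilon> by (simp add: \<epsilon>1_def)
  obtain d1 where d1: "d1 > 0" and mod: "\<And>t s. norm s \<le> d1 * exp (\<eta> * \<bar>t\<bar>) \<Longrightarrow>
     norm (g' (sol v t + s) - g' (sol v t)) \<le> \<epsilon>1 * exp ((\<eta>' - \<eta>) * \<bar>t\<bar>)"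
    using g'_modulus[OF sol_continuous[OF v] \<epsilon>1] by blast
  define d where "d = d1 / (2 * C + 1)"
  have C1: "2 * C + 1 > 0" using C0 by (simp add: add_nonneg_pos)
  have d: "d > 0" using d1 C1 by (simp add: d_def)
  have main: "norm (var v' w 0 - var v w 0) \<le> \<epsilon> * norm w"
    if v': "v' \<in> Ec" and vd: "norm (v' - v) < d" and w: "w \<in> Ec" for v' w
  proof -
    define R where "R t = var v' w t - var v w t" for t
    define q where "q t = blinfun_apply (g' (sol v' t) - g' (sol v t)) (var v w t)" for t
    have gb: "norm (g' (sol v' t) - g' (sol v t)) \<le> \<epsilon>1 * exp ((\<eta>' - \<eta>) * \<bar>t\<bar>)" for t
    proof -
      have "2 * C * norm (v' - v) \<le> (2 * C + 1) * d" using vd C0 by (intro mult_mono) auto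
      also have "\<dots> = d1" using C1 by (simp add: d_def)
      finally have "norm (sol v' t - sol v t) \<le> d1 * exp (\<eta> * \<bar>t\<bar>)"
        using sol_diff[OF v v', of t] by (meson exp_ge_zero mult_right_mono order_trans)
      from mod[OF this] show ?thesis by simp
    qed
    have qb: "norm (q t) \<le> \<epsilon>1 * (2 * C * norm w) * exp (\<eta>' * \<bar>t\<bar>)" for t
    proof -
      have "norm (q t) \<le> norm (g' (sol v' t) - g' (sol v t)) * norm (var v w t)"
        unfolding q_def by (rule norm_blinfun)
      also have "\<dots> \<le> (\<epsilon>1 * exp ((\<eta>' - \<eta>) * \<bar>t\<bar>)) * (2 * C * norm w * exp (\<eta> * \<bar>t\<bar>))"
        using \<epsilon>1 by (intro mult_mono gb var v w) auto
      also have "\<dots> = \<epsilon>1 * (2 * C * norm w) * exp (\<eta>' * \<bar>t\<bar>)"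
        unfolding weight_add[symmetric] by simp
      finally show ?thesis .
    qed
    have "norm (R 0) \<le> 2 * C' * (norm (0::'a) + \<epsilon>1 * (2 * C * norm w)) * exp (\<eta>' * \<bar>0\<bar>)"
    proof (rule perturbed_estimate[OF ad' L0 CL(2) _ subspace_0[OF Ec],
          where p = "\<lambda>t. blinfun_apply (g' (sol v' t)) (R t) + q t"
          and B = "2 * C * norm w + 2 * C * norm w"])
      show "0 \<le> \<epsilon>1 * (2 * C * norm w)" using \<epsilon>1 C0 by simp
      show "continuous_on UNIV (\<lambda>t. blinfun_apply (g' (sol v' t)) (R t) + q t)"
        unfolding q_def R_def blinfun.diff_left
        by (intro continuous_intros g'_continuous sol_continuous var_continuous v v' w)
      show "blinfun_apply (g' (sol v' t)) (R t) + q t \<in> X" for t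
        unfolding q_def blinfun.diff_left by (intro subspace_add[OF X] subspace_diff[OF X] g'_X)
      show "norm (blinfun_apply (g' (sol v' t)) (R t) + q t)
          \<le> L * norm (R t) + \<epsilon>1 * (2 * C * norm w) * exp (\<eta>' * \<bar>t\<bar>)" for t
        by (intro norm_triangle_le add_mono g'_apply_bound qb)
      show "(R has_vector_derivative A (R t) + (blinfun_apply (g' (sol v' t)) (R t) + q t)) (at t)" for t
        unfolding R_def[abs_def]
        by (rule has_vector_derivative_eq_rhs[OF
              has_vector_derivative_diff[OF var(3)[OF v' w] var(3)[OF v w]]])
          (simp add: A_diff q_def blinfun.diff_right blinfun.diff_left)
      show "norm (R t) \<le> (2 * C * norm w + 2 * C * norm w) * exp (\<eta>' * \<bar>t\<bar>)" for t
      proof (rule weight_mono)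
        show "norm (R t) \<le> (2 * C * norm w + 2 * C * norm w) * exp (\<eta> * \<bar>t\<bar>)"
          using norm_triangle_ineq4[of "var v' w t" "var v w t"] var(4)[OF v w, of t] var(4)[OF v' w, of t]
          by (simp add: R_def distrib_right)
      qed (use C0 in auto)
      have "var v' w 0 - w - (var v w 0 - w) \<in> Eh"
        by (intro subspace_diff[OF Eh] var v v' w)
      then show "R 0 - 0 \<in> Eh" by (simp add: R_def)
    qed
    also have "\<dots> = \<epsilon>1 * (4 * C * C') * norm w" by simp
    also have "\<dots> \<le> \<epsilon>1 * (4 * C * C' + 1) * norm w"
      using \<epsilon>1 by (intro mult_left_mono mult_right_mono) auto
    also have "\<dots> = \<epsilon> * norm w" using CC by (simp add: \<epsilon>1_def)
    finally show ?thesis by (simp add: R_def)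
  qed
  then show ?thesis using d by blast
qed

section \<open>The graph function and its derivative\<close>

definition h :: "'a \<Rightarrow> 'a" where "h v = sol v 0 - v"

lemma h_Eh: "v \<in> Ec \<Longrightarrow> h v \<in> Eh"
  by (simp add: h_def sol)

lemma h_0: "h 0 = 0"
  by (simp add: h_def sol_0)

text \<open>The variational solutions give a derivative along \<open>Ec\<close> only. Precomposition
  with the orthogonal projection \<open>\<pi>\<close> onto \<open>Ec\<close> extends it to a linear
  map on the whole space without changing its values on \<open>Ec\<close>.\<close>

lemma h_C1:
  obtains h' :: "'a \<Rightarrow> 'a \<Rightarrow>\<^sub>L 'a"
  where "\<And>v. v \<in> Ec \<Longrightarrow> (h has_derivative blinfun_apply (h' v)) (at v within Ec)"
    "continuous_on Ec h'" "h' 0 = 0"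
proof -
  obtain B where B: "B \<subseteq> Ec" "pairwise orthogonal B" "\<And>x. x \<in> B \<Longrightarrow> norm x = 1"
    "independent B" "span B = Ec"
    using orthonormal_basis_subspace[OF Ec] by metis
  have fin: "finite B" using B(4) by (rule independent_imp_finite)
  define \<pi> where "\<pi> x = (\<Sum>b\<in>B. (x \<bullet> b) *\<^sub>R b)" for x
  have \<pi>: "bounded_linear \<pi>" unfolding \<pi>_def[abs_def]
    by (intro bounded_linear_sum bounded_linear_scaleR_const bounded_linear_inner_left)
  have \<pi>E: "\<pi> x \<in> Ec" for x
    unfolding \<pi>_def using B(1) by (intro subspace_sum[OF Ec] subspace_mul[OF Ec]) auto
  have \<pi>id: "\<pi> x = x" if "x \<in> Ec" for x
    unfolding \<pi>_def using orthonormal_basis_expand[OF B(2,3) _ fin, of x] that B(5) by simp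
  obtain M where M: "M > 0" "\<And>x. norm (\<pi> x) \<le> norm x * M"
    using bounded_linear.pos_bounded[OF \<pi>] by blast
  define H where "H v w = var v (\<pi> w) 0 - \<pi> w" for v w
  have H: "bounded_linear (H v)" if v: "v \<in> Ec" for v
    unfolding linear_conv_bounded_linear[symmetric]
  proof (rule linearI)
    have lc: "H v (r *\<^sub>R x + y) = r *\<^sub>R H v x + H v y" for r x y
      using var_lincomb[OF v \<pi>E \<pi>E, of r x 0 y]
      by (simp add: H_def linear_add[OF bounded_linear.linear[OF \<pi>]]
          linear_cmul[OF bounded_linear.linear[OF \<pi>]] algebra_simps)
    show "H v (x + y) = H v x + H v y" for x y using lc[of 1 x y] by simp
    then have "H v 0 = 0" by (metis add.right_neutral add_left_cancel)
    then show "H v (r *\<^sub>R x) = r *\<^sub>R H v x" for r x using lc[of r x 0] by simp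
  qed
  show ?thesis
  proof (rule that[of "\<lambda>v. Blinfun (H v)"])
    fix v assume v: "v \<in> Ec"
    show "(h has_derivative blinfun_apply (Blinfun (H v))) (at v within Ec)"
      unfolding bounded_linear_Blinfun_apply[OF H[OF v]] has_derivative_within_alt
    proof (intro conjI allI impI H[OF v])
      fix e :: real assume "e > 0"
      from sol_deriv[OF v this] obtain d where "d > 0" and
        d: "\<And>v'. v' \<in> Ec \<Longrightarrow> norm (v' - v) < d \<Longrightarrow>
          norm (sol v' 0 - sol v 0 - var v (v' - v) 0) \<le> e * norm (v' - v)" by blast
      have "norm (h v' - h v - H v (v' - v)) \<le> e * norm (v' - v)"
        if "v' \<in> Ec" "norm (v' - v) < d" for v'
      proof -
        have "H v (v' - v) = var v (v' - v) 0 - (v' - v)"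
          by (simp only: H_def \<pi>id[OF subspace_diff[OF Ec that(1) v]])
        then show ?thesis using d[OF that] by (simp add: h_def)
      qed
      with \<open>d > 0\<close> show "\<exists>d>0. \<forall>y\<in>Ec. norm (y - v) < d \<longrightarrow>
          norm (h y - h v - H v (y - v)) \<le> e * norm (y - v)" by blast
    qed
  next
    show "continuous_on Ec (\<lambda>v. Blinfun (H v))"
      unfolding continuous_on_iff
    proof (intro ballI allI impI)
      fix v and e :: real assume v: "v \<in> Ec" and e: "e > 0"
      have "e / (2 * M) > 0" using e M by simp
      from var_cont[OF v this] obtain d where "d > 0" and
        d: "\<And>v' w. v' \<in> Ec \<Longrightarrow> norm (v' - v) < d \<Longrightarrow> w \<in> Ec \<Longrightarrow>
          norm (var v' w 0 - var v w 0) \<le> e / (2 * M) * norm w" by blast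
      have "dist (Blinfun (H v')) (Blinfun (H v)) < e" if "v' \<in> Ec" "dist v' v < d" for v'
      proof -
        have "norm (Blinfun (H v') - Blinfun (H v)) \<le> e / 2"
        proof (rule norm_blinfun_bound)
          fix w
          have "norm (blinfun_apply (Blinfun (H v') - Blinfun (H v)) w)
              = norm (var v' (\<pi> w) 0 - var v (\<pi> w) 0)"
            by (simp add: blinfun.diff_left bounded_linear_Blinfun_apply H v that H_def)
          also have "\<dots> \<le> e / (2 * M) * norm (\<pi> w)"
            using that by (intro d \<pi>E) (auto simp: dist_norm)
          also have "\<dots> \<le> e / (2 * M) * (norm w * M)"
            using e M by (intro mult_left_mono) auto
          also have "\<dots> = e / 2 * norm w" using M by simp
          finally show "norm (blinfun_apply (Blinfun (H v') - Blinfun (H v)) w) \<le> e / 2 * norm w" .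
        qed (use e in auto)
        then show ?thesis using e by (simp add: dist_norm)
      qed
      with \<open>d > 0\<close> show "\<exists>d>0. \<forall>x'\<in>Ec. dist x' v < d \<longrightarrow> dist (Blinfun (H x')) (Blinfun (H v)) < e"
        by blast
    qed
  next
    have "H 0 = (\<lambda>_. 0)" by (auto simp: H_def var_0 \<pi>E)
    then show "Blinfun (H 0) = 0" by (simp add: zero_blinfun_def)
  qed
qed

end

section \<open>Center manifolds of \<open>C\<^sup>1\<close> fields\<close>

context center_manifold_equation
begin

text \<open>A vector in both spaces starts a slow solution with hyperbolic initial value, hence is
  0. Addition is thus injective on \<open>Ec \<times> Eh\<close>, and an injective linear map in
  finite dimension is bounded below, which controls the center component.\<close>

lemma split_bound:
  "\<exists>K>0. \<forall>c\<in>Ec. \<forall>h\<in>Eh. norm c \<le> K * norm (c + h)"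
proof -
  let ?S = "Ec \<times> Eh" and ?f = "\<lambda>(c, h). c + h :: 'a"
  have disj: "v = 0" if v: "v \<in> Ec" "v \<in> Eh" for v
  proof -
    obtain D x where x: "x 0 = v" "\<And>t. (x has_vector_derivative A (x t)) (at t)"
       "\<And>t. norm (x t) \<le> D * norm v * exp (\<eta> * \<bar>t\<bar>)"
      using center_solution[OF \<eta>0] v by blast
    have "x 0 = 0"
      by (rule solution_unique[OF _ _ x(2,3)]) (use ad v x in \<open>auto simp: admissible_def\<close>)
    then show ?thesis using x by simp
  qed
  have "\<exists>e>0. \<forall>x\<in>?S. norm (?f x) \<ge> e * norm x"
  proof (rule injective_imp_isometric)
    show "subspace ?S" using Ec Eh by (rule subspace_Times)
    then show "closed ?S" by (rule closed_subspace)
    show "bounded_linear ?f"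
      unfolding case_prod_unfold by (intro bounded_linear_add bounded_linear_fst bounded_linear_snd)
    show "\<forall>x\<in>?S. ?f x = 0 \<longrightarrow> x = 0"
    proof clarify
      fix c h assume ch: "c \<in> Ec" "h \<in> Eh" "c + h = 0"
      then have "c = - h" by (simp add: eq_neg_iff_add_eq_0)
      then have "c \<in> Eh" using subspace_neg[OF Eh ch(2)] by simp
      then have "c = 0" using disj ch by blast
      then show "(c, h) = 0" using ch by (simp add: zero_prod_def)
    qed
  qed
  then obtain e where e: "e > 0" "\<And>c h. c \<in> Ec \<Longrightarrow> h \<in> Eh \<Longrightarrow> e * norm (c, h) \<le> norm (c + h)"
    by auto
  have "norm c \<le> (1 / e) * norm (c + h)" if "c \<in> Ec" "h \<in> Eh" for c h
  proof -
    have "e * norm c \<le> e * norm (c, h)" using e(1) norm_fst_le[of c h] by simp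
    also have "\<dots> \<le> norm (c + h)" using e(2) that by simp
    finally show ?thesis using e(1) by (simp add: field_simps)
  qed
  then show ?thesis using e(1) by (intro exI[of _ "1 / e"]) auto
qed

text \<open>By Gronwall's inequality \<open>x\<close> coincides with \<open>sol v\<close>, all of
  whose values lie on the graph over the full center space. Only the restriction to a ball makes the
  invariance local: the center component moves by at most \<open>K\<close> times the displacement of
  the solution and so stays in the ball for a short time.\<close>

lemma graph_locally_invariant:
  assumes T: "open T" "is_interval T" "0 \<in> T"
    and x: "\<And>t. t \<in> T \<Longrightarrow> (x has_vector_derivative A (x t) + g (x t)) (at t)"
    and v: "v \<in> Ec" "norm v < r" and x0: "x 0 = v + h v"
  shows "\<exists>\<epsilon>>0. \<forall>t\<in>T. \<bar>t\<bar> < \<epsilon> \<longrightarrow> x t \<in> (\<lambda>v. v + h v) ` (Ec \<inter> ball 0 r)"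
proof -
  have x0': "x 0 = sol v 0" using x0 by (simp add: h_def)
  obtain KA where KA: "\<And>y. norm (A y) \<le> norm y * KA" using bounded_linear.bounded[OF A] by blast
  have xs: "x t = sol v t" if "t \<in> T" for t
  proof -
    have "x t - sol v t = 0"
    proof (rule vector_derivative_zero_of_norm_bound[OF T(2,3), of "\<lambda>t. x t - sol v t"
          "\<lambda>t. A (x t) + g (x t) - (A (sol v t) + g (sol v t))" "KA + L"])
      show "((\<lambda>t. x t - sol v t) has_vector_derivative
          A (x t) + g (x t) - (A (sol v t) + g (sol v t))) (at t)" if "t \<in> T" for t
        by (intro has_vector_derivative_diff x sol v that)
      show "norm (A (x t) + g (x t) - (A (sol v t) + g (sol v t))) \<le> (KA + L) * norm (x t - sol v t)" for t
      proof -
        have "A (x t) + g (x t) - (A (sol v t) + g (sol v t))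
            = A (x t - sol v t) + (g (x t) - g (sol v t))" by (simp add: A_diff)
        also have "norm \<dots> \<le> norm (x t - sol v t) * KA + L * norm (x t - sol v t)"
          by (intro norm_triangle_le add_mono KA g_Lipschitz)
        finally show ?thesis by (simp add: algebra_simps)
      qed
    qed (use x0' that in auto)
    then show ?thesis by simp
  qed
  obtain K where K: "K > 0" "\<And>c h. c \<in> Ec \<Longrightarrow> h \<in> Eh \<Longrightarrow> norm c \<le> K * norm (c + h)"
    using split_bound by blast
  have "(r - norm v) / K > 0" using v K by simp
  moreover have "isCont (sol v) 0"
    using sol_continuous[OF v(1)] by (simp add: continuous_on_eq_continuous_at)
  ultimately obtain \<epsilon> where \<epsilon>: "\<epsilon> > 0"
    "\<And>t. norm (t - 0) < \<epsilon> \<Longrightarrow> dist (sol v t) (sol v 0) < (r - norm v) / K"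
    unfolding continuous_at_eps_delta by (metis dist_norm)
  have "x t \<in> (\<lambda>v. v + h v) ` (Ec \<inter> ball 0 r)" if t: "t \<in> T" "\<bar>t\<bar> < \<epsilon>" for t
  proof -
    obtain c where c: "c \<in> Ec" "sol v t = sol c 0" using sol_translate[OF v(1)] by blast
    have "norm (c - v) \<le> K * norm ((c - v) + (h c - h v))"
      by (intro K subspace_diff[OF Ec] subspace_diff[OF Eh] h_Eh c v)
    also have "(c - v) + (h c - h v) = sol v t - sol v 0" by (simp add: h_def c(2))
    also have "K * norm (sol v t - sol v 0) < K * ((r - norm v) / K)"
      using \<epsilon>(2)[of t] t K(1) by (intro mult_strict_left_mono) (auto simp: dist_norm)
    also have "\<dots> = r - norm v" using K(1) by simp
    finally have "norm c < r" using norm_triangle_ineq2[of c v] by linarith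
    moreover have "x t = c + h c" using xs[OF t(1)] c(2) by (simp add: h_def)
    ultimately show ?thesis using c(1) by auto
  qed
  then show ?thesis using \<epsilon>(1) by blast
qed

lemma norm_graph_le: "v \<in> Ec \<Longrightarrow> norm (v + h v) \<le> 2 * C * norm v"
  using sol(4)[of v 0] by (simp add: h_def)

end

text \<open>The antiderivative of a trapezoid \<open>q\<close> that is 1 on [-1, 1] and 0 outside
  [-2, 2]: the identity in the middle and constant outside.\<close>

lemma ex_C1_cutoff:
  obtains \<theta> q :: "real \<Rightarrow> real"
  where "\<And>s. (\<theta> has_real_derivative q s) (at s)" "continuous_on UNIV q" "\<And>s. \<bar>q s\<bar> \<le> 1"
    "\<And>s. \<bar>s\<bar> \<le> 1 \<Longrightarrow> \<theta> s = s" "\<And>s. \<bar>\<theta> s\<bar> \<le> 2"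
proof -
  define q :: "real \<Rightarrow> real" where "q s = max 0 (1 - max 0 (\<bar>s\<bar> - 1))" for s
  have q: "continuous_on UNIV q" unfolding q_def[abs_def] by (intro continuous_intros)
  obtain \<theta> where \<theta>0: "\<theta> 0 = 0" and \<theta>': "\<And>s. (\<theta> has_vector_derivative q s) (at s)"
    using antiderivative_on_line[OF q] by blast
  have \<theta>: "(\<theta> has_real_derivative q s) (at s)" for s
    using \<theta>' by (simp add: has_real_derivative_iff_has_vector_derivative)
  have "((\<lambda>s. \<theta> s - s) has_vector_derivative 0) (at s within {-1..1})" if "s \<in> {-1..1}" for s
  proof -
    have "q s = 1" using that by (auto simp: q_def)
    then have "((\<lambda>s. \<theta> s - s) has_real_derivative 0) (at s)"
      using \<theta>[of s] by (auto intro!: derivative_eq_intros)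
    then show ?thesis
      by (simp add: has_real_derivative_iff_has_vector_derivative has_vector_derivative_at_within)
  qed
  then obtain c where c: "\<And>s. s \<in> {-1..1} \<Longrightarrow> \<theta> s - s = c"
    by (rule has_vector_derivative_zero_constant[rotated]) auto
  have id: "\<theta> s = s" if "\<bar>s\<bar> \<le> 1" for s
    using c[of s] c[of 0] that \<theta>0 by (auto simp: abs_le_iff)
  have bq: "\<bar>q s\<bar> \<le> 1" for s by (auto simp: q_def)
  have ab: "\<bar>\<theta> s\<bar> \<le> \<bar>s\<bar>" for s
  proof -
    have "norm (\<theta> s - \<theta> 0) \<le> 1 * norm (s - 0)"
      by (rule field_differentiable_bound[of UNIV \<theta> q]) (auto simp: \<theta> bq)
    then show ?thesis using \<theta>0 by simp
  qed
  have const: "\<exists>a. \<forall>s\<in>S. \<theta> s = a" if S: "convex S" "\<And>s. s \<in> S \<Longrightarrow> \<bar>s\<bar> \<ge> 2" for S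
  proof -
    have "(\<theta> has_vector_derivative 0) (at s within S)" if "s \<in> S" for s
      using \<theta>'[of s] S(2)[OF that] by (auto simp: q_def intro: has_vector_derivative_at_within)
    then show ?thesis using has_vector_derivative_zero_constant[OF S(1)] by metis
  qed
  have "\<bar>\<theta> s\<bar> \<le> 2" for s
  proof -
    consider "\<bar>s\<bar> \<le> 2" | "s \<in> {2..}" | "s \<in> {..-2}" by fastforce
    then show ?thesis
    proof cases
      case 1
      then show ?thesis using ab[of s] by simp
    next
      case 2
      obtain a where "\<And>s. s \<in> {2..} \<Longrightarrow> \<theta> s = a" using const[of "{2..}"] by auto
      then have "\<theta> s = \<theta> 2" using 2 by simp
      then show ?thesis using ab[of 2] by simp
    next
      case 3
      obtain a where "\<And>s. s \<in> {..-2} \<Longrightarrow> \<theta> s = a" using const[of "{..-2}"] by auto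
      then have "\<theta> s = \<theta> (-2)" using 3 by simp
      then show ?thesis using ab[of "-2"] by simp
    qed
  qed
  then show ?thesis using that \<theta> q bq id by blast
qed

text \<open>Composing a field with this \<open>C\<^sup>1\<close> retraction into a small cube cuts the field off without
  multiplying it, so that no product rule is needed.\<close>

lemma ex_C1_retraction:
  assumes R: "R > 0"
  obtains \<rho> :: "real^'n::finite \<Rightarrow> real^'n" and \<rho>'
  where "\<And>x. (\<rho> has_derivative blinfun_apply (\<rho>' x)) (at x)" "continuous_on UNIV \<rho>'"
    "\<And>x. norm (\<rho>' x) \<le> real CARD('n)" "\<And>x. norm x \<le> R \<Longrightarrow> \<rho> x = x"
    "\<And>x. norm (\<rho> x) \<le> 2 * R * real CARD('n)"
    "\<And>K x. x \<in> coord_space K \<Longrightarrow> \<rho> x \<in> coord_space K"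
proof -
  obtain \<theta> q :: "real \<Rightarrow> real" where \<theta>: "\<And>s. (\<theta> has_real_derivative q s) (at s)"
    and q: "continuous_on UNIV q" "\<And>s. \<bar>q s\<bar> \<le> 1" and id: "\<And>s. \<bar>s\<bar> \<le> 1 \<Longrightarrow> \<theta> s = s"
    and bd: "\<And>s. \<bar>\<theta> s\<bar> \<le> 2"
    using ex_C1_cutoff by blast
  define E :: "'n \<Rightarrow> (real^'n) \<Rightarrow>\<^sub>L (real^'n)" where "E i = Blinfun (\<lambda>w. (w $ i) *\<^sub>R axis i 1)" for i
  have "bounded_linear (\<lambda>w::real^'n. (w $ i) *\<^sub>R (axis i 1 :: real^'n))" for i
    by (intro bounded_linear_scaleR_const bounded_linear_vec_nth)
  then have E: "blinfun_apply (E i) w = (w $ i) *\<^sub>R axis i 1" for i w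
    by (simp add: E_def bounded_linear_Blinfun_apply)
  have nE: "norm (E i) \<le> 1" for i
    by (rule norm_blinfun_bound) (auto simp: E norm_axis_1 component_le_norm_cart)
  define \<rho> :: "real^'n \<Rightarrow> real^'n" where "\<rho> x = (\<Sum>i\<in>UNIV. (R * \<theta> (x $ i / R)) *\<^sub>R axis i 1)" for x
  define \<rho>' :: "real^'n \<Rightarrow> (real^'n) \<Rightarrow>\<^sub>L (real^'n)" where "\<rho>' x = (\<Sum>i\<in>UNIV. q (x $ i / R) *\<^sub>R E i)" for x
  have \<rho>_nth: "\<rho> x $ i = R * \<theta> (x $ i / R)" for x i
  proof -
    have "\<rho> x $ i = (\<Sum>j\<in>UNIV. if j = i then R * \<theta> (x $ i / R) else 0)"
      unfolding \<rho>_def sum_component by (intro sum.cong) (auto simp: axis_def)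
    then show ?thesis by simp
  qed
  show ?thesis
  proof (rule that[of \<rho> \<rho>'])
    show "(\<rho> has_derivative blinfun_apply (\<rho>' x)) (at x)" for x
    proof -
      have "((\<lambda>x. (R * \<theta> (x $ i / R)) *\<^sub>R axis i 1) has_derivative
          (\<lambda>w. (q (x $ i / R) * w $ i) *\<^sub>R (axis i 1 :: real^'n))) (at x)" for i
      proof -
        have "((\<lambda>x. x $ i / R) has_derivative (\<lambda>w. w $ i / R)) (at x)"
          using bounded_linear_imp_has_derivative[OF bounded_linear_vec_nth[of i]] R
          by (auto intro!: derivative_eq_intros)
        from has_derivative_compose[OF this \<theta>[unfolded has_field_derivative_def]]
        have "((\<lambda>x. \<theta> (x $ i / R)) has_derivative (\<lambda>w. q (x $ i / R) * (w $ i / R))) (at x)" .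
        from has_derivative_scaleR_left[OF has_derivative_mult_right[OF this, of R], of "axis i 1 :: real^'n"]
        show ?thesis using R by simp
      qed
      then have "(\<rho> has_derivative (\<lambda>w. \<Sum>i\<in>UNIV. (q (x $ i / R) * w $ i) *\<^sub>R axis i 1)) (at x)"
        unfolding \<rho>_def[abs_def] by (intro has_derivative_sum)
      moreover have "(\<lambda>w. \<Sum>i\<in>UNIV. (q (x $ i / R) * w $ i) *\<^sub>R axis i 1) = blinfun_apply (\<rho>' x)"
        by (auto simp: \<rho>'_def blinfun.sum_left blinfun.scaleR_left E)
      ultimately show ?thesis by simp
    qed
    show "continuous_on UNIV \<rho>'"
      unfolding \<rho>'_def[abs_def]
      by (intro continuous_intros continuous_on_compose2[OF q(1)] linear_continuous_on bounded_linear_vec_nth)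
        (use R in auto)
    \<comment> \<open>Each coordinate contributes at most 1. The crude constant does no harm: the
      derivative of the field is later required to be smaller by the same factor.\<close>
    show "norm (\<rho>' x) \<le> real CARD('n)" for x
    proof -
      have "norm (\<rho>' x) \<le> (\<Sum>i::'n\<in>UNIV. 1)"
        unfolding \<rho>'_def
      proof (rule sum_norm_le)
        show "norm (q (x $ i / R) *\<^sub>R E i) \<le> 1" for i
          using mult_mono[OF q(2)[of "x $ i / R"] nE[of i]] by simp
      qed
      then show ?thesis by simp
    qed
    show "\<rho> x = x" if "norm x \<le> R" for x
    proof -
      have "\<bar>x $ i / R\<bar> \<le> 1" for i
        using component_le_norm_cart[of x i] that R by (simp add: abs_divide divide_le_eq)
      then show ?thesis using R by (simp add: vec_eq_iff \<rho>_nth id)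
    qed
    show "norm (\<rho> x) \<le> 2 * R * real CARD('n)" for x
    proof -
      have "norm (\<rho> x) \<le> (\<Sum>i::'n\<in>UNIV. \<bar>\<rho> x $ i\<bar>)" by (rule norm_le_l1_cart)
      also have "\<dots> \<le> (\<Sum>i::'n\<in>UNIV. 2 * R)"
        using bd R by (intro sum_mono) (simp add: \<rho>_nth abs_mult)
      finally show ?thesis by (simp add: mult_ac)
    qed
    show "\<rho> x \<in> coord_space K" if "x \<in> coord_space K" for K x
      using that by (simp add: coord_space_def \<rho>_nth id)
  qed
qed

lemma bounded_linear_blk: "bounded_linear (blk K)" for K :: "'n::finite set"
  unfolding linear_conv_bounded_linear[symmetric]
  by (rule linearI) (auto simp: blk_def vec_eq_iff)

lemma blk_in_coord_space: "blk K x \<in> coord_space K"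
  by (simp add: blk_def coord_space_def)

lemma blk_id: "x \<in> coord_space K \<Longrightarrow> blk K x = x"
  by (auto simp: blk_def coord_space_def vec_eq_iff)

lemma norm_blk_le: "norm (blk K x) \<le> norm x"
  unfolding norm_vec_def blk_def by (rule L2_set_mono) auto

text \<open>A derivative within a subset of a coordinate subspace is at most determined along that
  subspace. Placing it between two block projections removes the freedom, preserves continuity and
  yields a matrix supported in the block.\<close>

lemma C1_on_coord_space:
  fixes f :: "real^'n::finite \<Rightarrow> real^'n"
  assumes C1: "C1_on D f" and D: "D \<subseteq> coord_space K" and f: "\<And>x. x \<in> D \<Longrightarrow> f x \<in> coord_space K"
  obtains F' :: "real^'n \<Rightarrow> (real^'n) \<Rightarrow>\<^sub>L (real^'n)"
  where "\<And>x. x \<in> D \<Longrightarrow> (f has_derivative blinfun_apply (F' x)) (at x within D)"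
    "continuous_on D F'" "\<And>x w. blinfun_apply (F' x) w \<in> coord_space K"
    "\<And>x w. blinfun_apply (F' x) (blk K w) = blinfun_apply (F' x) w"
proof -
  obtain f' :: "real^'n \<Rightarrow> (real^'n) \<Rightarrow>\<^sub>L (real^'n)"
    where f': "\<And>x. x \<in> D \<Longrightarrow> (f has_derivative blinfun_apply (f' x)) (at x within D)"
    and cf': "continuous_on D f'"
    using C1 unfolding C1_on_def by blast
  define Pb :: "(real^'n) \<Rightarrow>\<^sub>L (real^'n)" where "Pb = Blinfun (blk K)"
  have Pb: "blinfun_apply Pb w = blk K w" for w
    by (simp add: Pb_def bounded_linear_Blinfun_apply bounded_linear_blk)
  have bd: "(blk K has_derivative blk K) F" for F :: "(real^'n) filter"
    by (rule bounded_linear_imp_has_derivative[OF bounded_linear_blk])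
  show ?thesis
  proof (rule that[of "\<lambda>x. Pb o\<^sub>L f' x o\<^sub>L Pb"])
    fix x assume x: "x \<in> D"
    have img: "blk K ` D \<subseteq> D" using D blk_id by force
    have "((\<lambda>x. f (blk K x)) has_derivative (\<lambda>w. blinfun_apply (f' (blk K x)) (blk K w))) (at x within D)"
      by (rule has_derivative_in_compose2[OF f' img x bd])
    then have "((\<lambda>x. blk K (f (blk K x))) has_derivative
        (\<lambda>w. blk K (blinfun_apply (f' (blk K x)) (blk K w)))) (at x within D)"
      by (rule bounded_linear.has_derivative[OF bounded_linear_blk])
    then have "(f has_derivative (\<lambda>w. blk K (blinfun_apply (f' (blk K x)) (blk K w)))) (at x within D)"
    proof (rule has_derivative_transform[OF x, rotated])
      show "f z = blk K (f (blk K z))" if "z \<in> D" for z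
        using blk_id[of z K] blk_id[OF f[OF that]] that D by auto
    qed
    then show "(f has_derivative blinfun_apply (Pb o\<^sub>L f' x o\<^sub>L Pb)) (at x within D)"
      by (rule has_derivative_eq_rhs) (use D x blk_id in \<open>force simp: Pb\<close>)
  qed (auto simp: Pb blk_in_coord_space blk_id
      intro!: bounded_bilinear.continuous_on[OF bounded_bilinear_blinfun_compose] continuous_intros cf')
qed

theorem center_manifold_exists:
  fixes f :: "real^'n::finite \<Rightarrow> real^'n"
  assumes D: "openin (top_of_set (coord_space K)) D" and D0: "0 \<in> D" and f0: "f 0 = 0"
    and C1: "C1_on D f" and fK: "\<And>x. x \<in> D \<Longrightarrow> f x \<in> coord_space K"
  shows "\<exists>M. center_manifold K D f M"
proof -
  let ?X = "coord_space K :: (real^'n) set"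
  have DX: "D \<subseteq> ?X" using D openin_imp_subset by blast
  obtain F' where F': "\<And>x. x \<in> D \<Longrightarrow> (f has_derivative blinfun_apply (F' x)) (at x within D)"
    and cF': "continuous_on D F'" and F'X: "\<And>x w. blinfun_apply (F' x) w \<in> ?X"
    and F'blk: "\<And>x w. blinfun_apply (F' x) (blk K w) = blinfun_apply (F' x) w"
    using C1_on_coord_space[OF C1 DX fK] by metis
  define A where "A = matrix (blinfun_apply (F' 0))"
  have A_apply: "A *v x = blinfun_apply (F' 0) x" for x
    unfolding A_def using matrix_vector_mul(3)[OF blinfun.bounded_linear_right] by metis
  interpret matrix_block A K
  proof
    fix i j assume nz: "A $ i $ j \<noteq> 0"
    have Aij: "A $ i $ j = blinfun_apply (F' 0) (axis j 1) $ i" by (simp add: A_def matrix_def)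
    then have "i \<in> K" using nz F'X[of 0 "axis j 1"] by (auto simp: coord_space_def)
    moreover have "j \<in> K"
    proof (rule ccontr)
      assume "j \<notin> K"
      then have "blk K (axis j 1) = (0 :: real^'n)" by (auto simp: blk_def axis_def vec_eq_iff)
      then have "blinfun_apply (F' 0) (axis j 1) = 0"
        using F'blk[of 0 "axis j 1"] by (simp add: blinfun.zero_right)
      then show False using nz Aij by simp
    qed
    ultimately show "i \<in> K \<and> j \<in> K" ..
  qed
  obtain \<beta> where \<beta>: "\<beta> > 0" "\<And>\<eta>. \<eta> < \<beta> \<Longrightarrow> gap \<eta>" using ex_gap by blast
  interpret lyapunov_perron "(*v) A" ?X "center_space K A" "hyperbolic_space K A" \<beta>
  proof (rule lyapunov_perron.intro)
    show "bounded_linear ((*v) A)" by (rule matrix_vector_mul_bounded_linear)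
    show "subspace ?X" by (rule subspace_coord_space)
    show "subspace (center_space K A)" "subspace (hyperbolic_space K A)"
      by (rule subspace_spectral_space)+
  next
    fix x assume "x \<in> ?X"
    then show "\<exists>c\<in>center_space K A. \<exists>h\<in>hyperbolic_space K A. x = c + h" by (rule coord_space_split)
  next
    fix \<eta> :: real assume "0 < \<eta>"
    then show "\<exists>C\<ge>0. \<forall>v\<in>center_space K A. \<exists>x. x 0 = v \<and> (\<forall>t. x t \<in> ?X \<and>
       (x has_vector_derivative A *v x t) (at t) \<and> norm (x t) \<le> C * norm v * exp (\<eta> * \<bar>t\<bar>))"
      by (rule ex_center_space_solution_uniform)
  next
    fix \<eta> :: real assume "0 < \<eta>" "\<eta> < \<beta>"
    then show "\<exists>C\<ge>0. \<forall>p P. continuous_on UNIV p \<longrightarrow>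
       (\<forall>t. p t \<in> ?X \<and> norm (p t) \<le> P * exp (\<eta> * \<bar>t\<bar>)) \<longrightarrow>
       (\<exists>x. x 0 \<in> hyperbolic_space K A \<and> (\<forall>t. x t \<in> ?X \<and>
          (x has_vector_derivative A *v x t + p t) (at t) \<and> norm (x t) \<le> C * P * exp (\<eta> * \<bar>t\<bar>)))"
      using \<beta>(2) by (intro ex_hyperbolic_solution) auto
  next
    fix \<eta> B r :: real and z :: "real \<Rightarrow> real^'n"
    assume "0 < \<eta>" "\<eta> < \<beta>" and z: "\<And>t. (z has_vector_derivative A *v z t) (at t)"
      "\<And>t. norm (z t) \<le> B * exp (\<eta> * \<bar>t\<bar>)" "z 0 \<in> hyperbolic_space K A"
    then show "z r = 0" using bounded_solution_zero[OF \<beta>(2) z] by blast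
  qed
  obtain C where C: "admissible (\<beta> / 3) C" using ex_admissible[of "\<beta> / 3"] \<beta>(1) by auto
  obtain C' where C': "admissible (2 * \<beta> / 3) C'" using ex_admissible[of "2 * \<beta> / 3"] \<beta>(1) by auto
  have C0: "0 \<le> C" "0 \<le> C'" using C C' by (auto simp: admissible_def)
  \<comment> \<open>One Lipschitz constant that keeps both \<open>C * L\<close> and
    \<open>C' * L\<close> below one half.\<close>
  define L where "L = 1 / (2 * (C + C' + 1))"
  have L: "L > 0" using C0 by (simp add: L_def)
  have CL: "C * L \<le> 1 / 2" "C' * L \<le> 1 / 2" using C0 by (auto simp: L_def field_simps)
  define n where "n = real CARD('n)"
  have n: "n \<ge> 1" by (simp add: n_def Suc_leI)
  obtain r1 where r1: "r1 > 0" "ball 0 r1 \<inter> ?X \<subseteq> D"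
    using D D0 unfolding openin_contains_ball by blast
  have "L / n > 0" using L n by simp
  then obtain r2 where r2: "r2 > 0" "\<And>x. x \<in> D \<Longrightarrow> dist x 0 < r2 \<Longrightarrow> dist (F' x) (F' 0) < L / n"
    using cF' D0 unfolding continuous_on_iff by metis
  \<comment> \<open>The retraction takes values of norm at most \<open>2 * R * n\<close>. This is
    less than \<open>r1\<close>, so they lie in \<open>D\<close>, and less than \<open>r2\<close>,
    so \<open>F'\<close> is within \<open>L / n\<close> of \<open>F' 0\<close> there; the factor
    \<open>n\<close> from \<open>\<rho>'\<close> then turns \<open>L / n\<close> into
    \<open>L\<close>.\<close>
  define R where "R = min r1 r2 / (3 * n)"
  have R: "R > 0" using r1 r2 n by (simp add: R_def)
  have "2 * R * n < 3 * R * n" using R n by simp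
  also have "\<dots> = min r1 r2" using n by (simp add: R_def)
  finally have Rn: "2 * R * n < r1" "2 * R * n < r2" by auto
  obtain \<rho> :: "real^'n \<Rightarrow> real^'n" and \<rho>' where
    \<rho>: "\<And>x. (\<rho> has_derivative blinfun_apply (\<rho>' x)) (at x)" and c\<rho>': "continuous_on UNIV \<rho>'"
    and n\<rho>': "\<And>x. norm (\<rho>' x) \<le> n" and \<rho>id: "\<And>x. norm x \<le> R \<Longrightarrow> \<rho> x = x"
    and n\<rho>: "\<And>x. norm (\<rho> x) \<le> 2 * R * n" and \<rho>K: "\<And>x. x \<in> ?X \<Longrightarrow> \<rho> x \<in> ?X"
    using ex_C1_retraction[OF R, where 'n = 'n] unfolding n_def by metis
  \<comment> \<open>The block projection extends the field from the coordinate space to all vectors.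
    On vectors of the coordinate space of norm at most \<open>R\<close> the map \<open>y\<close> is
    the identity, so there the new field agrees with \<open>f\<close>.\<close>
  define y where "y x = \<rho> (blk K x)" for x
  have yX: "y x \<in> ?X" for x unfolding y_def by (intro \<rho>K blk_in_coord_space)
  have ny1: "norm (y x) < r1" and ny2: "norm (y x) < r2" for x
    using n\<rho>[of "blk K x"] Rn by (auto simp: y_def)
  have yD: "y x \<in> D" for x using r1(2) yX[of x] ny1[of x] by auto
  define Pb :: "(real^'n) \<Rightarrow>\<^sub>L (real^'n)" where "Pb = Blinfun (blk K)"
  have Pb: "blinfun_apply Pb w = blk K w" for w
    by (simp add: Pb_def bounded_linear_Blinfun_apply bounded_linear_blk)
  have nPb: "norm Pb \<le> 1" by (rule norm_blinfun_bound) (auto simp: Pb norm_blk_le)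
  have yd: "(y has_derivative (\<lambda>w. blinfun_apply (\<rho>' (blk K x)) (blk K w))) (at x)" for x
    unfolding y_def[abs_def]
    by (rule has_derivative_compose[OF bounded_linear_imp_has_derivative[OF bounded_linear_blk] \<rho>])
  have cblk: "continuous_on UNIV (blk K :: real^'n \<Rightarrow> real^'n)"
    by (rule linear_continuous_on[OF bounded_linear_blk])
  have cy: "continuous_on UNIV y"
    using yd by (meson continuous_at_imp_continuous_on has_derivative_continuous)
  define g where "g x = f (y x) - A *v y x" for x
  define g' where "g' x = (F' (y x) - F' 0) o\<^sub>L \<rho>' (blk K x) o\<^sub>L Pb" for x
  interpret center_manifold_equation "(*v) A" ?X "center_space K A" "hyperbolic_space K A" \<beta>
    g g' L "\<beta> / 3" "2 * \<beta> / 3" C C'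
  proof
    fix x w
    have fd: "((\<lambda>z. f z - A *v z) has_derivative (\<lambda>w. blinfun_apply (F' z) w - A *v w)) (at z within D)"
      if "z \<in> D" for z
      by (intro has_derivative_diff F' that bounded_linear_imp_has_derivative
          matrix_vector_mul_bounded_linear)
    have "(g has_derivative (\<lambda>w. blinfun_apply (F' (y x)) (blinfun_apply (\<rho>' (blk K x)) (blk K w))
        - A *v (blinfun_apply (\<rho>' (blk K x)) (blk K w)))) (at x)"
      unfolding g_def[abs_def]
      by (rule has_derivative_in_compose2[OF fd _ UNIV_I yd]) (auto simp: yD)
    then show "(g has_derivative blinfun_apply (g' x)) (at x)"
      by (rule has_derivative_eq_rhs) (simp add: g'_def Pb A_apply blinfun.diff_left fun_eq_iff)
    have "norm (g' x) \<le> norm (F' (y x) - F' 0) * norm (\<rho>' (blk K x)) * norm Pb"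
      unfolding g'_def
      by (intro order_trans[OF norm_blinfun_compose] mult_right_mono norm_blinfun_compose) simp
    also have "\<dots> \<le> (L / n) * n * 1"
      using r2(2)[OF yD[of x]] ny2[of x] n\<rho>' nPb L n
      by (intro mult_mono) (auto simp: dist_norm)
    finally show "norm (g' x) \<le> L" using n by simp
    show "g x \<in> ?X" unfolding g_def A_apply by (intro subspace_diff[OF subspace_coord_space] fK yD F'X)
    show "blinfun_apply (g' x) w \<in> ?X"
      by (simp add: g'_def blinfun.diff_left subspace_diff[OF subspace_coord_space] F'X)
  next
    show "continuous_on UNIV g'"
      unfolding g'_def[abs_def]
      by (intro bounded_bilinear.continuous_on[OF bounded_bilinear_blinfun_compose] continuous_intros
          continuous_on_compose2[OF cF' cy] continuous_on_compose2[OF c\<rho>' cblk]) (auto simp: yD)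
    have y0: "y 0 = 0"
      using \<rho>id[of 0] R blk_id[OF subspace_0[OF subspace_coord_space], of K] by (simp add: y_def)
    show "g 0 = 0" by (simp add: g_def y0 f0)
    show "g' 0 = 0" by (simp add: g'_def y0)
  qed (use C C' CL \<beta> in auto)
  obtain h' :: "real^'n \<Rightarrow> (real^'n) \<Rightarrow>\<^sub>L (real^'n)" where
    h': "\<And>v. v \<in> center_space K A \<Longrightarrow> (h has_derivative blinfun_apply (h' v)) (at v within center_space K A)"
    and ch': "continuous_on (center_space K A) h'" and h'0: "h' 0 = 0"
    using h_C1 by blast
  \<comment> \<open>By \<open>norm_graph_le\<close> the graph over the ball of radius
    \<open>r\<close> has norm below \<open>R\<close>, where the cut-off is invisible.\<close>
  define r where "r = R / (2 * C + 1)"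
  have C1': "2 * C + 1 > 0" using C0 by (simp add: add_nonneg_pos)
  have r: "r > 0" using R C1' by (simp add: r_def)
  define B where "B = center_space K A \<inter> ball 0 r"
  have BE: "B \<subseteq> center_space K A" by (auto simp: B_def)
  have B0: "0 \<in> B" using r by (simp add: B_def subspace_0[OF subspace_spectral_space])
  define M where "M = (\<lambda>v. v + h v) ` B"
  have small: "norm (v + h v) < R" if "v \<in> B" for v
  proof -
    have "norm (v + h v) \<le> 2 * C * norm v" using norm_graph_le BE that by blast
    also have "\<dots> \<le> 2 * C * r" using that C0 by (intro mult_left_mono) (auto simp: B_def)
    also have "\<dots> < (2 * C + 1) * r" using r by (simp add: algebra_simps)
    also have "\<dots> = R" using C1' by (simp add: r_def)
    finally show ?thesis .
  qed
  have "R \<le> 2 * R * n" using R n by simp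
  then have RD: "x \<in> D" if "x \<in> ?X" "norm x < R" for x using that Rn r1(2) by auto
  have MX: "v + h v \<in> ?X" if "v \<in> B" for v
    using that BE spectral_space_subset h_Eh by (intro subspace_add[OF subspace_coord_space]) blast+
  have MD: "M \<subseteq> D" unfolding M_def using RD MX small by blast
  have inv: "locally_invariant D f M"
    unfolding locally_invariant_def
  proof (intro allI impI)
    fix T x assume "solution D f T x \<and> x 0 \<in> M"
    then have T: "open T" "is_interval T" "0 \<in> T" and xD: "\<And>t. t \<in> T \<Longrightarrow> x t \<in> D"
      and xd: "\<And>t. t \<in> T \<Longrightarrow> (x has_vector_derivative f (x t)) (at t)" and x0: "x 0 \<in> M"
      by (auto simp: solution_def)
    obtain v where v: "v \<in> B" "x 0 = v + h v" using x0 by (auto simp: M_def)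
    have "isCont x 0" using xd[OF T(3)] by (rule has_vector_derivative_continuous)
    moreover have "R - norm (x 0) > 0" using small[OF v(1)] v(2) by simp
    ultimately obtain \<epsilon>1 where \<epsilon>1: "\<epsilon>1 > 0" "\<And>t. norm (t - 0) < \<epsilon>1 \<Longrightarrow> dist (x t) (x 0) < R - norm (x 0)"
      unfolding continuous_at_eps_delta by (metis dist_norm)
    have xR: "norm (x t) < R" if "\<bar>t\<bar> < \<epsilon>1" for t
      using \<epsilon>1(2)[of t] that norm_triangle_ineq2[of "x t" "x 0"] by (simp add: dist_norm)
    \<comment> \<open>For these times the solution of the original system has norm below
      \<open>R\<close>, so it also solves the cut-off system, for which invariance of the graph is
      known.\<close>
    define T' where "T' = T \<inter> {-\<epsilon>1<..<\<epsilon>1}"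
    have T': "open T'" "is_interval T'" "0 \<in> T'"
      unfolding T'_def using T \<epsilon>1(1) by (auto intro!: is_interval_Int simp: is_interval_oo)
    have "(x has_vector_derivative A *v x t + g (x t)) (at t)" if "t \<in> T'" for t
    proof -
      have t: "t \<in> T" "\<bar>t\<bar> < \<epsilon>1" using that by (auto simp: T'_def)
      have "blk K (x t) = x t" using blk_id xD[OF t(1)] DX by blast
      then have "y (x t) = x t" using \<rho>id[of "x t"] xR[OF t(2)] by (simp add: y_def)
      then show ?thesis using xd[OF t(1)] by (simp add: g_def)
    qed
    from graph_locally_invariant[OF T' this _ _ v(2), of r]
    obtain \<epsilon>2 where \<epsilon>2: "\<epsilon>2 > 0" "\<And>t. t \<in> T' \<Longrightarrow> \<bar>t\<bar> < \<epsilon>2 \<Longrightarrow> x t \<in> M"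
      using v(1) by (auto simp: B_def M_def)
    show "\<exists>\<epsilon>>0. \<forall>t\<in>T. \<bar>t\<bar> < \<epsilon> \<longrightarrow> x t \<in> M"
      using \<epsilon>1(1) \<epsilon>2 by (intro exI[of _ "min \<epsilon>1 \<epsilon>2"]) (auto simp: T'_def abs_less_iff)
  qed
  have hB: "(h has_derivative blinfun_apply (h' v)) (at v within B)" if "v \<in> B" for v
    by (rule has_derivative_subset[OF h' BE]) (use that BE in blast)
  have "C1_on B h"
    unfolding C1_on_def using hB continuous_on_subset[OF ch' BE] by blast
  moreover have "(h has_derivative (\<lambda>_. 0)) (at 0 within B)"
    by (rule has_derivative_eq_rhs[OF hB[OF B0]]) (simp add: h'0 fun_eq_iff)
  moreover have "(f has_derivative (\<lambda>x. A *v x)) (at 0 within D)"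
    using F'[OF D0] by (simp add: A_apply[abs_def])
  moreover have "\<forall>v\<in>B. h v \<in> hyperbolic_space K A" using h_Eh BE by blast
  ultimately have "center_manifold K D f M"
    unfolding center_manifold_def Let_def
    using D D0 f0 r h_0 MD inv M_def B_def by blast
  then show ?thesis by blast
qed

section \<open>The singular system\<close>

lemma norm_matrix_vector_mult_le:
  "norm (M *v u) \<le> real CARD('n) * norm M * norm u" for M :: "real^'n::finite^'n"
proof -
  have "norm (M *v u) \<le> (\<Sum>i\<in>UNIV. \<bar>(M *v u) $ i\<bar>)" by (rule norm_le_l1_cart)
  also have "\<dots> \<le> (\<Sum>i::'n\<in>UNIV. norm M * norm u)"
  proof (rule sum_mono)
    fix i
    have "\<bar>(M *v u) $ i\<bar> \<le> norm (M $ i) * norm u"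
      unfolding matrix_vector_mul_component by (rule Cauchy_Schwarz_ineq2)
    also have "\<dots> \<le> norm M * norm u" by (intro mult_right_mono Finite_Cartesian_Product.norm_nth_le) simp
    finally show "\<bar>(M *v u) $ i\<bar> \<le> norm M * norm u" .
  qed
  finally show ?thesis by simp
qed

text \<open>The mean value inequality is applied between \<open>y\<close> and its projection
  \<open>z\<close> to the hyperplane of vanishing k-component, where that component of the field is
  0. As \<open>y0\<close> lies in the hyperplane, \<open>z\<close> is no farther from it than
  \<open>y\<close>.\<close>

lemma C1_field_component_bound:
  fixes f :: "real^'n::finite \<Rightarrow> real^'n"
  assumes D: "openin (top_of_set (coord_space K)) D" and C1: "C1_on D f" and k: "k \<in> K"
    and f0: "\<And>y. y \<in> D \<Longrightarrow> y $ k = 0 \<Longrightarrow> f y $ k = 0"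
    and y0: "y0 \<in> D" "y0 $ k = 0"
  shows "\<exists>r>0. \<exists>B. \<forall>y\<in>D. dist y y0 < r \<longrightarrow> \<bar>f y $ k\<bar> \<le> B * \<bar>y $ k\<bar>"
proof -
  obtain f' :: "real^'n \<Rightarrow> (real^'n) \<Rightarrow>\<^sub>L (real^'n)"
    where f': "\<And>x. x \<in> D \<Longrightarrow> (f has_derivative blinfun_apply (f' x)) (at x within D)"
    and cf': "continuous_on D f'"
    using C1 unfolding C1_on_def by blast
  obtain r1 where r1: "r1 > 0" "ball y0 r1 \<inter> coord_space K \<subseteq> D"
    using D y0(1) unfolding openin_contains_ball by blast
  obtain r2 where r2: "r2 > 0" "\<And>x. x \<in> D \<Longrightarrow> dist x y0 < r2 \<Longrightarrow> dist (f' x) (f' y0) < 1"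
    using cf' y0(1) zero_less_one unfolding continuous_on_iff by metis
  define r where "r = min r1 r2"
  define B where "B = norm (f' y0) + 1"
  define S where "S = ball y0 r \<inter> coord_space K"
  have SD: "S \<subseteq> D" using r1 by (auto simp: S_def r_def)
  have DK: "D \<subseteq> coord_space K" using D openin_imp_subset by blast
  have convS: "convex S" unfolding S_def
    by (intro convex_Int convex_ball subspace_imp_convex subspace_coord_space)
  have "\<bar>f y $ k\<bar> \<le> B * \<bar>y $ k\<bar>" if y: "y \<in> D" "dist y y0 < r" for y
  proof -
    define z where "z = (\<chi> i. if i = k then 0 else y $ i)"
    have yz: "y - z = (y $ k) *\<^sub>R axis k 1" by (auto simp: z_def vec_eq_iff axis_def)
    have yS: "y \<in> S" using y DK by (auto simp: S_def dist_commute)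
    have "norm (z - y0) \<le> norm (y - y0)"
      unfolding norm_vec_def by (rule L2_set_mono) (auto simp: z_def y0)
    then have zS: "z \<in> S" using yS by (auto simp: S_def coord_space_def z_def dist_norm norm_minus_commute)
    have "norm (f y - f z) \<le> B * norm (y - z)"
    proof (rule differentiable_bound[OF convS _ _ yS zS])
      fix x assume x: "x \<in> S"
      show "(f has_derivative blinfun_apply (f' x)) (at x within S)"
        by (rule has_derivative_subset[OF f' SD]) (use x SD in blast)
      have "dist (f' x) (f' y0) < 1"
        using x SD by (intro r2) (auto simp: S_def r_def dist_commute)
      then have "norm (f' x) \<le> B"
        using norm_triangle_ineq2[of "f' x" "f' y0"] by (simp add: B_def dist_norm)
      then show "onorm (blinfun_apply (f' x)) \<le> B" by (simp add: norm_blinfun.rep_eq)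
    qed
    also have "norm (y - z) = \<bar>y $ k\<bar>" by (simp add: yz norm_axis_1)
    finally have "norm (f y - f z) \<le> B * \<bar>y $ k\<bar>" .
    moreover have "f z $ k = 0" using zS SD by (intro f0) (auto simp: z_def)
    then have "\<bar>f y $ k\<bar> \<le> norm (f y - f z)" using component_le_norm_cart[of "f y - f z" k] by simp
    ultimately show ?thesis by linarith
  qed
  then show ?thesis using r1(1) r2(1) by (intro exI[of _ r]) (auto simp: r_def)
qed

text \<open>The times at which the component vanishes form an open set by Gronwall's inequality and
  a closed one by continuity. By connectedness a single zero would spread to time 0; a change of
  sign is excluded by the intermediate value theorem.\<close>

lemma component_stays_positive:
  fixes f :: "real^'n::finite \<Rightarrow> real^'n"
  assumes D: "openin (top_of_set (coord_space K)) D" and C1: "C1_on D f" and k: "k \<in> K"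
    and f0: "\<And>y. y \<in> D \<Longrightarrow> y $ k = 0 \<Longrightarrow> f y $ k = 0"
    and x: "solution D f T x" and pos: "x 0 $ k > 0" and t: "t \<in> T"
  shows "x t $ k > 0"
proof (rule ccontr)
  assume "\<not> x t $ k > 0"
  have T: "open T" "is_interval T" "0 \<in> T" and xD: "\<And>t. t \<in> T \<Longrightarrow> x t \<in> D"
    and xd: "\<And>t. t \<in> T \<Longrightarrow> (x has_vector_derivative f (x t)) (at t)"
    using x by (auto simp: solution_def)
  have zd: "((\<lambda>t. x t $ k) has_vector_derivative f (x t) $ k) (at t)" if "t \<in> T" for t
    by (rule bounded_linear.has_vector_derivative[OF bounded_linear_vec_nth xd[OF that]])
  have zc: "isCont (\<lambda>t. x t $ k) t" if "t \<in> T" for t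
    using zd[OF that] by (rule has_vector_derivative_continuous)
  have conn: "connected T" using T(2) by (simp add: is_interval_connected_1)
  have zcT: "continuous_on T (\<lambda>t. x t $ k)"
    by (rule continuous_at_imp_continuous_on) (use zc in blast)
  have "is_interval ((\<lambda>t. x t $ k) ` T)"
    unfolding is_interval_connected_1 by (rule connected_continuous_image[OF zcT conn])
  from mem_is_interval_1_I[OF this imageI[OF t] imageI[OF T(3)], of 0]
  have "0 \<in> (\<lambda>t. x t $ k) ` T" using pos \<open>\<not> x t $ k > 0\<close> by simp
  then obtain s where s: "s \<in> T" "x s $ k = 0" by force
  have "x 0 $ k = 0"
  proof (rule connected_induction_simple[OF conn s(1) T(3), of "\<lambda>t. x t $ k = 0"])
    fix a assume a: "a \<in> T"
    show "\<exists>S. openin (top_of_set T) S \<and> a \<in> S \<and> (\<forall>x'\<in>S. \<forall>y\<in>S. x x' $ k = 0 \<longrightarrow> x y $ k = 0)"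
    proof (cases "x a $ k = 0")
      case False
      have "open ((\<lambda>t. x t $ k) -` (- {0}) \<inter> T)"
        using iffD1[OF continuous_on_open_vimage[OF T(1)] zcT] by auto
      then show ?thesis
        using False a by (intro exI[of _ "(\<lambda>t. x t $ k) -` (- {0}) \<inter> T"]) (auto intro: open_subset)
    next
      case True
      obtain r B where r: "r > 0" "\<And>y. y \<in> D \<Longrightarrow> dist y (x a) < r \<Longrightarrow> \<bar>f y $ k\<bar> \<le> B * \<bar>y $ k\<bar>"
        using C1_field_component_bound[OF D C1 k f0 xD[OF a] True] by blast
      have "isCont x a" using xd[OF a] by (rule has_vector_derivative_continuous)
      then obtain \<epsilon> where \<epsilon>: "\<epsilon> > 0" "\<And>t. dist t a < \<epsilon> \<Longrightarrow> dist (x t) (x a) < r"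
        using r(1) unfolding continuous_at_eps_delta by blast
      define S where "S = T \<inter> ball a \<epsilon>"
      have iS: "is_interval S" unfolding S_def by (intro is_interval_Int T) (simp add: is_interval_ball_real)
      have "x y $ k = 0" if y: "y \<in> S" for y
      proof (rule vector_derivative_zero_of_norm_bound[OF iS, of a "\<lambda>t. x t $ k"])
        show "a \<in> S" using a \<epsilon>(1) by (simp add: S_def)
        show "((\<lambda>t. x t $ k) has_vector_derivative f (x t) $ k) (at t)" if "t \<in> S" for t
          using zd that by (simp add: S_def)
        show "norm (f (x t) $ k) \<le> B * norm (x t $ k)" if "t \<in> S" for t
          using r(2)[OF xD \<epsilon>(2)] that by (simp add: S_def dist_commute)
      qed (use True y in auto)
      moreover have "open S" using T(1) by (auto simp: S_def)
      ultimately show ?thesis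
        using a \<epsilon>(1) by (intro exI[of _ S]) (auto simp: S_def intro!: open_subset)
    qed
  qed (use s in auto)
  then show False using pos by simp
qed

lemma slow_manifold_eq:
  assumes "k \<notin> J" "I \<inter> J = {}" "insert k (I \<union> J) = UNIV"
  shows "slow_manifold J \<Omega> = \<Omega> \<inter> coord_space (insert k I)"
proof -
  have "i \<in> J \<longleftrightarrow> i \<notin> insert k I" for i using assms by blast
  then have "blk J x = 0 \<longleftrightarrow> x \<in> coord_space (insert k I)" for x
    by (auto simp: blk_def coord_space_def vec_eq_iff)
  then show ?thesis by (auto simp: slow_manifold_def)
qed

text \<open>When \<open>um\<close> is 0 the bracket of the \<open>G0m\<close> terms cancels, and the
  last block is \<open>1 / z\<close> times 0, hence 0 even where \<open>z = 0\<close>.\<close>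

lemma sing_field_eq_reduced_field:
  assumes "blk J x = 0"
  shows "sing_field k I J G10 G1m G01 G0m Gs x = reduced_field k I G10 G01 x"
  unfolding sing_field_def reduced_field_def Let_def assms by (auto simp: vec_eq_iff)

text \<open>The fast variable satisfies \<open>\<bar>u'\<bar> \<le> B \<bar>u\<bar>\<close> as long as \<open>\<zeta>\<close> is bounded away from zero,
  hence it stays zero.\<close>

lemma fast_variable_stays_zero:
  fixes Gs :: "real \<Rightarrow> real^'n::finite \<Rightarrow> real^'n \<Rightarrow> real^'n^'n"
  assumes kJ: "k \<notin> J" "I \<inter> J = {}"
    and cGs: "continuous_on \<Omega> (\<lambda>x. Gs (x $ k) (blk I x) (blk J x))"
    and x: "solution (sing_domain k J \<Omega>) (sing_field k I J G10 G1m G01 G0m Gs) T x"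
    and pos: "x 0 $ k > 0" and x0: "blk J (x 0) = 0"
  shows "\<exists>\<epsilon>>0. \<forall>t\<in>T. \<bar>t\<bar> < \<epsilon> \<longrightarrow> blk J (x t) = 0"
proof -
  let ?f = "sing_field k I J G10 G1m G01 G0m Gs"
  let ?G = "\<lambda>x. Gs (x $ k) (blk I x) (blk J x)"
  have T: "open T" "is_interval T" "0 \<in> T" and x\<Omega>: "\<And>t. t \<in> T \<Longrightarrow> x t \<in> \<Omega>"
    and xd: "\<And>t. t \<in> T \<Longrightarrow> (x has_vector_derivative ?f (x t)) (at t)"
    using x by (auto simp: solution_def sing_domain_def)
  have cx: "continuous_on T x"
    by (intro continuous_at_imp_continuous_on ballI has_vector_derivative_continuous[OF xd])
  have "continuous_on T (\<lambda>t. ?G (x t))"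
    by (rule continuous_on_compose2[OF cGs cx]) (use x\<Omega> in auto)
  then obtain \<epsilon>1 where \<epsilon>1: "\<epsilon>1 > 0" "\<And>t. t \<in> T \<Longrightarrow> dist t 0 < \<epsilon>1 \<Longrightarrow> dist (?G (x t)) (?G (x 0)) < 1"
    using T(3) zero_less_one unfolding continuous_on_iff by metis
  \<comment> \<open>Half the initial value of \<zeta>: for short times \<zeta> stays above
    \<open>c\<close>, which bounds the singular factor by \<open>1 / c\<close>.\<close>
  define c where "c = x 0 $ k / 2"
  have c: "c > 0" using pos by (simp add: c_def)
  have "continuous_on T (\<lambda>t. x t $ k)" by (intro continuous_intros cx)
  then obtain \<epsilon>2 where \<epsilon>2: "\<epsilon>2 > 0" "\<And>t. t \<in> T \<Longrightarrow> dist t 0 < \<epsilon>2 \<Longrightarrow> dist (x t $ k) (x 0 $ k) < c"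
    using T(3) c unfolding continuous_on_iff by metis
  define \<epsilon> where "\<epsilon> = min \<epsilon>1 \<epsilon>2"
  define S where "S = T \<inter> {-\<epsilon><..<\<epsilon>}"
  define B where "B = real CARD('n) * (norm (?G (x 0)) + 1) / c"
  have S: "is_interval S" unfolding S_def by (intro is_interval_Int T is_interval_oo)
  have "blk J (x t) = 0" if t: "t \<in> S" for t
  proof (rule vector_derivative_zero_of_norm_bound[OF S, of 0 "\<lambda>t. blk J (x t)"])
    show "0 \<in> S" using T(3) \<epsilon>1(1) \<epsilon>2(1) by (auto simp: S_def \<epsilon>_def)
    show "((\<lambda>t. blk J (x t)) has_vector_derivative blk J (?f (x t))) (at t)" if "t \<in> S" for t
      using that by (intro bounded_linear.has_vector_derivative[OF bounded_linear_blk] xd) (simp add: S_def)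
    show "norm (blk J (?f (x t))) \<le> B * norm (blk J (x t))" if "t \<in> S" for t
    proof -
      have t: "t \<in> T" "dist t 0 < \<epsilon>1" "dist t 0 < \<epsilon>2" using that by (auto simp: S_def \<epsilon>_def)
      have z: "x t $ k > c" using \<epsilon>2(2)[OF t(1,3)] unfolding dist_real_def c_def by linarith
      have G: "norm (?G (x t)) \<le> norm (?G (x 0)) + 1"
        using \<epsilon>1(2)[OF t(1,2)] norm_triangle_ineq2[of "?G (x t)" "?G (x 0)"] by (simp add: dist_norm)
      have "blk J (?f (x t)) = (1 / x t $ k) *\<^sub>R blk J (?G (x t) *v blk J (x t))"
        using kJ by (auto simp: sing_field_def Let_def blk_def vec_eq_iff)
      then have "norm (blk J (?f (x t))) = norm (blk J (?G (x t) *v blk J (x t))) / x t $ k"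
        using z c by simp
      also have "\<dots> \<le> norm (?G (x t) *v blk J (x t)) / x t $ k"
        using z c by (intro divide_right_mono norm_blk_le) auto
      also have "\<dots> \<le> (real CARD('n) * (norm (?G (x 0)) + 1) * norm (blk J (x t))) / c"
        using z c by (intro frac_le order_trans[OF norm_matrix_vector_mult_le] mult_right_mono
            mult_left_mono G) auto
      finally show ?thesis by (simp add: B_def)
    qed
  qed (use x0 t in auto)
  then show ?thesis using \<epsilon>1(1) \<epsilon>2(1) by (intro exI[of _ \<epsilon>]) (auto simp: S_def \<epsilon>_def abs_less_iff)
qed

text \<open>Invariance appears in two forms. For the reduced system it is part of being a center
  manifold; for the singular system it is a further claim, since a solution that starts on the slow
  manifold might leave it, and it is made for starting points with positive \<zeta>. Being non
  singular is expressed by agreement with the reduced field and continuous differentiability on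
  \<open>M00\<close>.\<close>

theorem theorem4p1:
  fixes \<phi>s \<phi>ns F :: "real^'n \<Rightarrow> real^'n" and \<zeta> :: "real^'n \<Rightarrow> real" and \<delta> :: real
    and S :: "(real^'n) set"
    and \<Phi> :: "real^'n \<Rightarrow> real^'n" and \<Omega> :: "(real^'n) set"
    and k :: 'n and I J :: "'n set"
    and G10 :: "real \<Rightarrow> real^'n \<Rightarrow> real^'n"
    and G1m :: "real \<Rightarrow> real^'n \<Rightarrow> real^'n \<Rightarrow> real^'n"
    and G01 :: "real \<Rightarrow> real^'n \<Rightarrow> real^'n^'n"
    and G0m Gs :: "real \<Rightarrow> real^'n \<Rightarrow> real^'n \<Rightarrow> real^'n^'n"
  assumes smooth: "C2_on UNIV \<phi>s" "C2_on UNIV \<phi>ns" "C2_on UNIV \<zeta>"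
    and F_eq: "\<And>U. F U = \<phi>s U + \<zeta> U *\<^sub>R \<phi>ns U"
    and F_0: "F 0 = 0" and \<zeta>_0: "\<zeta> 0 = 0"
    and S_eq: "S = {U. \<zeta> U = 0}"
    and \<delta>_pos: "\<delta> > 0"
    and hyp_ii: "\<And>U. norm U \<ge> 2 * \<delta> \<Longrightarrow> F U = 0"
    and hyp_iii: "\<And>\<mu>. \<mu> \<in> eigenvalues_on UNIV (jacobian F (at 0)) \<Longrightarrow> Re \<mu> \<le> 0"
    and hyp_iv: "grad \<zeta> 0 \<noteq> 0"
    and hyp_v: "\<And>Mc U. center_manifold UNIV UNIV F Mc \<Longrightarrow> norm U \<le> \<delta> \<Longrightarrow> U \<in> Mc \<inter> S \<Longrightarrow> F U = 0"
    and hyp_vi: "\<exists>Meq d. submanifold (d + 1) Meq \<and> 0 \<in> Meq \<and> (\<forall>U\<in>Meq. F U = 0)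
                   \<and> submanifold d (S \<inter> Meq)"
    and hyp_vii: "\<And>U. U \<in> S \<Longrightarrow> grad \<zeta> U \<bullet> F U = 0"
    and hyp_viii: "\<And>U. U \<in> S \<Longrightarrow> F U = 0
                     \<Longrightarrow> ((\<lambda>V. (grad \<zeta> V \<bullet> F V) / \<zeta> V) \<longlongrightarrow> 0) (at U within - S)"
    and coords: "slow_fast_coordinates F \<zeta> \<delta> \<Phi> \<Omega> k I J G10 G1m G01 G0m Gs"
  shows "\<exists>M00. sing_center_manifold k I J \<Omega> G10 G01 M00
    \<and> M00 \<subseteq> slow_manifold J \<Omega>
    \<and> (\<forall>T x. solution (sing_domain k J \<Omega>) (sing_field k I J G10 G1m G01 G0m Gs) T x
          \<and> x 0 \<in> M00 \<and> x 0 $ k > 0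
          \<longrightarrow> (\<exists>\<epsilon>>0. \<forall>t\<in>T. \<bar>t\<bar> < \<epsilon> \<longrightarrow> x t \<in> M00))
    \<and> (\<forall>x\<in>M00. sing_field k I J G10 G1m G01 G0m Gs x = reduced_field k I G10 G01 x)
    \<and> C1_on M00 (sing_field k I J G10 G1m G01 G0m Gs)
    \<and> (\<forall>T x. solution (sing_domain k J \<Omega>) (sing_field k I J G10 G1m G01 G0m Gs) T x
          \<and> (\<forall>t\<in>T. x t \<in> M00) \<and> x 0 $ k > 0
          \<longrightarrow> (\<forall>t\<in>T. x t $ k > 0))"
proof -
  let ?K = "insert k I" and ?D = "slow_manifold J \<Omega>" and ?f = "reduced_field k I G10 G01"
  let ?s = "sing_field k I J G10 G1m G01 G0m Gs"
  have kIJ: "k \<notin> I" "k \<notin> J" "I \<inter> J = {}" "insert k (I \<union> J) = UNIV"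
    and diffeo: "C1_diffeo (ball 0 \<delta>) \<Omega> \<Phi>" and \<Phi>0: "\<Phi> 0 = 0"
    and C1: "C1_on ?D ?f"
    and cGs: "continuous_on \<Omega> (\<lambda>x. Gs (x $ k) (blk I x) (blk J x))"
    using coords unfolding slow_fast_coordinates_def by blast+
  have \<Omega>: "open \<Omega>" "0 \<in> \<Omega>"
    using diffeo \<Phi>0 \<delta>_pos unfolding C1_diffeo_def bij_betw_def by force+
  have D_eq: "?D = \<Omega> \<inter> coord_space ?K" by (rule slow_manifold_eq[OF kIJ(2-4)])
  have D: "openin (top_of_set (coord_space ?K)) ?D"
    unfolding D_eq using \<Omega>(1) by (auto simp: openin_open Int_commute)
  have D0: "0 \<in> ?D" using \<Omega>(2) by (simp add: D_eq coord_space_def)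
  have blk_0: "blk I 0 = (0 :: real^'n)" by (simp add: blk_def vec_eq_iff)
  have f0: "?f 0 = 0" unfolding reduced_field_def Let_def blk_0 by (simp add: vec_eq_iff)
  obtain M where M: "center_manifold ?K ?D ?f M"
    using center_manifold_exists[OF D D0 f0 C1] by (auto simp: reduced_field_def coord_space_def Let_def)
  have MD: "M \<subseteq> ?D" and inv: "locally_invariant ?D ?f M"
    using M unfolding center_manifold_def by auto
  have blk0: "blk J y = 0" if "y \<in> ?D" for y using that by (simp add: slow_manifold_def)
  have eq: "?s y = ?f y" if "y \<in> ?D" for y
    by (rule sing_field_eq_reduced_field[OF blk0[OF that]])
  \<comment> \<open>The fast variable is first shown to stay 0 for a short time. During that time
    the solution also solves the reduced system, whose local invariance then keeps it in
    \<open>M\<close>.\<close>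
  have stays: "\<exists>\<epsilon>>0. \<forall>t\<in>T. \<bar>t\<bar> < \<epsilon> \<longrightarrow> x t \<in> M"
    if x: "solution (sing_domain k J \<Omega>) ?s T x" and x0: "x 0 \<in> M" "x 0 $ k > 0" for T x
  proof -
    obtain \<epsilon>1 where \<epsilon>1: "\<epsilon>1 > 0" "\<And>t. t \<in> T \<Longrightarrow> \<bar>t\<bar> < \<epsilon>1 \<Longrightarrow> blk J (x t) = 0"
      using fast_variable_stays_zero[OF kIJ(2,3) cGs x x0(2)] blk0 MD x0(1) by blast
    define S where "S = T \<inter> {-\<epsilon>1<..<\<epsilon>1}"
    have xS: "x t \<in> ?D" "x t \<in> \<Omega>" if "t \<in> S" for t
      using that x \<epsilon>1(2)[of t] by (auto simp: S_def solution_def sing_domain_def slow_manifold_def)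
    have "open S" "is_interval S" "0 \<in> S"
      using x \<epsilon>1(1) unfolding S_def solution_def by (auto intro!: is_interval_Int is_interval_oo)
    then have "solution ?D ?f S x"
      using x xS eq unfolding solution_def by (auto simp: S_def)
    then obtain \<epsilon>2 where "\<epsilon>2 > 0" "\<And>t. t \<in> S \<Longrightarrow> \<bar>t\<bar> < \<epsilon>2 \<Longrightarrow> x t \<in> M"
      using inv x0(1) unfolding locally_invariant_def by blast
    then show ?thesis
      using \<epsilon>1(1) by (intro exI[of _ "min \<epsilon>1 \<epsilon>2"]) (auto simp: S_def abs_less_iff)
  qed
  have smooth_M: "C1_on M ?s"
  proof -
    obtain f' :: "real^'n \<Rightarrow> (real^'n) \<Rightarrow>\<^sub>L (real^'n)"
      where f': "\<And>x. x \<in> ?D \<Longrightarrow> (?f has_derivative blinfun_apply (f' x)) (at x within ?D)"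
      and cf': "continuous_on ?D f'"
      using C1 unfolding C1_on_def by blast
    have "(?s has_derivative blinfun_apply (f' y)) (at y within M)" if y: "y \<in> M" for y
    proof (rule has_derivative_transform[OF y])
      show "?s z = ?f z" if "z \<in> M" for z using eq MD that by blast
      show "(?f has_derivative blinfun_apply (f' y)) (at y within M)"
        by (rule has_derivative_subset[OF f' MD]) (use y MD in blast)
    qed
    then show ?thesis
      unfolding C1_on_def using continuous_on_subset[OF cf' MD] by blast
  qed
  \<comment> \<open>On \<open>M\<close> the solution obeys the reduced system, in which the
    k-component of the field carries the factor \<zeta> and so vanishes together with it.\<close>
  have positive: "x t $ k > 0"
    if x: "solution (sing_domain k J \<Omega>) ?s T x" and xM: "\<forall>t\<in>T. x t \<in> M" and pos: "x 0 $ k > 0"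
      and t: "t \<in> T" for T x t
  proof (rule component_stays_positive[OF D C1 insertI1, where x = x and T = T])
    show "?f y $ k = 0" if "y $ k = 0" for y using that by (simp add: reduced_field_def Let_def)
    show "solution ?D ?f T x"
      using x xM MD eq unfolding solution_def by (auto simp: subset_iff)
  qed (use pos t in auto)
  show ?thesis
    using M MD stays eq smooth_M positive unfolding sing_center_manifold_def
    by (intro exI[of _ M] conjI) blast+
qed

end
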